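(* Let $(M,g,V,\lambda,\mu)$ be an $\eta$-Ricci soliton (that is, an $\eta$-Ricci-Yamabe soliton of type $(1,0)$) with vertical potential field $V$, and let $\pi:(M,g)\to(N,g_N)$ be a Riemannian submersion between Riemannian manifolds. If the vertical distribution $\mathcal{V}$ is parallel, then any fiber of $\pi$ is an $\eta$-Ricci soliton.
   Context: All manifolds, maps and tensor fields are smooth. A Riemannian submersion $\pi:(M,g)\to(N,g_N)$, with $\dim M>\dim N$, is a surjective map of rank $\dim N$ whose differential preserves the lengths of horizontal vectors. The vertical distribution is $\mathcal{V}=\ker\pi_*$; the horizontal distribution is its $g$-orthogonal complement. A vector field is vertical if it is a section of $\mathcal{V}$. $\mathcal{V}$ is parallel if $\nabla_E F$ is vertical for every vector field $E$ on $M$ and every vertical $F$, where $\nabla$ is the Levi-Civita connection of $g$. Given a $1$-form $\eta$, a vector field $V$ (the potential field) and real constants $\lambda,\mu$, the data $(M,g,V,\lambda,\mu)$ is an $\eta$-Ricci soliton if $\mathcal{L}_V g+2S+2\lambda g+2\mu\,\eta\otimes\eta=0$, where $S$ is the Ricci tensor of $g$. A fiber $\pi^{-1}(q)$ with induced metric $\hat g$ and Ricci tensor $\hat S$ is an $\eta$-Ricci soliton if this equation holds on the fiber, for some real constants in the places of $\lambda,\mu$, with $\hat g,\hat S$ in place of $g,S$ and with $V$ and $\eta$ restricted to the fiber. *)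

theory Defs
  imports "HOL-Analysis.Analysis"
begin

section \<open>Smooth manifolds\<close>

subsection \<open>Smooth maps between open subsets of finite-dimensional spaces\<close>

text \<open>For an open set of a finite-dimensional space, being of class $C^{k+1}$ is the same as being
  differentiable with all directional derivatives of class $C^k$.\<close>

primrec Ck_on :: "nat \<Rightarrow> 'a::real_normed_vector set \<Rightarrow> ('a \<Rightarrow> 'b::real_normed_vector) \<Rightarrow> bool" where
  "Ck_on 0 S f \<longleftrightarrow> continuous_on S f"
| "Ck_on (Suc k) S f \<longleftrightarrow>
     (\<forall>x\<in>S. f differentiable (at x)) \<and> (\<forall>v. Ck_on k S (\<lambda>x. frechet_derivative f (at x) v))"

definition smooth_on :: "'a::real_normed_vector set \<Rightarrow> ('a \<Rightarrow> 'b::real_normed_vector) \<Rightarrow> bool" where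
  "smooth_on S f \<longleftrightarrow> (\<forall>k. Ck_on k S f)"

subsection \<open>Charts and smooth structures\<close>

text \<open>A chart is a pair of a domain and a coordinate map; the values of the map outside the domain
  are irrelevant.\<close>

type_synonym ('m, 'a) chart = "'m set \<times> ('m \<Rightarrow> 'a)"

abbreviation dom_chart :: "('m, 'a) chart \<Rightarrow> 'm set" where
  "dom_chart c \<equiv> fst c"

abbreviation img_chart :: "('m, 'a) chart \<Rightarrow> 'a set" where
  "img_chart c \<equiv> snd c ` fst c"

abbreviation inv_chart :: "('m, 'a) chart \<Rightarrow> 'a \<Rightarrow> 'm" where
  "inv_chart c \<equiv> inv_into (fst c) (snd c)"

definition chart_of :: "'m topology \<Rightarrow> ('m, 'a::real_normed_vector) chart \<Rightarrow> bool" where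
  "chart_of X c \<longleftrightarrow> openin X (dom_chart c) \<and> open (img_chart c) \<and>
     homeomorphic_map (subtopology X (dom_chart c)) (top_of_set (img_chart c)) (snd c)"

definition local_rep :: "('m \<Rightarrow> 'n) \<Rightarrow> ('m, 'a) chart \<Rightarrow> ('n, 'b) chart \<Rightarrow> 'a \<Rightarrow> 'b" where
  "local_rep f c d = snd d \<circ> f \<circ> inv_chart c"

text \<open>\<open>smooth_wrt f c d\<close>: the coordinate expression of \<open>f\<close> is smooth where it is defined.\<close>

definition smooth_wrt ::
  "('m \<Rightarrow> 'n) \<Rightarrow> ('m, 'a::real_normed_vector) chart \<Rightarrow> ('n, 'b::real_normed_vector) chart \<Rightarrow> bool" where
  "smooth_wrt f c d \<longleftrightarrow>
     smooth_on (snd c ` {p \<in> dom_chart c. f p \<in> dom_chart d}) (local_rep f c d)"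

text \<open>The differential of \<open>f\<close> at \<open>p\<close>, expressed in the charts \<open>c\<close> around \<open>p\<close> and \<open>d\<close> around \<open>f p\<close>.\<close>

definition differential ::
  "('m \<Rightarrow> 'n) \<Rightarrow> ('m, 'a::real_normed_vector) chart \<Rightarrow> ('n, 'b::real_normed_vector) chart
    \<Rightarrow> 'm \<Rightarrow> 'a \<Rightarrow> 'b" where
  "differential f c d p = frechet_derivative (local_rep f c d) (at (snd c p))"

text \<open>The model space is only required to be a finite-dimensional normed space, and not to be of class
  \<open>euclidean_space\<close>, because the latter excludes dimension 0.\<close>

definition smooth_manifold :: "'m topology \<Rightarrow> ('m, 'a::real_normed_vector) chart set \<Rightarrow> bool" where
  "smooth_manifold X A \<longleftrightarrow>
     (\<exists>B::'a set. finite B \<and> span B = UNIV) \<and>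
     Hausdorff_space X \<and> second_countable X \<and>
     (\<forall>c\<in>A. chart_of X c) \<and>
     (\<Union>c\<in>A. dom_chart c) = topspace X \<and>
     (\<forall>c\<in>A. \<forall>d\<in>A. smooth_wrt id c d) \<and>
     (\<forall>c. chart_of X c \<and> (\<forall>d\<in>A. smooth_wrt id c d \<and> smooth_wrt id d c) \<longrightarrow> c \<in> A)"

definition smooth_map ::
  "'m topology \<Rightarrow> ('m, 'a::real_normed_vector) chart set \<Rightarrow>
   'n topology \<Rightarrow> ('n, 'b::real_normed_vector) chart set \<Rightarrow> ('m \<Rightarrow> 'n) \<Rightarrow> bool" where
  "smooth_map X A Y B f \<longleftrightarrow> continuous_map X Y f \<and> (\<forall>c\<in>A. \<forall>d\<in>B. smooth_wrt f c d)"

subsection \<open>Tensor fields\<close>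

text \<open>A tensor field is given by its components in all charts of the atlas, as functions of the
  coordinates, subject to the transformation law under changes of charts.\<close>

type_synonym ('m, 'a) vfield = "('m, 'a) chart \<Rightarrow> 'a \<Rightarrow> 'a"
type_synonym ('m, 'a) oneform = "('m, 'a) chart \<Rightarrow> 'a \<Rightarrow> 'a \<Rightarrow> real"
type_synonym ('m, 'a) metric = "('m, 'a) chart \<Rightarrow> 'a \<Rightarrow> 'a \<Rightarrow> 'a \<Rightarrow> real"

definition vector_field :: "('m, 'a::real_normed_vector) chart set \<Rightarrow> ('m, 'a) vfield \<Rightarrow> bool" where
  "vector_field A V \<longleftrightarrow>
     (\<forall>c\<in>A. smooth_on (img_chart c) (V c)) \<and>
     (\<forall>c\<in>A. \<forall>d\<in>A. \<forall>p \<in> dom_chart c \<inter> dom_chart d.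
        V d (snd d p) = differential id c d p (V c (snd c p)))"

definition one_form :: "('m, 'a::real_normed_vector) chart set \<Rightarrow> ('m, 'a) oneform \<Rightarrow> bool" where
  "one_form A \<eta> \<longleftrightarrow>
     (\<forall>c\<in>A. \<forall>x \<in> img_chart c. linear (\<eta> c x)) \<and>
     (\<forall>c\<in>A. \<forall>u. smooth_on (img_chart c) (\<lambda>x. \<eta> c x u)) \<and>
     (\<forall>c\<in>A. \<forall>d\<in>A. \<forall>p \<in> dom_chart c \<inter> dom_chart d. \<forall>u.
        \<eta> c (snd c p) u = \<eta> d (snd d p) (differential id c d p u))"

definition riemannian_metric :: "('m, 'a::real_normed_vector) chart set \<Rightarrow> ('m, 'a) metric \<Rightarrow> bool" where
  "riemannian_metric A g \<longleftrightarrow>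
     (\<forall>c\<in>A. \<forall>x \<in> img_chart c. bilinear (g c x) \<and>
        (\<forall>u v. g c x u v = g c x v u) \<and> (\<forall>u. u \<noteq> 0 \<longrightarrow> g c x u u > 0)) \<and>
     (\<forall>c\<in>A. \<forall>u v. smooth_on (img_chart c) (\<lambda>x. g c x u v)) \<and>
     (\<forall>c\<in>A. \<forall>d\<in>A. \<forall>p \<in> dom_chart c \<inter> dom_chart d. \<forall>u v.
        g c (snd c p) u v = g d (snd d p) (differential id c d p u) (differential id c d p v))"

definition riemannian_manifold ::
  "'m topology \<Rightarrow> ('m, 'a::real_normed_vector) chart set \<Rightarrow> ('m, 'a) metric \<Rightarrow> bool" where
  "riemannian_manifold X A g \<longleftrightarrow> smooth_manifold X A \<and> riemannian_metric A g"

section \<open>Riemannian geometry in a chart\<close>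

text \<open>Here \<open>h\<close> is a metric and \<open>X\<close>, \<open>Y\<close>, \<open>Z\<close> are vector fields on an open subset of the model
  space. Constant fields \<open>\<lambda>_. u\<close> are the combinations of the coordinate fields with constant
  coefficients.\<close>

definition lie_bracket :: "('a::real_normed_vector \<Rightarrow> 'a) \<Rightarrow> ('a \<Rightarrow> 'a) \<Rightarrow> 'a \<Rightarrow> 'a" where
  "lie_bracket X Y x = frechet_derivative Y (at x) (X x) - frechet_derivative X (at x) (Y x)"

text \<open>The connection coefficients of the Levi-Civita connection at \<open>x\<close>: \<open>\<Gamma> u v\<close> is the covariant
  derivative of the constant field \<open>v\<close> in direction \<open>u\<close>. As constant fields commute, symmetry of
  \<open>\<Gamma>\<close> says that the connection is torsion-free; the second condition is metric compatibility.\<close>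

definition levi_civita_coeffs ::
  "('a::real_normed_vector \<Rightarrow> 'a \<Rightarrow> 'a \<Rightarrow> real) \<Rightarrow> 'a \<Rightarrow> ('a \<Rightarrow> 'a \<Rightarrow> 'a) \<Rightarrow> bool" where
  "levi_civita_coeffs h x \<Gamma> \<longleftrightarrow> bilinear \<Gamma> \<and> (\<forall>u v. \<Gamma> u v = \<Gamma> v u) \<and>
     (\<forall>u v w. frechet_derivative (\<lambda>y. h y u v) (at x) w = h x (\<Gamma> w u) v + h x u (\<Gamma> w v))"

definition christoffel :: "('a::real_normed_vector \<Rightarrow> 'a \<Rightarrow> 'a \<Rightarrow> real) \<Rightarrow> 'a \<Rightarrow> 'a \<Rightarrow> 'a \<Rightarrow> 'a" where
  "christoffel h x = (THE \<Gamma>. levi_civita_coeffs h x \<Gamma>)"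

definition nabla ::
  "('a::real_normed_vector \<Rightarrow> 'a \<Rightarrow> 'a \<Rightarrow> real) \<Rightarrow> ('a \<Rightarrow> 'a) \<Rightarrow> ('a \<Rightarrow> 'a) \<Rightarrow> 'a \<Rightarrow> 'a" where
  "nabla h X Y x = frechet_derivative Y (at x) (X x) + christoffel h x (X x) (Y x)"

definition curvature ::
  "('a::real_normed_vector \<Rightarrow> 'a \<Rightarrow> 'a \<Rightarrow> real) \<Rightarrow> ('a \<Rightarrow> 'a) \<Rightarrow> ('a \<Rightarrow> 'a) \<Rightarrow> ('a \<Rightarrow> 'a) \<Rightarrow> 'a \<Rightarrow> 'a" where
  "curvature h X Y Z x =
     nabla h X (nabla h Y Z) x - nabla h Y (nabla h X Z) x - nabla h (lie_bracket X Y) Z x"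

text \<open>\<open>S(u, v)\<close> is the trace of \<open>w \<mapsto> R(w, u) v\<close>. The trace of an endomorphism does not depend on the
  basis; no orthonormality with respect to \<open>h\<close> is involved.\<close>

definition ricci :: "('a::euclidean_space \<Rightarrow> 'a \<Rightarrow> 'a \<Rightarrow> real) \<Rightarrow> 'a \<Rightarrow> 'a \<Rightarrow> 'a \<Rightarrow> real" where
  "ricci h x u v = (\<Sum>b\<in>Basis. curvature h (\<lambda>_. b) (\<lambda>_. u) (\<lambda>_. v) x \<bullet> b)"

text \<open>\<open>(L\<^sub>V h)(X, Y) = V (h(X, Y)) - h([V, X], Y) - h(X, [V, Y])\<close>, evaluated on the
  constant fields \<open>X = u\<close> and \<open>Y = v\<close>.\<close>

definition lie_deriv_metric ::
  "('a::real_normed_vector \<Rightarrow> 'a) \<Rightarrow> ('a \<Rightarrow> 'a \<Rightarrow> 'a \<Rightarrow> real) \<Rightarrow> 'a \<Rightarrow> 'a \<Rightarrow> 'a \<Rightarrow> real" where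
  "lie_deriv_metric V h x u v =
     frechet_derivative (\<lambda>y. h y u v) (at x) (V x)
     - h x (lie_bracket V (\<lambda>_. u) x) v - h x u (lie_bracket V (\<lambda>_. v) x)"

text \<open>Existence and uniqueness of the Levi-Civita connection, so that \<open>christoffel\<close> is well defined.\<close>

lemma riesz_bilinear:
  fixes b :: "'a::euclidean_space \<Rightarrow> 'a \<Rightarrow> real"
  assumes "bilinear b" "\<And>u. u \<noteq> 0 \<Longrightarrow> b u u > 0" "linear f"
  shows "\<exists>z. \<forall>w. b z w = f w"
proof -
  have lin1: "linear (\<lambda>z. b z w)" and lin2: "linear (b w)" for w
    using assms(1) unfolding bilinear_def by auto
  define L where "L z = (\<Sum>i\<in>Basis. b z i *\<^sub>R i)" for z
  have rep: "F w = (\<Sum>i\<in>Basis. F i *\<^sub>R i) \<bullet> w" if "linear F" for F :: "'a \<Rightarrow> real" and w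
  proof -
    have "F w = F (\<Sum>i\<in>Basis. (w \<bullet> i) *\<^sub>R i)" by (simp add: euclidean_representation)
    also have "\<dots> = (\<Sum>i\<in>Basis. (w \<bullet> i) * F i)"
      using that by (simp add: linear_sum linear_scale)
    finally show ?thesis by (simp add: inner_sum_left inner_sum_right inner_commute mult.commute)
  qed
  have Lw: "L z \<bullet> w = b z w" for z w
    unfolding L_def by (rule rep[OF lin2, symmetric])
  have "linear L"
    unfolding L_def
    by (rule linear_compose_sum, intro ballI linearI)
       (simp_all add: linear_add[OF lin1] linear_scale[OF lin1] scaleR_add_left)
  moreover have "inj L"
    using Lw assms(2) by (subst linear_injective_0[OF \<open>linear L\<close>]) (metis inner_zero_left less_irrefl)
  ultimately have "surj L" by (rule linear_injective_imp_surjective) simp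
  then obtain z where z: "L z = (\<Sum>i\<in>Basis. f i *\<^sub>R i)" by (metis surjD)
  have "b z w = f w" for w
    unfolding Lw[symmetric] z by (rule rep[OF assms(3), symmetric])
  then show ?thesis by blast
qed

lemma levi_civita_ex1:
  fixes h :: "'a::euclidean_space \<Rightarrow> 'a \<Rightarrow> 'a \<Rightarrow> real"
  assumes "open U" "x \<in> U"
    and bil: "\<And>y. y \<in> U \<Longrightarrow> bilinear (h y)"
    and sym: "\<And>y u v. y \<in> U \<Longrightarrow> h y u v = h y v u"
    and pos: "\<And>u. u \<noteq> 0 \<Longrightarrow> h x u u > 0"
    and diff: "\<And>u v. (\<lambda>y. h y u v) differentiable (at x)"
  shows "\<exists>!\<Gamma>. levi_civita_coeffs h x \<Gamma>"
proof -
  define D where "D u v = frechet_derivative (\<lambda>y. h y u v) (at x)" for u v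
  have hD: "((\<lambda>y. h y u v) has_derivative D u v) (at x)" for u v
    unfolding D_def using diff frechet_derivative_works by blast
  have DI: "D u v = F" if "(f has_derivative F) (at x)" "\<And>y. y \<in> U \<Longrightarrow> f y = h y u v" for u v f F
    using has_derivative_transform_within_open[OF that(1) assms(1,2), of "\<lambda>y. h y u v"] that(2)
      has_derivative_unique[OF hD] by metis
  have Dlin: "linear (D u v)" for u v
    using hD has_derivative_linear by blast
  have Dsym: "D u v = D v u" for u v
    by (rule DI[OF hD]) (simp add: sym)
  have "D u (v + v') = (\<lambda>w. D u v w + D u v' w)" for u v v'
    by (rule DI[OF has_derivative_add[OF hD[of u v] hD[of u v']]]) (simp add: bilinear_radd bil)
  then have Dadd: "D u (v + v') w = D u v w + D u v' w" for u v v' w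
    by simp
  have "D u (r *\<^sub>R v) = (\<lambda>w. r * D u v w)" for u v r
    by (rule DI[OF has_derivative_mult_right[OF hD[of u v], of r]]) (simp add: bilinear_rmul bil)
  then have Dscale: "D u (r *\<^sub>R v) w = r * D u v w" for u v r w
    by simp
  note Dl = Dadd Dscale linear_add[OF Dlin] linear_scale[OF Dlin]
  have Dl': "D (u + u') v w = D u v w + D u' v w" "D (r *\<^sub>R u) v w = r * D u v w" for u u' v w r
    using Dadd Dscale Dsym by metis+
  define K where "K u v w = (D v w u + D u w v - D u v w) / 2" for u v w
  have "linear (K u v)" for u v
    by (rule linearI) (simp_all add: K_def Dl Dl' field_simps)
  then have "\<exists>z. \<forall>w. h x z w = K u v w" for u v
    using riesz_bilinear[OF bil[OF assms(2)] pos] by blast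
  then obtain G where G: "h x (G u v) w = K u v w" for u v w by metis
  note hb = bil[OF assms(2)]
  have eqI: "z = z'" if "\<And>w. h x z w = h x z' w" for z z'
    using that[of "z - z'"] pos[of "z - z'"] by (auto simp: bilinear_lsub[OF hb])
  have K: "2 * h x (\<Gamma> u v) w = D v w u + D u w v - D u v w" if "levi_civita_coeffs h x \<Gamma>" for \<Gamma> u v w
  proof -
    have S: "\<Gamma> a b = \<Gamma> b a" and C: "D a b c = h x (\<Gamma> c a) b + h x a (\<Gamma> c b)" for a b c
      using that unfolding levi_civita_coeffs_def D_def by blast+
    show ?thesis
      unfolding C S[of w u] S[of w v] S[of v u]
        sym[OF assms(2), of v "\<Gamma> u w"] sym[OF assms(2), of u "\<Gamma> v w"] sym[OF assms(2), of w "\<Gamma> u v"]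
      by simp
  qed
  have "levi_civita_coeffs h x G"
    unfolding levi_civita_coeffs_def D_def[symmetric]
  proof (intro conjI allI)
    show "bilinear G"
      unfolding bilinear_def
      by (intro conjI allI linearI; rule eqI)
         (simp_all add: G bilinear_ladd[OF hb] bilinear_lmul[OF hb] K_def Dl Dl' field_simps)
    show "G u v = G v u" for u v
      by (rule eqI) (simp only: G K_def Dsym[of v u] add.commute)
    show "D u v w = h x (G w u) v + h x u (G w v)" for u v w
      unfolding sym[OF assms(2), of u "G w v"] G K_def Dsym[of v u]
      by (simp add: field_simps)
  qed
  moreover have "\<Gamma> = G" if "levi_civita_coeffs h x \<Gamma>" for \<Gamma>
    by (intro ext eqI) (simp add: G K_def K[OF that, symmetric])
  ultimately show ?thesis by blast
qed

section \<open>Riemannian submersions and solitons\<close>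

definition vertical_at ::
  "('n, 'b::real_normed_vector) chart set \<Rightarrow> ('m \<Rightarrow> 'n) \<Rightarrow> ('m, 'a::real_normed_vector) chart
    \<Rightarrow> 'm \<Rightarrow> 'a \<Rightarrow> bool" where
  "vertical_at B \<pi> c p v \<longleftrightarrow> (\<forall>d\<in>B. \<pi> p \<in> dom_chart d \<longrightarrow> differential \<pi> c d p v = 0)"

definition horizontal_at ::
  "('n, 'b::real_normed_vector) chart set \<Rightarrow> ('m \<Rightarrow> 'n) \<Rightarrow> ('m, 'a::real_normed_vector) metric \<Rightarrow>
    ('m, 'a) chart \<Rightarrow> 'm \<Rightarrow> 'a \<Rightarrow> bool" where
  "horizontal_at B \<pi> g c p v \<longleftrightarrow> (\<forall>w. vertical_at B \<pi> c p w \<longrightarrow> g c (snd c p) v w = 0)"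

definition vertical_field ::
  "('m, 'a::real_normed_vector) chart set \<Rightarrow> ('n, 'b::real_normed_vector) chart set \<Rightarrow> ('m \<Rightarrow> 'n)
    \<Rightarrow> ('m, 'a) vfield \<Rightarrow> bool" where
  "vertical_field A B \<pi> V \<longleftrightarrow> (\<forall>c\<in>A. \<forall>p \<in> dom_chart c. vertical_at B \<pi> c p (V c (snd c p)))"

definition riemannian_submersion ::
  "'m topology \<Rightarrow> ('m, 'a::real_normed_vector) chart set \<Rightarrow> ('m, 'a) metric \<Rightarrow>
   'n topology \<Rightarrow> ('n, 'b::real_normed_vector) chart set \<Rightarrow> ('n, 'b) metric \<Rightarrow> ('m \<Rightarrow> 'n) \<Rightarrow> bool" where
  "riemannian_submersion X A g Y B h \<pi> \<longleftrightarrow>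
     riemannian_manifold X A g \<and> riemannian_manifold Y B h \<and>
     dim (UNIV :: 'a set) > dim (UNIV :: 'b set) \<and>
     smooth_map X A Y B \<pi> \<and> \<pi> ` topspace X = topspace Y \<and>
     (\<forall>c\<in>A. \<forall>d\<in>B. \<forall>p \<in> dom_chart c. \<pi> p \<in> dom_chart d \<longrightarrow>
        dim (range (differential \<pi> c d p)) = dim (UNIV :: 'b set) \<and>
        (\<forall>v. horizontal_at B \<pi> g c p v \<longrightarrow>
           h d (snd d (\<pi> p)) (differential \<pi> c d p v) (differential \<pi> c d p v) = g c (snd c p) v v))"

definition vertical_parallel ::
  "('m, 'a::real_normed_vector) chart set \<Rightarrow> ('m, 'a) metric \<Rightarrow> ('n, 'b::real_normed_vector) chart set
    \<Rightarrow> ('m \<Rightarrow> 'n) \<Rightarrow> bool" where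
  "vertical_parallel A g B \<pi> \<longleftrightarrow>
     (\<forall>E F. vector_field A E \<and> vector_field A F \<and> vertical_field A B \<pi> F \<longrightarrow>
        vertical_field A B \<pi> (\<lambda>c. nabla (g c) (E c) (F c)))"

definition eta_ricci_soliton ::
  "'m topology \<Rightarrow> ('m, 'a::euclidean_space) chart set \<Rightarrow> ('m, 'a) metric \<Rightarrow> ('m, 'a) oneform \<Rightarrow>
   ('m, 'a) vfield \<Rightarrow> real \<Rightarrow> real \<Rightarrow> bool" where
  "eta_ricci_soliton X A g \<eta> V l m \<longleftrightarrow>
     riemannian_manifold X A g \<and> one_form A \<eta> \<and> vector_field A V \<and>
     (\<forall>c\<in>A. \<forall>x \<in> img_chart c. \<forall>u v.
        lie_deriv_metric (V c) (g c) x u v + 2 * ricci (g c) x u v + 2 * l * g c x u v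
        + 2 * m * (\<eta> c x u * \<eta> c x v) = 0)"

section \<open>Embedded submanifolds\<close>

text \<open>The smooth structure of an embedded submanifold \<open>F\<close> with the subspace topology: its charts are
  those whose inverse is a smooth immersion into the ambient manifold.\<close>

definition submanifold_atlas ::
  "'m topology \<Rightarrow> ('m, 'a::real_normed_vector) chart set \<Rightarrow> 'm set \<Rightarrow>
    ('m, 'c::real_normed_vector) chart set" where
  "submanifold_atlas X A F =
     {k. chart_of (subtopology X F) k \<and>
         (\<forall>c\<in>A. smooth_wrt id k c \<and>
            (\<forall>p \<in> dom_chart k \<inter> dom_chart c. inj (differential id k c p)))}"

text \<open>The next three predicates relate tensor fields on \<open>F\<close> (charts \<open>K\<close>) to tensor fields on the
  ambient manifold (charts \<open>A\<close>): pullback along the inclusion for covariant tensors, equality of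
  tangent vectors for vector fields. Each determines the field on \<open>F\<close> uniquely.\<close>

definition induced_metric ::
  "('m, 'a::real_normed_vector) chart set \<Rightarrow> ('m, 'c::real_normed_vector) chart set \<Rightarrow>
    ('m, 'a) metric \<Rightarrow> ('m, 'c) metric \<Rightarrow> bool" where
  "induced_metric A K g gF \<longleftrightarrow>
     (\<forall>k\<in>K. \<forall>c\<in>A. \<forall>p \<in> dom_chart k \<inter> dom_chart c. \<forall>u v.
        gF k (snd k p) u v = g c (snd c p) (differential id k c p u) (differential id k c p v))"

definition restricts_one_form ::
  "('m, 'a::real_normed_vector) chart set \<Rightarrow> ('m, 'c::real_normed_vector) chart set \<Rightarrow>
    ('m, 'a) oneform \<Rightarrow> ('m, 'c) oneform \<Rightarrow> bool" where
  "restricts_one_form A K \<eta> \<eta>F \<longleftrightarrow>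
     (\<forall>k\<in>K. \<forall>c\<in>A. \<forall>p \<in> dom_chart k \<inter> dom_chart c. \<forall>u.
        \<eta>F k (snd k p) u = \<eta> c (snd c p) (differential id k c p u))"

definition restricts_vector_field ::
  "('m, 'a::real_normed_vector) chart set \<Rightarrow> ('m, 'c::real_normed_vector) chart set \<Rightarrow>
    ('m, 'a) vfield \<Rightarrow> ('m, 'c) vfield \<Rightarrow> bool" where
  "restricts_vector_field A K V VF \<longleftrightarrow>
     (\<forall>k\<in>K. \<forall>c\<in>A. \<forall>p \<in> dom_chart k \<inter> dom_chart c.
        differential id k c p (VF k (snd k p)) = V c (snd c p))"

text \<open>The type \<open>'c\<close> is the model space of the submanifold.\<close>

definition submanifold_eta_ricci_soliton ::
  "'c::euclidean_space itself \<Rightarrow> 'm topology \<Rightarrow> ('m, 'a::euclidean_space) chart set \<Rightarrow>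
    ('m, 'a) metric \<Rightarrow> ('m, 'a) oneform \<Rightarrow> ('m, 'a) vfield \<Rightarrow> 'm set \<Rightarrow> bool" where
  "submanifold_eta_ricci_soliton _ X A g \<eta> V F \<longleftrightarrow>
     (let K = (submanifold_atlas X A F :: ('m, 'c) chart set) in
      \<exists>gF \<eta>F VF l m.
        induced_metric A K g gF \<and> restricts_one_form A K \<eta> \<eta>F \<and> restricts_vector_field A K V VF \<and>
        eta_ricci_soliton (subtopology X F) K gF \<eta>F VF l m)"

end

theory Submission
  imports Defs
begin

text \<open>Around each point of a fibre there is a chart of the total space in which the submersion is a
  linear map \<open>r\<close> and the fibre, read in a prescribed chart of its own, is an affine subspace
  \<open>b + i y\<close> with \<open>range i = ker r\<close>. In such a chart parallelism of the vertical distribution says that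
  the connection coefficients \<open>\<Gamma>(u, v)\<close> are in \<open>ker r\<close> for \<open>v\<close> in \<open>ker r\<close>. Hence the connection of
  the fibre is the restriction of that of the total space, curvature operators
  \<open>w \<mapsto> R(w, u) v\<close> with vertical \<open>u\<close>, \<open>v\<close> have vertical values, and their trace only sees the
  vertical directions: the Ricci tensor of the fibre is the restriction of the Ricci tensor. The Lie derivative
  of the metric along a vertical field also restricts, so the soliton equation holds on the fibre
  with the same constants.\<close>

subsection \<open>Calculus of smooth maps\<close>

text \<open>No transformation law for connection coefficients, curvature or the Ricci tensor under a
  change of charts is used: the definitions evaluate all of them chart by chart. The atlas of the
  fibre is maximal, so the soliton equation has to hold in each of its charts, and most of them are
  not restrictions of a chart of the total space. This is why the chart of the fibre is prescribed
  and the ambient chart is bent to fit it. With an affine inclusion, both sides of every comparison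
  are explicit expressions at corresponding points. The price is differential topology: inverse
  functions with smoothness of all orders, the local form of a submersion, and a proof that the
  charts of the fibre form a maximal smooth atlas. Parallelism speaks of fields on the whole
  manifold, whereas the argument needs it for constant fields of a single chart; bump functions
  bridge this gap. The model space of the base is only a normed space with a finite spanning set, so
  boundedness and surjectivity of linear maps from or to it need arguments of their own.\<close>

lemma Ck_on_cong:
  assumes "open S" "\<And>x. x \<in> S \<Longrightarrow> f x = g x" "Ck_on k S f"
  shows "Ck_on k S g"
  using assms(2,3)
proof (induction k arbitrary: f g)
  case 0
  then show ?case by (simp cong: continuous_on_cong)
next
  case (Suc k)
  have g: "(g has_derivative frechet_derivative f (at x)) (at x)" if "x \<in> S" for x
    using Suc.prems that has_derivative_transform_within_open[OF _ \<open>open S\<close> that, of f _ UNIV g]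
    by (auto simp: frechet_derivative_works)
  then have eq: "frechet_derivative f (at x) = frechet_derivative g (at x)" if "x \<in> S" for x
    using that frechet_derivative_at by blast
  have "Ck_on k S (\<lambda>x. frechet_derivative f (at x) v)" for v
    using Suc.prems(2) by simp
  then have "Ck_on k S (\<lambda>x. frechet_derivative g (at x) v)" for v
    by (rule Suc.IH[rotated]) (simp only: eq)
  then show ?case
    using g by (auto simp: differentiable_def)
qed

text \<open>In inductions on the order, the derivative is at hand as a formula. Uniqueness of
  derivatives exchanges it for \<open>frechet_derivative\<close>, which is what \<open>Ck_on\<close>
  iterates.\<close>

lemma Ck_onI:
  assumes "\<And>x. x \<in> S \<Longrightarrow> (f has_derivative f' x) (at x)"
    and "open S" "\<And>v. Ck_on k S (\<lambda>x. f' x v)"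
  shows "Ck_on (Suc k) S f"
proof -
  have eq: "f' x = frechet_derivative f (at x)" if "x \<in> S" for x
    using assms(1)[OF that] frechet_derivative_at by metis
  have "Ck_on k S (\<lambda>x. frechet_derivative f (at x) v)" for v
    by (rule Ck_on_cong[OF \<open>open S\<close> _ assms(3)[of v]]) (simp only: eq)
  then show ?thesis
    using assms(1) by (auto simp: differentiable_def)
qed

lemma Ck_on_subset: "Ck_on k S f \<Longrightarrow> T \<subseteq> S \<Longrightarrow> Ck_on k T f"
  by (induction k arbitrary: f) (auto intro: continuous_on_subset)

lemma Ck_on_SucD: "Ck_on (Suc k) S f \<Longrightarrow> Ck_on k S f"
proof (induction k arbitrary: f)
  case 0
  then show ?case
    by (auto intro!: continuous_at_imp_continuous_on differentiable_imp_continuous_within)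
qed simp

lemma Ck_on_has_derivative:
  "Ck_on (Suc k) S f \<Longrightarrow> x \<in> S \<Longrightarrow> (f has_derivative frechet_derivative f (at x)) (at x)"
  by (simp add: frechet_derivative_works)

text \<open>The sets \<open>U\<close> need not lie in \<open>S\<close>:
  \<open>frechet_derivative f (at x)\<close> is formed from the full neighbourhood filter and is the
  same whichever set is considered, so the local hypothesis passes to it as it stands.\<close>

lemma Ck_on_local:
  assumes "\<And>x. x \<in> S \<Longrightarrow> \<exists>U. open U \<and> x \<in> U \<and> Ck_on k U f"
  shows "Ck_on k S f"
  using assms
proof (induction k arbitrary: f)
  case 0
  then have "isCont f x" if "x \<in> S" for x
    using that continuous_on_eq_continuous_at by (metis Ck_on.simps(1))
  then show ?case
    by (auto intro: continuous_at_imp_continuous_on)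
next
  case (Suc k)
  have "f differentiable (at x)" if "x \<in> S" for x
    using Suc.prems[OF that] by auto
  moreover have "Ck_on k S (\<lambda>x. frechet_derivative f (at x) v)" for v
    by (rule Suc.IH) (metis Suc.prems Ck_on.simps(2))
  ultimately show ?case by simp
qed

lemma Ck_on_const: "Ck_on k S (\<lambda>x. a)"
  by (induction k arbitrary: a) auto

lemma Ck_on_linear:
  assumes "open S" "bounded_linear L" shows "Ck_on k S L"
proof (cases k)
  case 0
  then show ?thesis using assms by (simp add: linear_continuous_on)
next
  case (Suc n)
  show ?thesis
    unfolding Suc
    by (rule Ck_onI[where f' = "\<lambda>x. L"]) (use assms in \<open>auto intro: bounded_linear_imp_has_derivative Ck_on_const\<close>)
qed

lemma Ck_on_linear_compose:
  assumes "open S" "bounded_linear L" "Ck_on k S f"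
  shows "Ck_on k S (\<lambda>x. L (f x))"
  using assms(3)
proof (induction k arbitrary: f)
  case 0
  then show ?case
    using assms(2) by (auto intro: bounded_linear.continuous_on)
next
  case (Suc k)
  show ?case
    by (rule Ck_onI[where f' = "\<lambda>x v. L (frechet_derivative f (at x) v)"])
       (use Suc assms in \<open>auto intro!: bounded_linear.has_derivative[OF assms(2)] Ck_on_has_derivative\<close>)
qed

lemma Ck_on_add:
  assumes "open S" "Ck_on k S f" "Ck_on k S g"
  shows "Ck_on k S (\<lambda>x. f x + g x)"
  using assms(2,3)
proof (induction k arbitrary: f g)
  case 0
  then show ?case by (auto intro: continuous_on_add)
next
  case (Suc k)
  show ?case
    by (rule Ck_onI[where f' = "\<lambda>x v. frechet_derivative f (at x) v + frechet_derivative g (at x) v"])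
       (use Suc assms in \<open>auto intro!: has_derivative_add Ck_on_has_derivative\<close>)
qed

lemma Ck_on_sum:
  assumes "open S" "\<And>i. i \<in> I \<Longrightarrow> Ck_on k S (f i)"
  shows "Ck_on k S (\<lambda>x. \<Sum>i\<in>I. f i x)"
  using assms(2)
  by (induction I rule: infinite_finite_induct) (auto intro: Ck_on_const Ck_on_add[OF assms(1)])

lemma (in bounded_bilinear) Ck_on:
  assumes "open S" "Ck_on k S f" "Ck_on k S g"
  shows "Ck_on k S (\<lambda>x. prod (f x) (g x))"
  using assms(2,3)
proof (induction k arbitrary: f g)
  case 0
  then show ?case by (auto intro: continuous_on)
next
  case (Suc k)
  \<comment> \<open>The Leibniz formula still contains the undifferentiated factors, which are
    needed at the lower order \<open>k\<close>.\<close>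
  note S = Suc.prems Ck_on_SucD[OF Suc.prems(1)] Ck_on_SucD[OF Suc.prems(2)]
  show ?case
    by (rule Ck_onI[where f' = "\<lambda>x v. prod (f x) (frechet_derivative g (at x) v) +
          prod (frechet_derivative f (at x) v) (g x)"])
       (use S Suc.IH assms(1) in \<open>auto intro!: FDERIV Ck_on_add Ck_on_has_derivative\<close>)
qed

lemma linear_Basis_sum:
  fixes L :: "'a::euclidean_space \<Rightarrow> 'b::real_vector"
  assumes "linear L"
  shows "L x = (\<Sum>b\<in>Basis. (x \<bullet> b) *\<^sub>R L b)"
proof -
  have "L x = L (\<Sum>b\<in>Basis. (x \<bullet> b) *\<^sub>R b)" by (simp add: euclidean_representation)
  then show ?thesis by (simp add: linear_sum[OF assms] linear_scale[OF assms])
qed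

text \<open>Families of linear maps are never treated as maps into an operator space. Their
  smoothness is that of \<open>L x v\<close> for each fixed \<open>v\<close>, and expanding
  \<open>f x\<close> in the basis reduces a moving argument to a finite sum of products.\<close>

lemma Ck_on_apply:
  fixes L :: "'x::real_normed_vector \<Rightarrow> 'a::euclidean_space \<Rightarrow> 'b::real_normed_vector"
  assumes "open S" "\<And>x. x \<in> S \<Longrightarrow> linear (L x)" "\<And>v. Ck_on k S (\<lambda>x. L x v)" "Ck_on k S f"
  shows "Ck_on k S (\<lambda>x. L x (f x))"
proof (rule Ck_on_cong[OF \<open>open S\<close>])
  show "Ck_on k S (\<lambda>x. \<Sum>b\<in>Basis. (f x \<bullet> b) *\<^sub>R L x b)"
    using assms
    by (auto intro!: Ck_on_sum bounded_bilinear.Ck_on[OF bounded_bilinear_scaleR]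
        Ck_on_linear_compose[OF _ bounded_linear_inner_left])
  show "(\<Sum>b\<in>Basis. (f x \<bullet> b) *\<^sub>R L x b) = L x (f x)" if "x \<in> S" for x
    using linear_Basis_sum[OF assms(2)[OF that]] by metis
qed

text \<open>The chain rule applies a family of linear maps, the derivatives of \<open>g\<close> at
  \<open>f x\<close>, to a moving vector. The induction hypothesis, general in \<open>g\<close>,
  covers the family at a fixed vector, and \<open>Ck_on_apply\<close> lets the vector move.\<close>

lemma Ck_on_compose:
  fixes f :: "'x::real_normed_vector \<Rightarrow> 'a::euclidean_space"
  assumes "open S" "open T" "Ck_on k S f" "Ck_on k T g" "f ` S \<subseteq> T"
  shows "Ck_on k S (\<lambda>x. g (f x))"
  using assms(3,4)
proof (induction k arbitrary: g)
  case 0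
  then show ?case using assms(5) by (auto intro: continuous_on_compose2)
next
  case (Suc k)
  have g': "(g has_derivative frechet_derivative g (at (f x))) (at (f x))" if "x \<in> S" for x
    using Suc.prems(2) assms(5) that by (blast intro: Ck_on_has_derivative)
  note fS = Ck_on_SucD[OF Suc.prems(1)]
  show ?case
  proof (rule Ck_onI)
    fix x assume "x \<in> S"
    then show "((\<lambda>x. g (f x)) has_derivative
        (\<lambda>v. frechet_derivative g (at (f x)) (frechet_derivative f (at x) v))) (at x)"
      using has_derivative_compose[OF Ck_on_has_derivative[OF Suc.prems(1)] g'] by blast
  next
    show "Ck_on k S (\<lambda>x. frechet_derivative g (at (f x)) (frechet_derivative f (at x) v))" for v
    proof (rule Ck_on_apply[OF assms(1)])
      show "Ck_on k S (\<lambda>x. frechet_derivative g (at (f x)) v)" for v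
        using Suc.prems fS by (intro Suc.IH) auto
    qed (use g' Suc.prems in \<open>auto intro: has_derivative_linear\<close>)
  qed (rule assms(1))
qed

lemma smooth_on_imp_Ck: "smooth_on S f \<Longrightarrow> Ck_on k S f"
  by (simp add: smooth_on_def)

lemma smooth_on_has_derivative:
  "smooth_on S f \<Longrightarrow> x \<in> S \<Longrightarrow> (f has_derivative frechet_derivative f (at x)) (at x)"
  using Ck_on_has_derivative smooth_on_imp_Ck by blast

lemma smooth_on_differentiable: "smooth_on S f \<Longrightarrow> x \<in> S \<Longrightarrow> f differentiable (at x)"
  using smooth_on_has_derivative differentiable_def by blast

lemma smooth_on_continuous_on: "smooth_on S f \<Longrightarrow> continuous_on S f"
  using smooth_on_imp_Ck[of S f 0] by simp

lemma smooth_on_frechet_derivative: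
  "smooth_on S f \<Longrightarrow> smooth_on S (\<lambda>x. frechet_derivative f (at x) v)"
  unfolding smooth_on_def using Ck_on.simps(2) by blast

lemma smooth_on_cong:
  "open S \<Longrightarrow> (\<And>x. x \<in> S \<Longrightarrow> f x = g x) \<Longrightarrow> smooth_on S f \<Longrightarrow> smooth_on S g"
  unfolding smooth_on_def using Ck_on_cong by blast

lemma smooth_on_subset: "smooth_on S f \<Longrightarrow> T \<subseteq> S \<Longrightarrow> smooth_on T f"
  unfolding smooth_on_def using Ck_on_subset by blast

lemma smooth_on_local:
  "(\<And>x. x \<in> S \<Longrightarrow> \<exists>U. open U \<and> x \<in> U \<and> smooth_on U f) \<Longrightarrow> smooth_on S f"
  unfolding smooth_on_def by (intro allI Ck_on_local) blast

lemma smooth_on_const: "smooth_on S (\<lambda>x. a)"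
  unfolding smooth_on_def using Ck_on_const by blast

lemma smooth_on_linear: "open S \<Longrightarrow> bounded_linear L \<Longrightarrow> smooth_on S L"
  unfolding smooth_on_def using Ck_on_linear by blast

lemma smooth_on_linear_compose:
  "open S \<Longrightarrow> bounded_linear L \<Longrightarrow> smooth_on S f \<Longrightarrow> smooth_on S (\<lambda>x. L (f x))"
  unfolding smooth_on_def using Ck_on_linear_compose by blast

lemma smooth_on_add:
  "open S \<Longrightarrow> smooth_on S f \<Longrightarrow> smooth_on S g \<Longrightarrow> smooth_on S (\<lambda>x. f x + g x)"
  unfolding smooth_on_def using Ck_on_add by blast

lemma smooth_on_minus: "open S \<Longrightarrow> smooth_on S f \<Longrightarrow> smooth_on S (\<lambda>x. - f x)"
  by (rule smooth_on_linear_compose) (auto intro: bounded_linear_minus bounded_linear_ident)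

lemma smooth_on_diff:
  "open S \<Longrightarrow> smooth_on S f \<Longrightarrow> smooth_on S g \<Longrightarrow> smooth_on S (\<lambda>x. f x - g x)"
  using smooth_on_add[of S f "\<lambda>x. - g x"] smooth_on_minus[of S g] by simp

lemma smooth_on_sum:
  "open S \<Longrightarrow> (\<And>i. i \<in> I \<Longrightarrow> smooth_on S (f i)) \<Longrightarrow> smooth_on S (\<lambda>x. \<Sum>i\<in>I. f i x)"
  by (simp add: smooth_on_def Ck_on_sum)

lemma (in bounded_bilinear) smooth_on:
  "open S \<Longrightarrow> smooth_on S f \<Longrightarrow> smooth_on S g \<Longrightarrow> smooth_on S (\<lambda>x. prod (f x) (g x))"
  by (simp add: smooth_on_def Ck_on)

lemma smooth_on_apply:
  fixes L :: "'x::real_normed_vector \<Rightarrow> 'a::euclidean_space \<Rightarrow> 'b::real_normed_vector"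
  assumes "open S" "\<And>x. x \<in> S \<Longrightarrow> linear (L x)" "\<And>v. smooth_on S (\<lambda>x. L x v)" "smooth_on S f"
  shows "smooth_on S (\<lambda>x. L x (f x))"
  using assms(3,4) by (simp add: smooth_on_def Ck_on_apply[OF assms(1,2)])

lemma smooth_on_compose:
  fixes f :: "'x::real_normed_vector \<Rightarrow> 'a::euclidean_space"
  assumes "open S" "open T" "smooth_on S f" "smooth_on T g" "f ` S \<subseteq> T"
  shows "smooth_on S (\<lambda>x. g (f x))"
  using assms(3,4) by (simp add: smooth_on_def Ck_on_compose[OF assms(1,2) _ _ assms(5)])

subsection \<open>Inverse functions\<close>

text \<open>A product rule without differentiability of the second factor: where the scalar factor
  vanishes, continuity of \<open>g\<close> is enough. It serves to differentiate inverses of linear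
  maps that are so far only known to be continuous.\<close>

lemma has_derivative_scaleR_vanishing:
  fixes f :: "'x::real_normed_vector \<Rightarrow> real" and g :: "'x \<Rightarrow> 'b::real_normed_vector"
  assumes f: "(f has_derivative f') (at x)" "f x = 0" and g: "isCont g x"
  shows "((\<lambda>y. f y *\<^sub>R g y) has_derivative (\<lambda>h. f' h *\<^sub>R g x)) (at x)"
proof -
  obtain K where K: "K > 0" "\<And>h. norm (f' h) \<le> norm h * K"
    using has_derivative_bounded_linear[OF f(1)] bounded_linear.pos_bounded by blast
  \<comment> \<open>In the splitting \<open>f y *\<^sub>R g y = f y *\<^sub>R g x + f y *\<^sub>R (g
    y - g x)\<close> the last term is of smaller order than \<open>y - x\<close>, since
    \<open>f y\<close> is at most \<open>(K + 1)\<close> times \<open>norm (y - x)\<close> near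
    \<open>x\<close>.\<close>
  have zero: "((\<lambda>y. f y *\<^sub>R (g y - g x)) has_derivative (\<lambda>h. 0)) (at x)"
    unfolding has_derivative_at_alt
  proof (intro conjI allI impI)
    fix e :: real assume "e > 0"
    obtain d1 where d1: "d1 > 0"
      "\<And>y. norm (y - x) < d1 \<Longrightarrow> norm (f y - f x - f' (y - x)) \<le> 1 * norm (y - x)"
      using f(1) unfolding has_derivative_at_alt by (metis zero_less_one)
    obtain d2 where d2: "d2 > 0" "\<And>y. dist y x < d2 \<Longrightarrow> dist (g y) (g x) < e / (K + 1)"
      using g K(1) \<open>e > 0\<close> unfolding continuous_at_eps_delta
      by (metis add_pos_pos divide_pos_pos zero_less_one)
    have "norm (f y *\<^sub>R (g y - g x)) \<le> e * norm (y - x)" if "norm (y - x) < min d1 d2" for y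
    proof -
      have "norm (f y) \<le> norm (f y - f x - f' (y - x)) + norm (f' (y - x))"
        using norm_triangle_ineq[of "f y - f x - f' (y - x)" "f' (y - x)"] f(2) by simp
      also have "\<dots> \<le> (K + 1) * norm (y - x)"
        using d1(2)[of y] K(2)[of "y - x"] that by (simp add: algebra_simps)
      finally have "norm (f y) * norm (g y - g x) \<le> ((K + 1) * norm (y - x)) * (e / (K + 1))"
        using d2(2)[of y] that by (intro mult_mono) (auto simp: dist_norm)
      also have "((K + 1) * norm (y - x)) * (e / (K + 1)) = e * norm (y - x)"
        using K(1) by simp
      finally show ?thesis by simp
    qed
    then show "\<exists>d>0. \<forall>y. norm (y - x) < d \<longrightarrow>
        norm (f y *\<^sub>R (g y - g x) - f x *\<^sub>R (g x - g x) - 0) \<le> e * norm (y - x)"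
      using d1(1) d2(1) by (intro exI[of _ "min d1 d2"]) auto
  qed simp
  have "((\<lambda>y. f y *\<^sub>R g x + f y *\<^sub>R (g y - g x)) has_derivative (\<lambda>h. f' h *\<^sub>R g x + 0)) (at x)"
    by (intro has_derivative_add zero bounded_linear.has_derivative[OF bounded_linear_scaleR_left] f(1))
  then show ?thesis by (simp add: algebra_simps)
qed

section \<open>Smooth families of linear maps and their inverses\<close>

lemma norm_linear_le_Basis:
  fixes L :: "'e::euclidean_space \<Rightarrow> 'b::real_normed_vector"
  assumes "linear L" "\<And>b. b \<in> Basis \<Longrightarrow> norm (L b) \<le> e / DIM('e)" "e > 0"
  shows "norm (L z) \<le> e * norm z"
proof -
  have "norm (L z) \<le> (\<Sum>b\<in>Basis. norm ((z \<bullet> b) *\<^sub>R L b))"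
    unfolding linear_Basis_sum[OF assms(1), of z] by (rule norm_sum)
  also have "\<dots> \<le> (\<Sum>b\<in>(Basis::'e set). norm z * (e / DIM('e)))"
  proof (rule sum_mono)
    fix b :: 'e assume "b \<in> Basis"
    then show "norm ((z \<bullet> b) *\<^sub>R L b) \<le> norm z * (e / DIM('e))"
      unfolding norm_scaleR using assms(2) by (intro mult_mono) (auto simp: Basis_le_norm)
  qed
  finally show ?thesis by (simp add: mult.commute)
qed

text \<open>In finite dimension pointwise convergence of linear maps is convergence in operator
  norm, because finitely many basis vectors control the norm.\<close>

lemma eventually_near_linear:
  fixes M :: "'x::topological_space \<Rightarrow> 'e::euclidean_space \<Rightarrow> 'b::real_normed_vector"
  assumes "\<forall>\<^sub>F x in F. linear (M x)" "linear M0" "\<And>v. ((\<lambda>x. M x v) \<longlongrightarrow> M0 v) F" "e > 0"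
  shows "\<forall>\<^sub>F x in F. \<forall>z. norm (M x z - M0 z) \<le> e * norm z"
proof -
  have "\<forall>\<^sub>F x in F. \<forall>b\<in>Basis. dist (M x b) (M0 b) < e / DIM('e)"
    using assms(3,4) by (intro eventually_ball_finite) (auto intro!: tendstoD)
  then show ?thesis
    using assms(1)
  proof eventually_elim
    case (elim x)
    have "linear (\<lambda>z. M x z - M0 z)"
      using elim(2) assms(2) by (rule linear_compose_sub)
    then show ?case
      using norm_linear_le_Basis[of "\<lambda>z. M x z - M0 z" e] elim(1) assms(4)
      by (auto simp: dist_norm less_imp_le)
  qed
qed

text \<open>The direction \<open>h\<close> is fixed and linearity is in the parameter
  \<open>v\<close>. It follows by differentiating the two linearity equations of \<open>M y\<close>,
  which hold throughout a neighbourhood of \<open>x\<close>.\<close>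

lemma linear_frechet_derivative:
  fixes M :: "'x::real_normed_vector \<Rightarrow> 'e::real_vector \<Rightarrow> 'b::real_normed_vector"
  assumes open_S: "open S" and x: "x \<in> S" and linear_M: "\<And>y. y \<in> S \<Longrightarrow> linear (M y)"
    and diff: "\<And>v. (\<lambda>y. M y v) differentiable (at x)"
  shows "linear (\<lambda>v. frechet_derivative (\<lambda>y. M y v) (at x) h)"
proof -
  let ?D = "\<lambda>v. frechet_derivative (\<lambda>y. M y v) (at x)"
  have D: "((\<lambda>y. M y v) has_derivative ?D v) (at x)" for v
    using diff by (simp add: frechet_derivative_works)
  have add: "((\<lambda>y. M y (v + w)) has_derivative (\<lambda>h. ?D v h + ?D w h)) (at x)" for v w
    by (rule has_derivative_transform_within_open[OF has_derivative_add[OF D D] open_S x])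
       (simp add: linear_add[OF linear_M])
  have scale: "((\<lambda>y. M y (r *\<^sub>R v)) has_derivative (\<lambda>h. r *\<^sub>R ?D v h)) (at x)" for v r
    by (rule has_derivative_transform_within_open[OF has_derivative_scaleR_right[OF D] open_S x])
       (simp add: linear_scale[OF linear_M])
  show ?thesis
    by (rule linearI) (simp_all add: has_derivative_unique[OF D add] has_derivative_unique[OF D scale])
qed

text \<open>\<open>N\<close> is the pointwise inverse of \<open>M\<close>. There are two instances:
  the derivatives of a map along its inverse, and the lowering of an index by a metric, whose
  inverse solves for the connection coefficients.\<close>

locale linear_family =
  fixes S :: "'x::real_normed_vector set" and M N :: "'x \<Rightarrow> 'e::euclidean_space \<Rightarrow> 'e"
  assumes open_S: "open S"
    and linear_M: "x \<in> S \<Longrightarrow> linear (M x)"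
    and inj_M: "x \<in> S \<Longrightarrow> inj (M x)"
    and M_N: "x \<in> S \<Longrightarrow> M x (N x v) = v"
begin

lemma N_M: "x \<in> S \<Longrightarrow> N x (M x v) = v"
  using inj_M M_N by (metis injD)

lemma linear_N: "x \<in> S \<Longrightarrow> linear (N x)"
  by (rule linearI; rule injD[OF inj_M[of x]])
     (simp_all add: M_N linear_add[OF linear_M] linear_scale[OF linear_M])

lemma eventually_S: "x \<in> S \<Longrightarrow> \<forall>\<^sub>F y in at x. y \<in> S"
  using open_S by (auto simp: eventually_at_topological)

text \<open>\<open>M x\<close> is bounded below by some \<open>B\<close>, and \<open>M y\<close>
  differs from it by at most \<open>B / 2\<close> for \<open>y\<close> near \<open>x\<close>, so the
  \<open>M y\<close> are bounded below uniformly. Applied to \<open>N y v - N x v\<close>, the map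
  \<open>M y\<close> gives \<open>v - M y (N x v)\<close>, which tends to 0.\<close>

lemma isCont_N:
  assumes x: "x \<in> S" and cont: "\<And>v. isCont (\<lambda>y. M y v) x"
  shows "isCont (\<lambda>y. N y v) x"
proof -
  obtain B where B: "B > 0" "\<And>z. B * norm z \<le> norm (M x z)"
    using linear_inj_bounded_below_pos[OF linear_M[OF x] inj_M[OF x]] by metis
  define z where "z = N x v"
  have linM: "\<forall>\<^sub>F y in at x. linear (M y)"
    using eventually_S[OF x] by eventually_elim (rule linear_M)
  have "\<forall>\<^sub>F y in at x. \<forall>z. norm (M y z - M x z) \<le> B / 2 * norm z"
    using cont B(1) by (intro eventually_near_linear linM linear_M x) (auto simp: isCont_def)
  then have "\<forall>\<^sub>F y in at x. norm (N y v - N x v) \<le> 2 / B * norm (M y z - v)"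
    using eventually_S[OF x]
  proof eventually_elim
    case (elim y)
    define w where "w = N y v - N x v"
    have "M y w = v - M y z"
      unfolding w_def z_def by (simp add: linear_diff[OF linear_M] elim(2) M_N)
    moreover have "B * norm w \<le> norm (M y w) + norm (M y w - M x w)"
      using B(2)[of w] norm_triangle_sub[of "M x w" "M y w"] by (simp add: norm_minus_commute)
    ultimately have "B * norm w \<le> 2 * norm (M y z - v)"
      using elim(1)[rule_format, of w] by (simp add: norm_minus_commute)
    then show ?case using B(1) by (simp add: w_def field_simps)
  qed
  moreover have "((\<lambda>y. 2 / B * norm (M y z - v)) \<longlongrightarrow> 2 / B * norm (M x z - v)) (at x)"
    using cont[of z] by (intro tendsto_intros) (auto simp: isCont_def)
  then have "((\<lambda>y. 2 / B * norm (M y z - v)) \<longlongrightarrow> 0) (at x)"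
    by (simp add: z_def M_N x)
  ultimately have "((\<lambda>y. N y v - N x v) \<longlongrightarrow> 0) (at x)"
    by (rule Lim_null_comparison)
  then show ?thesis
    by (simp add: isCont_def Lim_null[of _ "N x v"])
qed

text \<open>With \<open>z = N x v\<close> one has \<open>N y v = z - N y (M y z - v)\<close>.
  Expanded in the basis, the argument \<open>M y z - v\<close> has coefficients that vanish at
  \<open>y = x\<close>, so continuity of \<open>N\<close> suffices to differentiate the right-hand
  side.\<close>

lemma has_derivative_N:
  assumes x: "x \<in> S" and M': "\<And>v. ((\<lambda>y. M y v) has_derivative M' v) (at x)"
  shows "((\<lambda>y. N y v) has_derivative (\<lambda>h. - N x (M' (N x v) h))) (at x)"
proof -
  define z where "z = N x v"
  have cont: "isCont (\<lambda>y. N y v) x" for v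
    using isCont_N[OF x has_derivative_continuous[OF M']] .
  have 1: "((\<lambda>y. (M y z - v) \<bullet> b) has_derivative (\<lambda>h. M' z h \<bullet> b)) (at x)" for b
    by (auto intro!: derivative_eq_intros M')
  have "((\<lambda>y. N x v - (\<Sum>b\<in>Basis. ((M y z - v) \<bullet> b) *\<^sub>R N y b)) has_derivative
      (\<lambda>h. 0 - (\<Sum>b\<in>Basis. (M' z h \<bullet> b) *\<^sub>R N x b))) (at x)"
    by (intro has_derivative_diff has_derivative_const has_derivative_sum
        has_derivative_scaleR_vanishing 1 cont) (simp add: z_def M_N x)
  then have "((\<lambda>y. N x v - (\<Sum>b\<in>Basis. ((M y z - v) \<bullet> b) *\<^sub>R N y b)) has_derivative
      (\<lambda>h. - N x (M' z h))) (at x)"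
    by (simp flip: linear_Basis_sum[OF linear_N[OF x]])
  then show ?thesis
    unfolding z_def[symmetric]
  proof (rule has_derivative_transform_within_open[OF _ open_S x])
    fix y assume y: "y \<in> S"
    have "(\<Sum>b\<in>Basis. ((M y z - v) \<bullet> b) *\<^sub>R N y b) = z - N y v"
      using y by (simp flip: linear_Basis_sum[OF linear_N[OF y]] add: linear_diff[OF linear_N] N_M)
    then show "z - (\<Sum>b\<in>Basis. ((M y z - v) \<bullet> b) *\<^sub>R N y b) = N y v"
      by simp
  qed
qed

text \<open>The derivative of \<open>N\<close> is an expression in \<open>N\<close> and the
  derivative of \<open>M\<close>. Hence each order of smoothness of \<open>N\<close> yields the
  next, as long as \<open>M\<close> permits.\<close>

lemma Ck_on_N:
  assumes "\<And>v. Ck_on k S (\<lambda>x. M x v)"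
  shows "Ck_on k S (\<lambda>x. N x v)"
  using assms
proof (induction k arbitrary: v)
  case 0
  then show ?case
    using isCont_N open_S by (simp add: continuous_on_eq_continuous_at)
next
  case (Suc k)
  let ?D = "\<lambda>x v h. frechet_derivative (\<lambda>y. M y v) (at x) h"
  have D: "((\<lambda>y. M y v) has_derivative ?D x v) (at x)" if "x \<in> S" for x v
    using Suc.prems that by (rule Ck_on_has_derivative)
  have N: "Ck_on k S (\<lambda>x. N x v)" for v
    by (rule Suc.IH[OF Ck_on_SucD[OF Suc.prems]])
  have "Ck_on k S (\<lambda>x. N x (?D x (N x v) h))" for h
  proof (rule Ck_on_apply[OF open_S linear_N N])
    show "Ck_on k S (\<lambda>x. ?D x (N x v) h)"
    proof (rule Ck_on_apply[OF open_S _ _ N])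
      show "linear (\<lambda>v. ?D x v h)" if "x \<in> S" for x
        using D[OF that] by (intro linear_frechet_derivative[OF open_S that] linear_M) (auto simp: differentiable_def)
      show "Ck_on k S (\<lambda>x. ?D x v h)" for v
        using Suc.prems[of v] by simp
    qed
  qed
  then have *: "Ck_on k S (\<lambda>x. - N x (?D x (N x v) h))" for h
    using Ck_on_linear_compose[OF open_S bounded_linear_minus[OF bounded_linear_ident]] by blast
  show ?case
    by (rule Ck_onI[where f' = "\<lambda>x h. - N x (?D x (N x v) h)"]) (auto intro: has_derivative_N D open_S *)
qed

lemma smooth_on_N: "(\<And>v. smooth_on S (\<lambda>x. M x v)) \<Longrightarrow> smooth_on S (\<lambda>x. N x v)"
  by (simp add: smooth_on_def Ck_on_N)

end

text \<open>With injectivity given, invariance of domain supplies the open image and the continuity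
  of the inverse. The derivative of the inverse \<open>g\<close> at \<open>y\<close> is the inverse
  of the derivative of \<open>f\<close> at \<open>g y\<close>. This expression is as smooth as
  \<open>g\<close>, so \<open>g\<close> gains one order at each step of the induction.\<close>

lemma smooth_inverse:
  fixes f :: "'e::euclidean_space \<Rightarrow> 'e"
  assumes S: "open S" and f: "smooth_on S f" "inj_on f S"
    and inj: "\<And>x. x \<in> S \<Longrightarrow> inj (frechet_derivative f (at x))"
  shows "open (f ` S)" "smooth_on (f ` S) (inv_into S f)"
proof -
  let ?T = "f ` S" and ?g = "inv_into S f"
  note contf = smooth_on_continuous_on[OF f(1)]
  show T: "open ?T"
    using contf S f(2) by (rule invariance_of_domain)
  obtain g' where "homeomorphism S ?T f g'"
    using invariance_of_domain_homeomorphism[OF S contf _ f(2)] by auto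
  then have contg: "continuous_on ?T ?g"
    by (rule continuous_on_cong[THEN iffD1, rotated 2, OF homeomorphism_cont2])
       (use \<open>homeomorphism S ?T f g'\<close> f(2) in \<open>auto simp: homeomorphism_def\<close>)
  let ?M = "\<lambda>y. frechet_derivative f (at (?g y))" and ?N = "\<lambda>y. inv (frechet_derivative f (at (?g y)))"
  have gS: "?g y \<in> S" if "y \<in> ?T" for y
    using that by (rule inv_into_into)
  have derf: "(f has_derivative ?M y) (at (?g y))" if "y \<in> ?T" for y
    using gS[OF that] f(1) by (intro smooth_on_has_derivative)
  interpret linear_family ?T ?M ?N
  proof (rule linear_family.intro)
    fix y v assume y: "y \<in> ?T"
    show lin: "linear (?M y)" using derf[OF y] by (rule has_derivative_linear)
    show "inj (?M y)" using inj gS[OF y] by blast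
    then have "surj (?M y)" using lin linear_injective_imp_surjective by blast
    then show "?M y (?N y v) = v" by (rule surj_f_inv_f)
  qed (rule T)
  have derg: "(?g has_derivative ?N y) (at y)" if "y \<in> ?T" for y
  proof (rule has_derivative_inverse_basic[where f = f and T = ?T])
    show "bounded_linear (?N y)"
      using linear_N[OF that] linear_conv_bounded_linear by blast
    show "?N y \<circ> ?M y = id"
      using N_M[OF that] by (simp add: fun_eq_iff)
    show "isCont ?g y"
      using contg T that continuous_on_eq_continuous_at by blast
  qed (simp_all add: derf that T f_inv_into_f)
  have "Ck_on k ?T ?g" for k
  proof (induction k)
    case (Suc k)
    have "Ck_on k ?T (\<lambda>y. ?N y v)" for v
    proof (rule Ck_on_N)
      show "Ck_on k ?T (\<lambda>y. ?M y v)" for v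
        by (rule Ck_on_compose[OF T S Suc.IH smooth_on_imp_Ck[OF smooth_on_frechet_derivative[OF f(1)]]])
           (use gS in blast)
    qed
    with derg T show ?case by (rule Ck_onI)
  qed (simp add: contg)
  then show "smooth_on ?T ?g" by (simp add: smooth_on_def)
qed

text \<open>On a small ball the derivative of \<open>f x - x\<close> has norm at most
  \<open>1/2\<close>. There \<open>f\<close> is the identity plus a contraction, which makes both
  \<open>f\<close> and its derivatives injective.\<close>

lemma locally_injective_near_identity:
  fixes f :: "'e::euclidean_space \<Rightarrow> 'e"
  assumes S: "open S" "x0 \<in> S" and f: "smooth_on S f"
    and id: "\<And>v. frechet_derivative f (at x0) v = v"
  obtains W where "open W" "x0 \<in> W" "W \<subseteq> S" "inj_on f W"
    "\<forall>x\<in>W. inj (frechet_derivative f (at x))"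
proof -
  let ?D = "\<lambda>x. frechet_derivative f (at x)"
  have D: "(f has_derivative ?D x) (at x)" if "x \<in> S" for x
    using f that by (rule smooth_on_has_derivative)
  have linD: "linear (?D x)" if "x \<in> S" for x
    using D[OF that] by (rule has_derivative_linear)
  have "isCont (\<lambda>x. ?D x v) x0" for v
    using smooth_on_continuous_on[OF smooth_on_frechet_derivative[OF f, of v]] S
    by (simp add: continuous_on_eq_continuous_at)
  then have "((\<lambda>x. ?D x v) \<longlongrightarrow> ?D x0 v) (nhds x0)" for v
    using tendsto_at_iff_tendsto_nhds[of "\<lambda>x. ?D x _" x0] by (simp add: isCont_def)
  then have "((\<lambda>x. ?D x v) \<longlongrightarrow> v) (nhds x0)" for v
    by (simp only: id)
  moreover have "\<forall>\<^sub>F x in nhds x0. linear (?D x)"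
    using eventually_nhds_in_open[OF S] by eventually_elim (rule linD)
  ultimately have "\<forall>\<^sub>F x in nhds x0. \<forall>v. norm (?D x v - v) \<le> 1/2 * norm v"
    by (intro eventually_near_linear linear_ident) auto
  with eventually_nhds_in_open[OF S]
  have "\<forall>\<^sub>F x in nhds x0. x \<in> S \<and> (\<forall>v. norm (?D x v - v) \<le> 1/2 * norm v)"
    by (rule eventually_conj)
  then obtain r where r: "r > 0"
    and near: "\<And>x. x \<in> ball x0 r \<Longrightarrow> x \<in> S \<and> (\<forall>v. norm (?D x v - v) \<le> 1/2 * norm v)"
    unfolding eventually_nhds_metric by (auto simp: dist_commute)
  show ?thesis
  proof
    show "inj_on f (ball x0 r)"
    proof (rule inj_onI)
      fix x y assume xy: "x \<in> ball x0 r" "y \<in> ball x0 r" "f x = f y"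
      have "norm ((f x - x) - (f y - y)) \<le> 1/2 * norm (x - y)"
      proof (rule differentiable_bound[OF convex_ball _ _ xy(1,2)])
        show "((\<lambda>x. f x - x) has_derivative (\<lambda>v. ?D x v - v)) (at x within ball x0 r)"
          if "x \<in> ball x0 r" for x
          by (rule has_derivative_at_withinI[OF has_derivative_diff[OF D has_derivative_ident]])
             (use near[OF that] in blast)
        show "onorm (\<lambda>v. ?D x v - v) \<le> 1/2" if "x \<in> ball x0 r" for x
          by (rule onorm_bound) (use near[OF that] in auto)
      qed
      then show "x = y" using xy(3) by (simp add: norm_minus_commute)
    qed
    show "\<forall>x\<in>ball x0 r. inj (?D x)"
    proof
      fix x assume x: "x \<in> ball x0 r"
      have "v = 0" if "?D x v = 0" for v
      proof -
        have "norm (?D x v - v) \<le> 1/2 * norm v"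
          using near[OF x] by blast
        then show "v = 0" using that by simp
      qed
      then show "inj (?D x)"
        using linear_injective_0[OF linD] near[OF x] by blast
    qed
  qed (use r near in auto)
qed

subsection \<open>Bump functions\<close>

text \<open>The flat function \<open>exp (- 1 / t)\<close> is the case \<open>p = 1\<close>.
  Polynomial factors in \<open>1 / t\<close> are included to make the family closed under
  differentiation.\<close>

definition exp_cutoff :: "real poly \<Rightarrow> real \<Rightarrow> real" where
  "exp_cutoff p t = (if t > 0 then poly p (1 / t) * exp (- (1 / t)) else 0)"

text \<open>Under the substitution \<open>s = 1 / t\<close> this is the decay of
  \<open>s ^ i / exp s\<close> at infinity, summed over the monomials of \<open>p\<close>.\<close>

lemma exp_cutoff_tendsto_0:
  fixes p :: "real poly"
  shows "((\<lambda>t. poly p (1 / t) * exp (- (1 / t))) \<longlongrightarrow> 0) (at_right 0)"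
proof -
  have "((\<lambda>s. \<Sum>i\<le>degree p. coeff p i * (s ^ i / exp s)) \<longlongrightarrow> (\<Sum>i\<le>degree p. coeff p i * 0)) at_top"
    by (intro tendsto_sum tendsto_mult tendsto_const tendsto_power_div_exp_0)
  then have "((\<lambda>s. poly p s * exp (- s)) \<longlongrightarrow> 0) at_top"
    by (simp add: poly_altdef exp_minus field_simps sum_distrib_left sum_divide_distrib)
  moreover have "filterlim (\<lambda>t. 1 / t) at_top (at_right (0::real))"
    using filterlim_inverse_at_top_right by (simp add: inverse_eq_divide)
  ultimately show ?thesis by (rule filterlim_compose)
qed

text \<open>For \<open>s = 1 / t\<close> the derivative in \<open>t\<close> is \<open>- s^2\<close>
  times the derivative in \<open>s\<close>, which sends \<open>p(s) exp (- s)\<close> to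
  \<open>s^2 (p - p')(s) exp (- s)\<close>; the factor \<open>[:0, 0, 1:]\<close> is
  \<open>s^2\<close>.\<close>

lemma exp_cutoff_has_derivative:
  "(exp_cutoff p has_real_derivative exp_cutoff ([:0, 0, 1:] * (p - pderiv p)) t) (at t)"
proof -
  let ?q = "[:0, 0, 1:] * (p - pderiv p)"
  consider "t > 0" | "t < 0" | "t = 0" by linarith
  then show ?thesis
  proof cases
    case 1
    have "((\<lambda>t. poly p (1 / t) * exp (- (1 / t))) has_real_derivative exp_cutoff ?q t) (at t)"
      using 1 by (auto intro!: derivative_eq_intros DERIV_chain2[OF poly_DERIV]
          simp: exp_cutoff_def power2_eq_square field_simps)
    then show ?thesis
      by (rule DERIV_cong_ev[THEN iffD1, rotated -1, OF _ refl _ refl])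
         (use 1 in \<open>auto simp: exp_cutoff_def eventually_nhds intro!: exI[of _ "{0<..}"]\<close>)
  next
    case 2
    have "((\<lambda>t. 0) has_real_derivative exp_cutoff ?q t) (at t)"
      using 2 by (simp add: exp_cutoff_def)
    then show ?thesis
      by (rule DERIV_cong_ev[THEN iffD1, rotated -1, OF _ refl _ refl])
         (use 2 in \<open>auto simp: exp_cutoff_def eventually_nhds intro!: exI[of _ "{..<0}"]\<close>)
  next
    case 3
    have "((\<lambda>h. (exp_cutoff p h - exp_cutoff p 0) / (h - 0)) \<longlongrightarrow> 0) (at 0)"
    proof (rule filterlim_split_at)
      have "\<forall>\<^sub>F h in at_left 0. 0 = (exp_cutoff p h - exp_cutoff p 0) / (h - 0)"
        by (auto simp: eventually_at_filter exp_cutoff_def)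
      then show "((\<lambda>h. (exp_cutoff p h - exp_cutoff p 0) / (h - 0)) \<longlongrightarrow> 0) (at_left 0)"
        by (rule Lim_transform_eventually[OF tendsto_const])
      \<comment> \<open>Division by \<open>h\<close> multiplies the polynomial by its variable, so
        the right difference quotient at 0 is again a function of the same family.\<close>
      have "\<forall>\<^sub>F h in at_right 0. poly ([:0, 1:] * p) (1 / h) * exp (- (1 / h)) =
          (exp_cutoff p h - exp_cutoff p 0) / (h - 0)"
        by (auto simp: eventually_at_filter exp_cutoff_def)
      then show "((\<lambda>h. (exp_cutoff p h - exp_cutoff p 0) / (h - 0)) \<longlongrightarrow> 0) (at_right 0)"
        by (rule Lim_transform_eventually[OF exp_cutoff_tendsto_0])
    qed
    then show ?thesis
      by (simp add: 3 has_field_derivative_iff exp_cutoff_def)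
  qed
qed

lemma smooth_on_exp_cutoff: "smooth_on UNIV (exp_cutoff p)"
proof -
  have "Ck_on k UNIV (exp_cutoff p)" for k
  proof (induction k arbitrary: p)
    case 0
    show ?case
      using DERIV_isCont[OF exp_cutoff_has_derivative]
      by (auto intro: continuous_at_imp_continuous_on)
  next
    case (Suc k)
    show ?case
      by (rule Ck_onI[OF exp_cutoff_has_derivative[unfolded has_field_derivative_def]])
         (auto intro: Ck_on_linear_compose[OF _ bounded_linear_mult_left] Suc.IH)
  qed
  then show ?thesis by (simp add: smooth_on_def)
qed

text \<open>The squared distance is used because it is smooth at the centre as well. The only
  normalisation is a nonzero value at the centre, by which a later equation is divided.\<close>

lemma bump_function_exists:
  fixes x0 :: "'a::euclidean_space"
  assumes "\<rho> > 0"
  obtains \<beta> :: "'a \<Rightarrow> real" where "smooth_on UNIV \<beta>" "\<beta> x0 \<noteq> 0" "\<forall>x. x \<notin> cball x0 \<rho> \<longrightarrow> \<beta> x = 0"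
proof -
  define \<beta> where "\<beta> = (\<lambda>x. exp_cutoff 1 (\<rho>\<^sup>2 - (x - x0) \<bullet> (x - x0)))"
  have d: "smooth_on UNIV (\<lambda>x. x - x0)"
    by (intro smooth_on_diff smooth_on_const smooth_on_linear bounded_linear_ident open_UNIV)
  have "smooth_on UNIV (\<lambda>x. \<rho>\<^sup>2 - (x - x0) \<bullet> (x - x0))"
    by (intro smooth_on_diff smooth_on_const open_UNIV d bounded_bilinear.smooth_on[OF bounded_bilinear_inner])
  then have "smooth_on UNIV \<beta>"
    unfolding \<beta>_def by (rule smooth_on_compose[OF open_UNIV open_UNIV _ smooth_on_exp_cutoff]) simp
  moreover have "\<beta> x0 \<noteq> 0"
    using assms by (simp add: \<beta>_def exp_cutoff_def)
  moreover have "\<beta> x = 0" if "x \<notin> cball x0 \<rho>" for x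
  proof -
    have "\<rho>\<^sup>2 \<le> (norm (x - x0))\<^sup>2"
      using that assms by (intro power_mono) (auto simp: dist_norm norm_minus_commute)
    then show ?thesis by (simp add: \<beta>_def exp_cutoff_def power2_norm_eq_inner)
  qed
  ultimately show ?thesis using that by blast
qed

subsection \<open>Charts\<close>

text \<open>The homeomorphism condition is unfolded into statements about open sets of
  \<open>X\<close> and of the model space, free of subtopologies. New charts are verified in this
  form.\<close>

lemma chart_of_iff:
  "chart_of X c \<longleftrightarrow> openin X (dom_chart c) \<and> inj_on (snd c) (dom_chart c) \<and>
     (\<forall>U. openin X U \<and> U \<subseteq> dom_chart c \<longrightarrow> open (snd c ` U)) \<and>
     (\<forall>W. open W \<longrightarrow> openin X {p \<in> dom_chart c. snd c p \<in> W})"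
proof (cases "openin X (dom_chart c)")
  case D: True
  let ?S = "subtopology X (dom_chart c)" and ?T = "top_of_set (img_chart c)"
  have top: "topspace ?S = dom_chart c"
    using openin_subset[OF D] by auto
  show ?thesis
  proof
    assume c: "chart_of X c"
    then have img: "open (img_chart c)" and hom: "homeomorphic_map ?S ?T (snd c)"
      unfolding chart_of_def by auto
    have "open (snd c ` U)" if "openin X U" "U \<subseteq> dom_chart c" for U
      using homeomorphic_imp_open_map[OF hom] that
      by (auto simp: open_map_def openin_open_subtopology[OF D] openin_open_eq[OF img])
    moreover have "openin X {p \<in> dom_chart c. snd c p \<in> W}" if "open W" for W
    proof -
      have "openin ?S {p \<in> topspace ?S. snd c p \<in> W \<inter> img_chart c}"
        using homeomorphic_imp_continuous_map[OF hom] that img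
        by (intro openin_continuous_map_preimage) (auto simp: openin_open_eq)
      moreover have "{p \<in> topspace ?S. snd c p \<in> W \<inter> img_chart c} = {p \<in> dom_chart c. snd c p \<in> W}"
        unfolding top by auto
      ultimately show ?thesis
        by (simp add: openin_open_subtopology[OF D])
    qed
    ultimately show "openin X (dom_chart c) \<and> inj_on (snd c) (dom_chart c) \<and>
     (\<forall>U. openin X U \<and> U \<subseteq> dom_chart c \<longrightarrow> open (snd c ` U)) \<and>
     (\<forall>W. open W \<longrightarrow> openin X {p \<in> dom_chart c. snd c p \<in> W})"
      using D homeomorphic_imp_injective_map[OF hom] unfolding top by blast
  next
    assume r: "openin X (dom_chart c) \<and> inj_on (snd c) (dom_chart c) \<and>
     (\<forall>U. openin X U \<and> U \<subseteq> dom_chart c \<longrightarrow> open (snd c ` U)) \<and>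
     (\<forall>W. open W \<longrightarrow> openin X {p \<in> dom_chart c. snd c p \<in> W})"
    then have img: "open (img_chart c)" using D by blast
    have "homeomorphic_map ?S ?T (snd c)"
    proof (rule bijective_open_imp_homeomorphic_map)
      show "continuous_map ?S ?T (snd c)"
        unfolding continuous_map_def top using r
        by (auto simp: openin_open_eq[OF img] openin_open_subtopology[OF D])
      show "open_map ?S ?T (snd c)"
        using r by (auto simp: open_map_def openin_open_eq[OF img] openin_open_subtopology[OF D])
      show "snd c ` topspace ?S = topspace ?T"
        unfolding top by simp
      show "inj_on (snd c) (topspace ?S)"
        unfolding top using r by blast
    qed
    then show "chart_of X c"
      using D img by (simp add: chart_of_def)
  qed
next
  case False
  then show ?thesis by (simp add: chart_of_def)
qed

lemma chart_of_openin: "chart_of X c \<Longrightarrow> openin X (dom_chart c)"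
  and chart_of_inj: "chart_of X c \<Longrightarrow> inj_on (snd c) (dom_chart c)"
  and chart_of_open_image: "chart_of X c \<Longrightarrow> openin X U \<Longrightarrow> U \<subseteq> dom_chart c \<Longrightarrow> open (snd c ` U)"
  and chart_of_openin_preimage: "chart_of X c \<Longrightarrow> open W \<Longrightarrow> openin X {p \<in> dom_chart c. snd c p \<in> W}"
  by (simp_all add: chart_of_iff)

lemma chart_of_open_img: "chart_of X c \<Longrightarrow> open (img_chart c)"
  by (simp add: chart_of_def)

lemma local_rep_apply [simp]:
  "inj_on (snd c) (dom_chart c) \<Longrightarrow> p \<in> dom_chart c \<Longrightarrow> local_rep f c d (snd c p) = snd d (f p)"
  by (simp add: local_rep_def)

lemma smooth_wrt_has_derivative:
  assumes "smooth_wrt f c d" "p \<in> dom_chart c" "f p \<in> dom_chart d"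
  shows "(local_rep f c d has_derivative differential f c d p) (at (snd c p))"
  using assms unfolding smooth_wrt_def differential_def by (intro smooth_on_has_derivative) auto

lemma linear_differential:
  "smooth_wrt f c d \<Longrightarrow> p \<in> dom_chart c \<Longrightarrow> f p \<in> dom_chart d \<Longrightarrow> linear (differential f c d p)"
  by (rule has_derivative_linear[OF smooth_wrt_has_derivative])

text \<open>\<open>local_rep\<close> contains \<open>inv_into\<close>, so a closed formula for
  \<open>f\<close> in coordinates agrees with it only on the image of the chart. Agreement near the
  point is all that the derivative sees.\<close>

lemma differentialI:
  assumes c: "chart_of X c" and U: "openin X U" "p \<in> U" "U \<subseteq> dom_chart c"
    and F: "(F has_derivative F') (at (snd c p))" "\<And>p'. p' \<in> U \<Longrightarrow> F (snd c p') = snd d (f p')"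
  shows "differential f c d p = F'"
proof -
  have "(local_rep f c d has_derivative F') (at (snd c p))"
  proof (rule has_derivative_transform_within_open[OF F(1) chart_of_open_image[OF c U(1,3)]])
    fix x assume "x \<in> snd c ` U"
    then obtain p' where p': "p' \<in> U" "x = snd c p'" by blast
    then have "p' \<in> dom_chart c" using U(3) by blast
    then show "F x = local_rep f c d x"
      unfolding p'(2) F(2)[OF p'(1)] by (rule local_rep_apply[OF chart_of_inj[OF c], symmetric])
  qed (use U(2) in blast)
  then show ?thesis
    unfolding differential_def using frechet_derivative_at by metis
qed

lemma differential_compose:
  assumes c: "chart_of X c" and d: "chart_of Y d"
    and U: "openin X U" "p \<in> U" "U \<subseteq> dom_chart c" "f ` U \<subseteq> dom_chart d"
    and f: "smooth_wrt f c d" and f': "smooth_wrt f' d e" "f' (f p) \<in> dom_chart e"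
  shows "differential (f' \<circ> f) c e p v = differential f' d e (f p) (differential f c d p v)"
proof -
  have p: "p \<in> dom_chart c" "f p \<in> dom_chart d" using U by auto
  have "local_rep f c d (snd c p) = snd d (f p)"
    using chart_of_inj[OF c] p(1) by simp
  then have "((\<lambda>x. local_rep f' d e (local_rep f c d x)) has_derivative
      (\<lambda>v. differential f' d e (f p) (differential f c d p v))) (at (snd c p))"
    using has_derivative_compose[OF smooth_wrt_has_derivative[OF f p], of "local_rep f' d e"]
      smooth_wrt_has_derivative[OF f'(1) p(2) f'(2)] by simp
  then have "differential (f' \<circ> f) c e p = (\<lambda>v. differential f' d e (f p) (differential f c d p v))"
  proof (rule differentialI[OF c U(1-3)])
    fix p' assume "p' \<in> U"
    then have "p' \<in> dom_chart c" "f p' \<in> dom_chart d" using U by auto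
    then show "local_rep f' d e (local_rep f c d (snd c p')) = snd e ((f' \<circ> f) p')"
      using chart_of_inj[OF c] chart_of_inj[OF d] by simp
  qed
  then show ?thesis by simp
qed

lemma differential_id_compose:
  assumes "chart_of X c" "chart_of Y d" "openin X U" "p \<in> U" "U \<subseteq> dom_chart c \<inter> dom_chart d"
    and "smooth_wrt id c d" "smooth_wrt id d e" "p \<in> dom_chart e"
  shows "differential id c e p v = differential id d e p (differential id c d p v)"
  using differential_compose[OF assms(1-4), of id id e v] assms by auto

lemma differential_id_self:
  assumes "chart_of X c" "p \<in> dom_chart c"
  shows "differential id c c p v = v"
  by (subst differentialI[OF assms(1) chart_of_openin[OF assms(1)] assms(2) _ has_derivative_ident]) auto

lemma smooth_on_local_rep_compose:
  fixes d :: "('n, 'a::euclidean_space) chart"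
  assumes c: "chart_of X c" and d: "chart_of Y d"
    and U: "openin X U" "U \<subseteq> dom_chart c" "f ` U \<subseteq> T" and T: "openin Y T" "T \<subseteq> dom_chart d"
    and f: "smooth_on (snd c ` U) (local_rep f c d)" and f': "smooth_on (snd d ` T) (local_rep f' d e)"
  shows "smooth_on (snd c ` U) (local_rep (f' \<circ> f) c e)"
proof (rule smooth_on_cong)
  show op: "open (snd c ` U)" using chart_of_open_image[OF c U(1,2)] .
  have "local_rep f c d ` snd c ` U \<subseteq> snd d ` T"
    using U chart_of_inj[OF c] by (auto simp: subset_iff image_subset_iff)
  then show "smooth_on (snd c ` U) (\<lambda>x. local_rep f' d e (local_rep f c d x))"
    using smooth_on_compose[OF op chart_of_open_image[OF d T] f f'] by blast
  show "local_rep f' d e (local_rep f c d x) = local_rep (f' \<circ> f) c e x" if "x \<in> snd c ` U" for x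
    using that U T chart_of_inj[OF c] chart_of_inj[OF d] by (auto simp: subset_iff image_subset_iff)
qed

lemma smooth_wrt_localI:
  assumes c: "chart_of X c"
    and ex: "\<And>p. p \<in> dom_chart c \<Longrightarrow> f p \<in> dom_chart e \<Longrightarrow>
      \<exists>U. openin X U \<and> p \<in> U \<and> U \<subseteq> dom_chart c \<and> smooth_on (snd c ` U) (local_rep f c e)"
  shows "smooth_wrt f c e"
  unfolding smooth_wrt_def
proof (rule smooth_on_local)
  fix x assume "x \<in> snd c ` {p \<in> dom_chart c. f p \<in> dom_chart e}"
  then obtain p U where "x = snd c p" "openin X U" "p \<in> U" "U \<subseteq> dom_chart c"
    "smooth_on (snd c ` U) (local_rep f c e)"
    using ex by blast
  then show "\<exists>U. open U \<and> x \<in> U \<and> smooth_on U (local_rep f c e)"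
    using chart_of_open_image[OF c] by (intro exI[of _ "snd c ` U"]) auto
qed

lemma smooth_manifold_chart: "smooth_manifold X A \<Longrightarrow> c \<in> A \<Longrightarrow> chart_of X c"
  unfolding smooth_manifold_def by blast

lemma smooth_manifold_trans: "smooth_manifold X A \<Longrightarrow> c \<in> A \<Longrightarrow> d \<in> A \<Longrightarrow> smooth_wrt id c d"
  unfolding smooth_manifold_def by blast

lemma smooth_manifold_maximal:
  "smooth_manifold X A \<Longrightarrow> chart_of X c \<Longrightarrow>
    (\<And>d. d \<in> A \<Longrightarrow> smooth_wrt id c d \<and> smooth_wrt id d c) \<Longrightarrow> c \<in> A"
  unfolding smooth_manifold_def by blast

lemma smooth_manifold_Hausdorff: "smooth_manifold X A \<Longrightarrow> Hausdorff_space X"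
  unfolding smooth_manifold_def by blast

lemma smooth_manifold_Union: "smooth_manifold X A \<Longrightarrow> (\<Union>c\<in>A. dom_chart c) = topspace X"
  unfolding smooth_manifold_def by blast

lemma differential_id_inverse:
  assumes c: "chart_of X c" and d: "chart_of X d" and sm: "smooth_wrt id c d" "smooth_wrt id d c"
    and p: "p \<in> dom_chart c" "p \<in> dom_chart d"
  shows "differential id d c p (differential id c d p v) = v"
proof -
  have "openin X (dom_chart c \<inter> dom_chart d)"
    by (intro openin_Int chart_of_openin c d)
  then have "differential id d c p (differential id c d p v) = differential id c c p v"
    by (rule differential_id_compose[symmetric, OF c d _ _ subset_refl sm p(1)]) (simp add: p)
  then show ?thesis using differential_id_self[OF c p(1)] by simp
qed

text \<open>Maximality of the atlas is what admits new coordinates. The transitions between the new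
  chart and an old one are those of \<open>c\<close>, composed with \<open>\<Phi>\<close> or with
  its inverse, and the inverse is smooth by \<open>smooth_inverse\<close>.\<close>

lemma transport_chart:
  fixes A :: "('m, 'a::euclidean_space) chart set" and \<Phi> :: "'a \<Rightarrow> 'a"
  assumes A: "smooth_manifold X A" and c: "c \<in> A"
    and W: "open W" "W \<subseteq> img_chart c"
    and \<Phi>: "smooth_on W \<Phi>" "inj_on \<Phi> W" "\<And>x. x \<in> W \<Longrightarrow> inj (frechet_derivative \<Phi> (at x))"
  shows "({p \<in> dom_chart c. snd c p \<in> W}, \<Phi> \<circ> snd c) \<in> A" (is "?c \<in> A")
proof (rule smooth_manifold_maximal[OF A])
  note C = smooth_manifold_chart[OF A]
  note cc = C[OF c]
  note inv = smooth_inverse[OF W(1) \<Phi>]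
  have inj: "inj_on (snd ?c) (dom_chart ?c)"
    using chart_of_inj[OF cc] \<Phi>(2) by (auto simp: inj_on_def)
  have dom_open: "openin X (dom_chart ?c)"
    using chart_of_openin_preimage[OF cc W(1)] by simp
  have open_im: "open (\<Phi> ` V)" if "open V" "V \<subseteq> W" for V
    using invariance_of_domain[of V \<Phi>] that smooth_on_continuous_on[OF \<Phi>(1)] \<Phi>(2)
    by (meson continuous_on_subset inj_on_subset)
  have im_W: "snd c ` {p \<in> dom_chart c. snd c p \<in> W} = W" using W(2) by auto
  show c': "chart_of X ?c"
    unfolding chart_of_iff
  proof (intro conjI allI impI)
    fix U assume U: "openin X U \<and> U \<subseteq> dom_chart ?c"
    have "open (\<Phi> ` snd c ` U)"
      using U by (intro open_im chart_of_open_image[OF cc]) auto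
    then show "open (snd ?c ` U)" by (simp add: image_comp)
  next
    fix V :: "'a set" assume "open V"
    then have "open (W \<inter> \<Phi> -` V)"
      using continuous_open_preimage[OF smooth_on_continuous_on[OF \<Phi>(1)] W(1)] by blast
    then have "openin X {p \<in> dom_chart c. snd c p \<in> W \<inter> \<Phi> -` V}"
      by (rule chart_of_openin_preimage[OF cc])
    then show "openin X {p \<in> dom_chart ?c. snd ?c p \<in> V}"
      by (rule back_subst) auto
  qed (use inj dom_open in auto)
  fix e assume e: "e \<in> A"
  have op: "openin X (dom_chart ?c \<inter> dom_chart e)"
    using dom_open chart_of_openin[OF C[OF e]] by blast
  have set1: "{p \<in> dom_chart ?c. id p \<in> dom_chart e} = dom_chart ?c \<inter> dom_chart e"
    "{p \<in> dom_chart e. id p \<in> dom_chart ?c} = dom_chart ?c \<inter> dom_chart e"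
    by auto
  have ce: "smooth_on (snd c ` (dom_chart ?c \<inter> dom_chart e)) (local_rep id c e)"
    "smooth_on (snd e ` (dom_chart ?c \<inter> dom_chart e)) (local_rep id e c)"
    using smooth_manifold_trans[OF A c e] smooth_manifold_trans[OF A e c]
    unfolding smooth_wrt_def by (auto elim!: smooth_on_subset)
  have open_c: "open (snd c ` (dom_chart ?c \<inter> dom_chart e))"
    using op by (intro chart_of_open_image[OF cc]) auto
  have open_c': "open (snd ?c ` (dom_chart ?c \<inter> dom_chart e))"
    using op by (intro chart_of_open_image[OF c']) auto
  have open_e: "open (snd e ` (dom_chart ?c \<inter> dom_chart e))"
    using op by (intro chart_of_open_image[OF C[OF e]]) auto
  show "smooth_wrt id ?c e \<and> smooth_wrt id e ?c"
    unfolding smooth_wrt_def set1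
  proof
    show "smooth_on (snd ?c ` (dom_chart ?c \<inter> dom_chart e)) (local_rep id ?c e)"
    proof (rule smooth_on_cong[OF open_c'])
      show "smooth_on (snd ?c ` (dom_chart ?c \<inter> dom_chart e)) (\<lambda>y. local_rep id c e (inv_into W \<Phi> y))"
        by (rule smooth_on_compose[OF open_c' open_c _ ce(1)])
           (use \<Phi>(2) in \<open>auto intro!: smooth_on_subset[OF inv(2)]\<close>)
      fix y assume "y \<in> snd ?c ` (dom_chart ?c \<inter> dom_chart e)"
      then obtain p where p: "p \<in> dom_chart ?c" "p \<in> dom_chart e" "y = snd ?c p" by blast
      show "local_rep id c e (inv_into W \<Phi> y) = local_rep id ?c e y"
        unfolding p(3) using local_rep_apply[OF inj p(1), of id e] p chart_of_inj[OF cc] \<Phi>(2) by simp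
    qed
    show "smooth_on (snd e ` (dom_chart ?c \<inter> dom_chart e)) (local_rep id e ?c)"
    proof (rule smooth_on_cong[OF open_e])
      show "smooth_on (snd e ` (dom_chart ?c \<inter> dom_chart e)) (\<lambda>y. \<Phi> (local_rep id e c y))"
        by (rule smooth_on_compose[OF open_e W(1) ce(2) \<Phi>(1)])
           (use chart_of_inj[OF C[OF e]] in auto)
      show "\<Phi> (local_rep id e c y) = local_rep id e ?c y" for y
        by (simp add: local_rep_def)
    qed
  qed
qed

subsection \<open>Linear algebra\<close>

text \<open>\<open>'b\<close> carries an arbitrary norm, so a linear right inverse \<open>s\<close>
  has to be shown bounded. Its range lies in a Euclidean space, where the unit sphere is compact,
  and \<open>norm (r x)\<close> has a positive minimum on the unit vectors of that range.\<close>

lemma bounded_linear_right_inverse: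
  fixes r :: "'a::euclidean_space \<Rightarrow> 'b::real_normed_vector"
  assumes r: "bounded_linear r" and "surj r"
  obtains s where "bounded_linear s" "\<And>y. r (s y) = y"
proof -
  have linr: "linear r" using r by (rule bounded_linear.linear)
  obtain s where s: "linear s" and rs: "r \<circ> s = id"
    using linear_surjective_right_inverse[OF linr \<open>surj r\<close>] by blast
  then have rs: "r (s y) = y" for y by (simp add: fun_eq_iff)
  let ?T = "range s"
  have T: "subspace ?T"
    by (intro linear_subspace_image s subspace_UNIV)
  have sr: "s (r x) = x" if "x \<in> ?T" for x
    using that rs by auto
  obtain e where e: "e > 0" "\<And>x. x \<in> ?T \<Longrightarrow> e * norm x \<le> norm (r x)"
  proof (cases "sphere 0 1 \<inter> ?T = {}")
    case True
    \<comment> \<open>Without unit vectors the range is the zero space; there is no minimum to take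
      and every bound serves.\<close>
    have "x = 0" if "x \<in> ?T" for x
    proof (rule ccontr)
      assume "x \<noteq> 0"
      then have "(1 / norm x) *\<^sub>R x \<in> sphere 0 1 \<inter> ?T"
        using subspace_scale[OF T that] by auto
      with True show False by blast
    qed
    then show ?thesis using that[of 1] by force
  next
    case False
    have "compact (sphere 0 1 \<inter> ?T)"
      by (intro compact_Int_closed compact_sphere closed_subspace T)
    moreover have "continuous_on (sphere 0 1 \<inter> ?T) (\<lambda>x. norm (r x))"
      by (intro continuous_on_norm linear_continuous_on r)
    ultimately obtain z where z: "z \<in> sphere 0 1 \<inter> ?T"
      "\<And>x. x \<in> sphere 0 1 \<inter> ?T \<Longrightarrow> norm (r z) \<le> norm (r x)"
      using continuous_attains_inf[OF _ False] by blast
    have "r z \<noteq> 0"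
      using z(1) sr[of z] linear_0[OF s] by auto
    moreover have "norm (r z) * norm x \<le> norm (r x)" if "x \<in> ?T" for x
    proof (cases "x = 0")
      case False
      then have "(1 / norm x) *\<^sub>R x \<in> sphere 0 1 \<inter> ?T"
        using subspace_scale[OF T that] by auto
      from z(2)[OF this] False show ?thesis
        by (simp add: linear_scale[OF linr] field_simps)
    qed simp
    ultimately show ?thesis using that[of "norm (r z)"] by simp
  qed
  have "bounded_linear s"
  proof (rule bounded_linear_intro)
    show "norm (s y) \<le> norm y * (1 / e)" for y
      using e(2)[of "s y"] e(1) by (simp add: rs field_simps)
  qed (simp_all add: linear_add[OF s] linear_scale[OF s])
  then show ?thesis using that rs by blast
qed

text \<open>A vector outside the range, added to a basis of the range, would give an independent set
  larger than a basis of the whole space; the finite spanning set makes the latter finite.\<close>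

lemma surj_if_dim_range:
  fixes r :: "'a::euclidean_space \<Rightarrow> 'b::real_normed_vector"
  assumes r: "linear r" and B: "finite B" "span B = (UNIV :: 'b set)"
    and dim: "dim (range r) = dim (UNIV :: 'b set)"
  shows "surj r"
proof (rule ccontr)
  assume "\<not> surj r"
  then obtain y where y: "y \<notin> range r" by blast
  obtain C where C: "C \<subseteq> range r" "independent C" "range r \<subseteq> span C" "card C = dim (range r)"
    by (rule basis_exists)
  obtain D :: "'b set" where "D \<subseteq> UNIV" and D: "independent D" "UNIV \<subseteq> span D" "card D = dim (UNIV :: 'b set)"
    by (rule basis_exists[of "UNIV :: 'b set"])
  have finD: "finite D"
    using independent_span_bound[OF B(1) D(1)] B(2) by simp
  have "span C \<subseteq> range r"
    using C(1) by (rule span_minimal) (intro linear_subspace_image r subspace_UNIV)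
  then have y': "y \<notin> span C" using y by blast
  then have "independent (insert y C)"
    using C(2) by (simp add: independent_insert)
  then have "finite (insert y C) \<and> card (insert y C) \<le> card D"
    by (rule independent_span_bound[OF finD]) (use D(2) in auto)
  moreover have "y \<notin> C" using y' span_base by blast
  ultimately show False using C(4) D(3) dim by auto
qed

text \<open>The domain is the direct sum of the kernel and \<open>range s\<close>, and
  \<open>range s\<close> has the dimension of \<open>'b\<close>, so the kernel has the dimension of
  \<open>'c\<close>. The left inverse \<open>P\<close> of \<open>i\<close> is linear on the whole
  space, which later extends data from a slice to an ambient chart.\<close>

lemma kernel_parametrization:
  fixes r :: "'a::euclidean_space \<Rightarrow> 'b::real_normed_vector"
  assumes r: "linear r" and s: "linear s" "\<And>y. r (s y) = y"
    and dim: "DIM('c::euclidean_space) = DIM('a) - dim (UNIV :: 'b set)"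
  obtains i :: "'c::euclidean_space \<Rightarrow> 'a" and P where "linear i" "linear P" "\<And>w. P (i w) = w" "range i = {v. r v = 0}"
proof -
  let ?K = "{v. r v = 0}"
  have K: "subspace ?K" using r by (rule linear_subspace_kernel)
  have T: "subspace (range s)"
    by (intro linear_subspace_image s subspace_UNIV)
  have "inj_on r (span (range s))"
    unfolding span_eq_iff[THEN iffD2, OF T] using s(2) by (auto intro!: inj_onI)
  from dim_image_eq[OF r this] have dimT: "dim (range s) = dim (UNIV :: 'b set)"
    by (simp add: image_image s(2))
  have "x \<in> {x + y |x y. x \<in> ?K \<and> y \<in> range s}" for x
  proof -
    have "x = (x - s (r x)) + s (r x)" "r (x - s (r x)) = 0"
      by (simp_all add: linear_diff[OF r] s(2))
    then show ?thesis by blast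
  qed
  then have "{x + y |x y. x \<in> ?K \<and> y \<in> range s} = UNIV" by blast
  moreover have "?K \<inter> range s = {0}"
    using s(2) linear_0[OF r] linear_0[OF s(1)] by auto
  ultimately have "DIM('a) = dim ?K + dim (UNIV :: 'b set)"
    using dim_sums_Int[OF K T] dimT by simp
  then have "dim (UNIV :: 'c set) = dim ?K" using dim by simp
  then obtain i :: "'c \<Rightarrow> 'a" and P where "linear i" "linear P" "i ` UNIV = ?K" "\<And>x. P (i x) = x"
    using isometries_subspaces[OF subspace_UNIV K] by (metis UNIV_I)
  then show ?thesis using that by metis
qed

subsection \<open>Charts adapted to a submersion\<close>

locale submersion =
  fixes X :: "'m topology" and A :: "('m, 'a::euclidean_space) chart set"
    and Y :: "'n topology" and B :: "('n, 'b::real_normed_vector) chart set" and \<pi> :: "'m \<Rightarrow> 'n"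
  assumes A: "smooth_manifold X A" and B: "smooth_manifold Y B" and smooth_pi: "smooth_map X A Y B \<pi>"
    and dim_range_differential: "\<And>c d p. c \<in> A \<Longrightarrow> d \<in> B \<Longrightarrow> p \<in> dom_chart c \<Longrightarrow> \<pi> p \<in> dom_chart d \<Longrightarrow>
      dim (range (differential \<pi> c d p)) = dim (UNIV :: 'b set)"
begin

lemma chart_A: "c \<in> A \<Longrightarrow> chart_of X c" using A by (rule smooth_manifold_chart)
lemma chart_B: "d \<in> B \<Longrightarrow> chart_of Y d" using B by (rule smooth_manifold_chart)

lemma smooth_wrt_pi: "c \<in> A \<Longrightarrow> d \<in> B \<Longrightarrow> smooth_wrt \<pi> c d"
  using smooth_pi unfolding smooth_map_def by blast

lemma openin_pi_dom: "c \<in> A \<Longrightarrow> d \<in> B \<Longrightarrow> openin X {p \<in> dom_chart c. \<pi> p \<in> dom_chart d}"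
proof -
  assume c: "c \<in> A" and d: "d \<in> B"
  have "openin X {p \<in> topspace X. \<pi> p \<in> dom_chart d}"
    using smooth_pi chart_of_openin[OF chart_B[OF d]] unfolding smooth_map_def
    by (blast intro: openin_continuous_map_preimage)
  with chart_of_openin[OF chart_A[OF c]]
  have "openin X (dom_chart c \<inter> {p \<in> topspace X. \<pi> p \<in> dom_chart d})" by (rule openin_Int)
  moreover have "dom_chart c \<inter> {p \<in> topspace X. \<pi> p \<in> dom_chart d} = {p \<in> dom_chart c. \<pi> p \<in> dom_chart d}"
    using openin_subset[OF chart_of_openin[OF chart_A[OF c]]] by blast
  ultimately show ?thesis by simp
qed

text \<open>The normal form of the submersion theorem without a splitting of the model space:
  \<open>r\<close> is any bounded linear surjection, not a coordinate projection.\<close>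

definition linearizes :: "('m, 'a) chart \<Rightarrow> ('n, 'b) chart \<Rightarrow> ('a \<Rightarrow> 'b) \<Rightarrow> bool" where
  "linearizes c d r \<longleftrightarrow> c \<in> A \<and> d \<in> B \<and> bounded_linear r \<and> surj r \<and>
     (\<forall>p\<in>dom_chart c. \<pi> p \<in> dom_chart d \<and> snd d (\<pi> p) = r (snd c p))"

lemma linearizing_chart_exists:
  assumes "p \<in> topspace X"
  obtains c d r where "linearizes c d r" "p \<in> dom_chart c"
proof -
  obtain c where c: "c \<in> A" "p \<in> dom_chart c"
    using smooth_manifold_Union[OF A] assms by blast
  have "\<pi> p \<in> topspace Y"
    using smooth_pi assms unfolding smooth_map_def continuous_map_def by blast
  then obtain d where d: "d \<in> B" "\<pi> p \<in> dom_chart d"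
    using smooth_manifold_Union[OF B] by blast
  note C = chart_A[OF c(1)] and D = chart_B[OF d(1)]
  let ?U = "{p \<in> dom_chart c. \<pi> p \<in> dom_chart d}" and ?\<rho> = "local_rep \<pi> c d"
  let ?S = "snd c ` ?U" and ?r = "differential \<pi> c d p"
  have S: "open ?S"
    using openin_pi_dom[OF c(1) d(1)] by (rule chart_of_open_image[OF C]) blast
  have x0: "snd c p \<in> ?S" using c(2) d(2) by blast
  have \<rho>: "smooth_on ?S ?\<rho>"
    using smooth_wrt_pi[OF c(1) d(1)] unfolding smooth_wrt_def .
  have der: "(?\<rho> has_derivative ?r) (at (snd c p))"
    by (rule smooth_wrt_has_derivative[OF smooth_wrt_pi[OF c(1) d(1)] c(2) d(2)])
  have r: "bounded_linear ?r" by (rule has_derivative_bounded_linear[OF der])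
  obtain Bs :: "'b set" where "finite Bs" "span Bs = UNIV"
    using B unfolding smooth_manifold_def by blast
  then have surj: "surj ?r"
    using surj_if_dim_range[OF bounded_linear.linear[OF r] _ _ dim_range_differential[OF c(1) d(1) c(2) d(2)]]
    by blast
  obtain s where s: "bounded_linear s" "\<And>y. ?r (s y) = y"
    using bounded_linear_right_inverse[OF r surj] by metis
  \<comment> \<open>chosen so that \<open>r \<circ> \<Phi> = \<rho>\<close>, with the identity as derivative at the base point\<close>
  define \<Phi> where "\<Phi> x = x + s (?\<rho> x - ?r x)" for x
  have smooth: "smooth_on ?S \<Phi>"
    unfolding \<Phi>_def
    by (intro smooth_on_add smooth_on_linear_compose[OF _ s(1)] smooth_on_diff S \<rho>
        smooth_on_linear r bounded_linear_ident)
  have "(\<Phi> has_derivative (\<lambda>v. v + s (?r v - ?r v))) (at (snd c p))"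
    unfolding \<Phi>_def
    by (intro has_derivative_add has_derivative_ident bounded_linear.has_derivative[OF s(1)]
        has_derivative_diff der bounded_linear_imp_has_derivative r)
  then have "frechet_derivative \<Phi> (at (snd c p)) = (\<lambda>v. v + s (?r v - ?r v))"
    by (rule frechet_derivative_at[symmetric])
  then have id: "frechet_derivative \<Phi> (at (snd c p)) v = v" for v
    using linear_0[OF bounded_linear.linear[OF s(1)]] by simp
  obtain W where W: "open W" "snd c p \<in> W" "W \<subseteq> ?S" "inj_on \<Phi> W"
    "\<forall>x\<in>W. inj (frechet_derivative \<Phi> (at x))"
    by (rule locally_injective_near_identity[OF S x0 smooth id])
  let ?c = "({p \<in> dom_chart c. snd c p \<in> W}, \<Phi> \<circ> snd c)"
  have "?c \<in> A"
    by (rule transport_chart[OF A c(1) W(1) _ smooth_on_subset[OF smooth W(3)] W(4) W(5)[rule_format]])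
       (use W(3) in auto)
  moreover have "\<pi> q \<in> dom_chart d \<and> snd d (\<pi> q) = ?r (snd ?c q)" if "q \<in> dom_chart ?c" for q
  proof -
    have q: "q \<in> dom_chart c" "snd c q \<in> ?S" using that W(3) by auto
    then have "\<pi> q \<in> dom_chart d"
      using chart_of_inj[OF C] by (auto dest: inj_onD)
    moreover have "?r (\<Phi> (snd c q)) = ?\<rho> (snd c q)"
      unfolding \<Phi>_def linear_add[OF bounded_linear.linear[OF r]] s(2) by simp
    ultimately show ?thesis
      using q(1) chart_of_inj[OF C] by simp
  qed
  ultimately have "linearizes ?c d ?r"
    unfolding linearizes_def using d(1) r surj by blast
  then show ?thesis
    using that c(2) W(2) by simp
qed

end

section \<open>Slice charts of a fibre, and ambient charts fitted to a given chart of the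
  fibre\<close>

locale submersion_fibre = submersion X A Y B \<pi>
  for X :: "'m topology" and A :: "('m, 'a::euclidean_space) chart set"
    and Y :: "'n topology" and B :: "('n, 'b::real_normed_vector) chart set" and \<pi> :: "'m \<Rightarrow> 'n" +
  fixes q :: 'n and F :: "'m set" and K :: "('m, 'c::euclidean_space) chart set"
  defines "F \<equiv> {p \<in> topspace X. \<pi> p = q}" and "K \<equiv> submanifold_atlas X A F"
  assumes dim_fibre: "DIM('c) = DIM('a) - dim (UNIV :: 'b set)"
begin

text \<open>\<open>k\<close> need not be a restriction of \<open>c\<close>, and its domain may be
  larger than the part of the fibre covered by \<open>c\<close>. The offset \<open>b\<close> belongs
  to the model space and need not be the coordinate vector of a point.\<close>

definition adapted ::
  "('m, 'a) chart \<Rightarrow> ('n, 'b) chart \<Rightarrow> ('a \<Rightarrow> 'b) \<Rightarrow> ('c \<Rightarrow> 'a) \<Rightarrow> ('a \<Rightarrow> 'c) \<Rightarrow> 'a \<Rightarrow> ('m, 'c) chart \<Rightarrow> bool"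
  where "adapted c d r i P b k \<longleftrightarrow> linearizes c d r \<and> linear i \<and> linear P \<and> (\<forall>w. P (i w) = w) \<and>
     range i = {v. r v = 0} \<and> F \<inter> dom_chart c \<subseteq> dom_chart k \<and>
     (\<forall>p \<in> F \<inter> dom_chart c. snd c p = b + i (snd k p))"

lemma openin_F: "chart_of X c \<Longrightarrow> openin (subtopology X F) (F \<inter> dom_chart c)"
  unfolding openin_subtopology using chart_of_openin by blast

lemma dom_K: "chart_of (subtopology X F) k \<Longrightarrow> dom_chart k \<subseteq> F"
  using chart_of_openin[of "subtopology X F" k] openin_subset by fastforce

lemma adapted_in_A: "adapted c d r i P b k \<Longrightarrow> c \<in> A"
  by (simp add: adapted_def linearizes_def)

lemma adapted_coord:
  "adapted c d r i P b k \<Longrightarrow> p \<in> F \<Longrightarrow> p \<in> dom_chart c \<Longrightarrow> snd c p = b + i (snd k p)"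
  by (simp add: adapted_def)

text \<open>An affine inclusion has constant differential. The pullback conditions for tensors on
  the fibre thereby become mere substitution of \<open>i\<close>.\<close>

lemma adapted_differential:
  assumes k: "chart_of (subtopology X F) k" and ad: "adapted c d r i P b k"
    and p: "p \<in> F" "p \<in> dom_chart c"
  shows "differential id k c p = i"
proof (rule differentialI[OF k openin_F[OF chart_A[OF adapted_in_A[OF ad]]]])
  have "bounded_linear i" using ad linear_conv_bounded_linear unfolding adapted_def by blast
  then have "((\<lambda>y. b + i y) has_derivative (\<lambda>v. 0 + i v)) (at (snd k p))"
    by (intro has_derivative_add has_derivative_const bounded_linear_imp_has_derivative)
  then show "((\<lambda>y. b + i y) has_derivative i) (at (snd k p))" by simp
  show "b + i (snd k p') = snd c (id p')" if "p' \<in> F \<inter> dom_chart c" for p'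
    using adapted_coord[OF ad] that by simp
qed (use p ad in \<open>auto simp: adapted_def\<close>)

lemma adapted_smooth:
  assumes k: "chart_of (subtopology X F) k" and ad: "adapted c d r i P b k"
    and e: "e \<in> A"
  shows "smooth_on (snd k ` (F \<inter> dom_chart c \<inter> dom_chart e)) (local_rep id k e)"
proof (rule smooth_on_cong)
  note c = adapted_in_A[OF ad]
  let ?U = "F \<inter> dom_chart c \<inter> dom_chart e"
  have U: "?U \<subseteq> dom_chart k" using ad unfolding adapted_def by blast
  have "openin (subtopology X F) ?U"
    using openin_Int[OF openin_F[OF chart_A[OF c]] openin_F[OF chart_A[OF e]]]
    by (rule back_subst) blast
  then show op: "open (snd k ` ?U)" using U by (rule chart_of_open_image[OF k])
  have "bounded_linear i" using ad linear_conv_bounded_linear unfolding adapted_def by blast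
  then have 1: "smooth_on (snd k ` ?U) (\<lambda>y. b + i y)"
    by (intro smooth_on_add smooth_on_const smooth_on_linear op)
  have opce: "open (snd c ` (dom_chart c \<inter> dom_chart e))"
    by (rule chart_of_open_image[OF chart_A[OF c]])
       (auto intro: openin_Int chart_of_openin chart_A c e)
  have 2: "smooth_on (snd c ` (dom_chart c \<inter> dom_chart e)) (local_rep id c e)"
    using smooth_manifold_trans[OF A c e] unfolding smooth_wrt_def by (auto elim!: smooth_on_subset)
  show "smooth_on (snd k ` ?U) (\<lambda>y. local_rep id c e (b + i y))"
    by (rule smooth_on_compose[OF op opce 1 2]) (use adapted_coord[OF ad] in force)
  fix y assume "y \<in> snd k ` ?U"
  then obtain p where p: "p \<in> ?U" "y = snd k p" by blast
  then have "p \<in> dom_chart k" "p \<in> dom_chart c" using U by auto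
  then show "local_rep id c e (b + i y) = local_rep id k e y"
    using p adapted_coord[OF ad, of p] chart_of_inj[OF k] chart_of_inj[OF chart_A[OF c]]
      local_rep_apply[of c p id e] local_rep_apply[of k p id e] by simp
qed

text \<open>Smoothness into any ambient chart \<open>e\<close> follows by passing through an adapted
  one. The injective map \<open>i\<close> is the differential from \<open>k\<close> to
  \<open>e\<close> followed by that from \<open>e\<close> to \<open>c\<close>, so the first factor
  is injective.\<close>

lemma in_K_if_locally_adapted:
  assumes k: "chart_of (subtopology X F) k"
    and ex: "\<And>p. p \<in> dom_chart k \<Longrightarrow> \<exists>c d r i P b. adapted c d r i P b k \<and> p \<in> dom_chart c"
  shows "k \<in> K"
  unfolding K_def submanifold_atlas_def
proof (intro CollectI conjI ballI k)
  fix e assume e: "e \<in> A"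
  show sm: "smooth_wrt id k e"
  proof (rule smooth_wrt_localI[OF k])
    fix p assume p: "p \<in> dom_chart k" "id p \<in> dom_chart e"
    obtain c d r i P b where ad: "adapted c d r i P b k" and pc: "p \<in> dom_chart c" using ex[OF p(1)] by blast
    let ?U = "F \<inter> dom_chart c \<inter> dom_chart e"
    have "openin (subtopology X F) ?U"
      using openin_Int[OF openin_F[OF chart_A[OF adapted_in_A[OF ad]]] openin_F[OF chart_A[OF e]]]
      by (rule back_subst) blast
    moreover have "p \<in> ?U" using p pc dom_K[OF k] by auto
    moreover have "?U \<subseteq> dom_chart k" using ad unfolding adapted_def by blast
    ultimately show "\<exists>U. openin (subtopology X F) U \<and> p \<in> U \<and> U \<subseteq> dom_chart k \<and>
        smooth_on (snd k ` U) (local_rep id k e)"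
      using adapted_smooth[OF k ad e] by blast
  qed
  fix p assume p: "p \<in> dom_chart k \<inter> dom_chart e"
  then obtain c d r i P b where ad: "adapted c d r i P b k" and pc: "p \<in> dom_chart c" using ex by blast
  note c = adapted_in_A[OF ad]
  have pF: "p \<in> F" using p dom_K[OF k] by blast
  have smc: "smooth_wrt id k c"
  proof (rule smooth_wrt_localI[OF k])
    fix p assume p: "p \<in> dom_chart k" "id p \<in> dom_chart c"
    have "F \<inter> dom_chart c \<subseteq> dom_chart k" using ad unfolding adapted_def by blast
    then show "\<exists>U. openin (subtopology X F) U \<and> p \<in> U \<and> U \<subseteq> dom_chart k \<and>
        smooth_on (snd k ` U) (local_rep id k c)"
      using adapted_smooth[OF k ad c] openin_F[OF chart_A[OF c]] p dom_K[OF k]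
      by (intro exI[of _ "F \<inter> dom_chart c"]) auto
  qed
  have "differential id k c p v = differential id e c p (differential id k e p v)" for v
    by (rule differential_id_compose[OF k chart_A[OF e], of "dom_chart k \<inter> (F \<inter> dom_chart e)"])
       (use p pF pc sm smooth_manifold_trans[OF A e c] chart_of_openin[OF k] openin_F[OF chart_A[OF e]] in auto)
  moreover have "inj i" using ad unfolding adapted_def by (metis injI)
  ultimately show "inj (differential id k e p)"
    unfolding adapted_differential[OF k ad pF pc] by (metis injD injI)
qed

lemma K_chart: "k \<in> K \<Longrightarrow> chart_of (subtopology X F) k"
  and K_smooth: "k \<in> K \<Longrightarrow> c \<in> A \<Longrightarrow> smooth_wrt id k c"
  and K_inj: "k \<in> K \<Longrightarrow> c \<in> A \<Longrightarrow> p \<in> dom_chart k \<Longrightarrow> p \<in> dom_chart c \<Longrightarrow> inj (differential id k c p)"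
  by (simp_all add: K_def submanifold_atlas_def)

text \<open>The chart \<open>d\<close> separates points. Hence a point of the domain of
  \<open>c\<close> lies in the fibre exactly if \<open>r\<close> takes the same value at it as at
  \<open>p\<close>, that is, if its coordinates differ from those of \<open>p\<close> by an element
  of \<open>range i\<close>.\<close>

lemma slice_chart:
  assumes c: "linearizes c d r" and p: "p \<in> F" "p \<in> dom_chart c"
    and iP: "linear i" "linear P" "\<And>w. P (i w) = w" "range i = {v. r v = 0}"
  obtains b k where "k \<in> K" "k = (F \<inter> dom_chart c, P \<circ> snd c)" "adapted c d r i P b k"
proof -
  \<comment> \<open>This choice gives \<open>P b = 0\<close>, so that \<open>P\<close> recovers
    \<open>y\<close> from \<open>b + i y\<close>.\<close>
  define b where "b = snd c p - i (P (snd c p))"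
  define k where "k = (F \<inter> dom_chart c, P \<circ> snd c)"
  have cA: "c \<in> A" and dB: "d \<in> B" and r: "linear r"
    and \<pi>: "\<And>p'. p' \<in> dom_chart c \<Longrightarrow> \<pi> p' \<in> dom_chart d \<and> snd d (\<pi> p') = r (snd c p')"
    using c bounded_linear.linear unfolding linearizes_def by auto
  note C = chart_A[OF cA]
  have slice: "p' \<in> F \<longleftrightarrow> snd c p' = b + i (P (snd c p'))" if p': "p' \<in> dom_chart c" for p'
  proof -
    have "p' \<in> F \<longleftrightarrow> \<pi> p' = \<pi> p"
      using p p' openin_subset[OF chart_of_openin[OF C]] by (auto simp: F_def)
    also have "\<dots> \<longleftrightarrow> r (snd c p') = r (snd c p)"
      using \<pi>[OF p'] \<pi>[OF p(2)] inj_on_eq_iff[OF chart_of_inj[OF chart_B[OF dB]]] by metis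
    also have "\<dots> \<longleftrightarrow> snd c p' - snd c p \<in> range i"
      unfolding iP(4) by (simp add: linear_diff[OF r])
    also have "\<dots> \<longleftrightarrow> snd c p' - snd c p = i (P (snd c p' - snd c p))"
    proof
      assume "snd c p' - snd c p \<in> range i"
      then obtain w where "snd c p' - snd c p = i w" by blast
      then show "snd c p' - snd c p = i (P (snd c p' - snd c p))" by (simp only: iP(3))
    next
      assume "snd c p' - snd c p = i (P (snd c p' - snd c p))"
      then show "snd c p' - snd c p \<in> range i" by (rule range_eqI)
    qed
    also have "\<dots> \<longleftrightarrow> snd c p' = b + i (P (snd c p'))"
      unfolding b_def by (simp add: linear_diff[OF iP(2)] linear_diff[OF iP(1)] algebra_simps)
    finally show ?thesis .
  qed
  have bl: "bounded_linear i" "bounded_linear P"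
    using iP(1,2) by (simp_all add: linear_conv_bounded_linear)
  have contP: "continuous_on UNIV P"
    by (intro linear_continuous_on bl)
  have conti: "continuous_on UNIV (\<lambda>y. b + i y)"
    by (intro continuous_on_add continuous_on_const linear_continuous_on bl)
  have Pb: "P b = 0"
    unfolding b_def by (simp add: linear_diff[OF iP(2)] iP(3))
  have k: "chart_of (subtopology X F) k"
    unfolding chart_of_iff
  proof (intro conjI allI impI)
    show "openin (subtopology X F) (dom_chart k)"
      using openin_F[OF C] by (simp add: k_def)
    show "inj_on (snd k) (dom_chart k)"
    proof (rule inj_onI)
      fix p1 p2 assume h: "p1 \<in> dom_chart k" "p2 \<in> dom_chart k" "snd k p1 = snd k p2"
      then have "snd c p1 = snd c p2"
        using slice[of p1] slice[of p2] by (simp add: k_def)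
      then show "p1 = p2"
        using h chart_of_inj[OF C] by (auto simp: k_def dest: inj_onD)
    qed
  next
    fix U assume U: "openin (subtopology X F) U \<and> U \<subseteq> dom_chart k"
    then obtain U' where U': "openin X U'" "U = F \<inter> U'"
      by (auto simp: openin_subtopology)
    have "open (snd c ` (U' \<inter> dom_chart c))"
      by (rule chart_of_open_image[OF C]) (auto intro: openin_Int U' chart_of_openin[OF C])
    then have "open ((\<lambda>y. b + i y) -` snd c ` (U' \<inter> dom_chart c))"
      using conti by (simp add: open_vimage)
    \<comment> \<open>The inverse of the chart is the restriction of an affine map that is
      continuous on all of \<open>'c\<close>, so images of open sets become preimages of open
      sets.\<close>
    moreover have "(\<lambda>y. b + i y) -` snd c ` (U' \<inter> dom_chart c) = snd k ` U"
    proof (intro equalityI subsetI)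
      fix y assume "y \<in> (\<lambda>y. b + i y) -` snd c ` (U' \<inter> dom_chart c)"
      then obtain p' where p': "p' \<in> U'" "p' \<in> dom_chart c" "b + i y = snd c p'" by auto
      have "y = P (b + i y)"
        by (simp add: linear_add[OF iP(2)] Pb iP(3))
      then have y: "y = P (snd c p')" using p'(3) by simp
      then have "p' \<in> F" using slice[OF p'(2)] p'(3) by simp
      then show "y \<in> snd k ` U" using y p' U' by (auto simp: k_def)
    next
      fix y assume "y \<in> snd k ` U"
      then obtain p' where p': "p' \<in> U" "y = P (snd c p')" by (auto simp: k_def)
      then have "p' \<in> F" "p' \<in> U'" "p' \<in> dom_chart c" using U U' by (auto simp: k_def)
      then show "y \<in> (\<lambda>y. b + i y) -` snd c ` (U' \<inter> dom_chart c)"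
        using slice[of p'] p'(2) by auto
    qed
    ultimately show "open (snd k ` U)" by simp
  next
    fix W :: "'c set" assume "open W"
    then have "open (P -` W)" using contP by (simp add: open_vimage)
    then have "openin X {p \<in> dom_chart c. snd c p \<in> P -` W}"
      by (rule chart_of_openin_preimage[OF C])
    then show "openin (subtopology X F) {p \<in> dom_chart k. snd k p \<in> W}"
      unfolding openin_subtopology
      by (intro exI[of _ "{p \<in> dom_chart c. snd c p \<in> P -` W}"]) (auto simp: k_def)
  qed
  have ad: "adapted c d r i P b k"
    unfolding adapted_def using c iP slice by (auto simp: k_def)
  have "k \<in> K"
  proof (rule in_K_if_locally_adapted[OF k])
    show "\<exists>c d r i P b. adapted c d r i P b k \<and> p \<in> dom_chart c" if "p \<in> dom_chart k" for p
    proof -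
      have "p \<in> dom_chart c" using that by (simp add: k_def)
      with ad show ?thesis by blast
    qed
  qed
  then show ?thesis using that ad k_def by blast
qed

lemma kernel_parametrization_linearizes:
  assumes "linearizes c d r"
  obtains i :: "'c \<Rightarrow> 'a" and P where "linear i" "linear P" "\<And>w. P (i w) = w" "range i = {v. r v = 0}"
proof -
  have r: "bounded_linear r" "surj r" using assms unfolding linearizes_def by auto
  obtain s where s: "bounded_linear s" "\<And>y. r (s y) = y"
    using bounded_linear_right_inverse[OF r] by metis
  show ?thesis
    using kernel_parametrization[OF bounded_linear.linear[OF r(1)] bounded_linear.linear[OF s(1)] s(2) dim_fibre] that
    by metis
qed

lemma F_covered: "(\<Union>k\<in>K. dom_chart k) = F"
proof
  show "(\<Union>k\<in>K. dom_chart k) \<subseteq> F" using dom_K K_chart by blast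
  show "F \<subseteq> (\<Union>k\<in>K. dom_chart k)"
  proof
    fix p assume p: "p \<in> F"
    then have "p \<in> topspace X" by (simp add: F_def)
    then obtain c d r where c: "linearizes c d r" "p \<in> dom_chart c"
      using linearizing_chart_exists by metis
    obtain i :: "'c \<Rightarrow> 'a" and P where iP: "linear i" "linear P" "\<And>w. P (i w) = w" "range i = {v. r v = 0}"
      using kernel_parametrization_linearizes[OF c(1)] by metis
    obtain b k where "k \<in> K" "k = (F \<inter> dom_chart c, P \<circ> snd c)"
      using slice_chart[OF c(1) p c(2) iP] by metis
    then show "p \<in> (\<Union>k\<in>K. dom_chart k)" using p c(2) by force
  qed
qed

text \<open>A chart \<open>k\<close> of the fibre and a slice chart \<open>k0\<close> around
  \<open>p\<close> differ by a transition whose derivatives are injective, because \<open>k\<close>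
  is an immersion. Its inverse is smooth and acts on the coordinates along the slice;
  \<open>P\<close> extends this action to a change of the ambient coordinates that leaves
  \<open>r\<close> alone.\<close>

lemma adapted_exists:
  assumes kK: "k \<in> K" and pk: "p \<in> dom_chart k"
  obtains c d r i P b where "adapted c d r i P b k" "p \<in> dom_chart c"
proof -
  note k = K_chart[OF kK]
  have p: "p \<in> F" using dom_K[OF k] pk by blast
  then have "p \<in> topspace X" by (simp add: F_def)
  then obtain c0 d r where c0: "linearizes c0 d r" "p \<in> dom_chart c0"
    using linearizing_chart_exists by metis
  obtain i :: "'c \<Rightarrow> 'a" and P where iP: "linear i" "linear P" "\<And>w. P (i w) = w" "range i = {v. r v = 0}"
    using kernel_parametrization_linearizes[OF c0(1)] by metis
  obtain b k0 where k0: "k0 \<in> K" "k0 = (F \<inter> dom_chart c0, P \<circ> snd c0)" "adapted c0 d r i P b k0"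
    using slice_chart[OF c0(1) p c0(2) iP] by metis
  note c0A = adapted_in_A[OF k0(3)]
  note C0 = chart_A[OF c0A] and K0 = K_chart[OF k0(1)]
  have bi: "bounded_linear i" and bP: "bounded_linear P"
    using iP(1,2) by (simp_all add: linear_conv_bounded_linear)
  let ?U = "dom_chart k \<inter> dom_chart k0"
  let ?S = "snd k ` ?U" and ?T = "snd k0 ` ?U" and ?f = "local_rep id k k0"
  have U: "openin (subtopology X F) ?U" by (intro openin_Int chart_of_openin k K0)
  have S: "open ?S" using U by (intro chart_of_open_image[OF k]) auto
  have T: "open ?T" using U by (intro chart_of_open_image[OF K0]) auto
  have kc0: "smooth_on ?S (local_rep id k c0)"
    using K_smooth[OF kK c0A] unfolding smooth_wrt_def by (rule smooth_on_subset) (auto simp: k0(2))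
  have f_eq: "?f = (\<lambda>x. P (local_rep id k c0 x))"
    by (simp add: fun_eq_iff local_rep_def k0(2))
  have f: "smooth_on ?S ?f"
    using smooth_on_linear_compose[OF S bP kc0] by (simp only: f_eq)
  have fk: "?f (snd k p') = snd k0 p'" if "p' \<in> ?U" for p'
    using that chart_of_inj[OF k] by simp
  have inj_f: "inj_on ?f ?S"
    using chart_of_inj[OF K0] chart_of_inj[OF k] by (auto simp: inj_on_def fk)
  have fS: "?f ` ?S = ?T" unfolding image_image using fk by auto
  \<comment> \<open>Up to the constant \<open>b\<close>, the composite of \<open>?f\<close> with
    \<open>i\<close> is the inclusion read from \<open>k\<close> to \<open>c0\<close>, whose
    differential is injective.\<close>
  have "inj (frechet_derivative ?f (at x))" if x: "x \<in> ?S" for x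
  proof -
    obtain p' where p': "p' \<in> ?U" "x = snd k p'" using x by blast
    then have p'': "p' \<in> dom_chart k" "p' \<in> F" "p' \<in> dom_chart c0" by (auto simp: k0(2))
    have "(?f has_derivative frechet_derivative ?f (at x)) (at x)"
      using f x by (rule smooth_on_has_derivative)
    then have "((\<lambda>y. b + i (?f y)) has_derivative (\<lambda>v. 0 + i (frechet_derivative ?f (at x) v))) (at x)"
      by (intro has_derivative_add has_derivative_const bounded_linear.has_derivative[OF bi])
    then have D: "((\<lambda>y. b + i (?f y)) has_derivative (\<lambda>v. i (frechet_derivative ?f (at x) v))) (at (snd k p'))"
      by (simp add: p'(2))
    have "differential id k c0 p' = (\<lambda>v. i (frechet_derivative ?f (at x) v))"
    proof (rule differentialI[OF k U p'(1) _ D])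
      fix p2 assume p2: "p2 \<in> ?U"
      then have "p2 \<in> F" "p2 \<in> dom_chart c0" by (auto simp: k0(2))
      then show "b + i (?f (snd k p2)) = snd c0 (id p2)"
        using adapted_coord[OF k0(3)] fk[OF p2] by simp
    qed simp
    then show ?thesis
      using K_inj[OF kK c0A p''(1,3)] unfolding inj_def by metis
  qed
  note inv = smooth_inverse[OF S f inj_f this, unfolded fS]
  let ?\<phi> = "inv_into ?S ?f"
  have \<phi>k: "?\<phi> (snd k0 p') = snd k p'" if "p' \<in> ?U" for p'
    using inv_into_f_f[OF inj_f, of "snd k p'"] that fk[OF that] by auto
  have f\<phi>: "?f (?\<phi> y) = y" if "y \<in> ?T" for y
    using that f_inv_into_f[of y ?f ?S] unfolding fS by blast
  have inj_D\<phi>: "v = 0" if y: "y \<in> ?T" and v: "frechet_derivative ?\<phi> (at y) v = 0" for y v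
  proof -
    have D\<phi>: "(?\<phi> has_derivative frechet_derivative ?\<phi> (at y)) (at y)"
      using inv(2) y by (rule smooth_on_has_derivative)
    have Df: "(?f has_derivative frechet_derivative ?f (at (?\<phi> y))) (at (?\<phi> y))"
      using f by (rule smooth_on_has_derivative) (use y fS in \<open>metis inv_into_into\<close>)
    have "((\<lambda>y. y) has_derivative (\<lambda>v. frechet_derivative ?f (at (?\<phi> y)) (frechet_derivative ?\<phi> (at y) v))) (at y)"
      by (rule has_derivative_transform_within_open[OF has_derivative_compose[OF D\<phi> Df] T y]) (rule f\<phi>)
    then have "(\<lambda>v. frechet_derivative ?f (at (?\<phi> y)) (frechet_derivative ?\<phi> (at y) v)) = (\<lambda>v. v)"
      using has_derivative_unique has_derivative_ident by blast
    then have "v = frechet_derivative ?f (at (?\<phi> y)) (frechet_derivative ?\<phi> (at y) v)" by metis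
    then show ?thesis
      using v linear_0[OF has_derivative_linear[OF Df]] by simp
  qed
  \<comment> \<open>Restricting \<open>P x\<close> to \<open>?T\<close> keeps the part of the fibre
    in the new chart inside the domain of \<open>k\<close>.\<close>
  define W where "W = img_chart c0 \<inter> P -` ?T"
  \<comment> \<open>\<open>\<Psi>\<close> replaces the coordinates \<open>P x\<close> along the slice by \<open>\<phi> (P x)\<close>, without changing \<open>r x\<close>\<close>
  define \<Psi> where "\<Psi> x = x - i (P x) + i (?\<phi> (P x))" for x
  have PW: "P ` W \<subseteq> ?T" by (auto simp: W_def)
  have W: "open W"
    unfolding W_def using chart_of_open_img[OF C0] T bP
    by (intro open_Int) (auto intro!: open_vimage linear_continuous_on)
  have smooth\<phi>P: "smooth_on W (\<lambda>x. ?\<phi> (P x))"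
    by (rule smooth_on_compose[OF W T smooth_on_linear[OF W bP] inv(2) PW])
  have smooth\<Psi>: "smooth_on W \<Psi>"
    unfolding \<Psi>_def
    by (intro smooth_on_add smooth_on_diff smooth_on_linear_compose[OF W bi] smooth\<phi>P W
        smooth_on_linear bP bounded_linear_ident)
  have P\<Psi>: "P (\<Psi> x) = ?\<phi> (P x)" for x
    by (simp add: \<Psi>_def linear_add[OF iP(2)] linear_diff[OF iP(2)] iP(3))
  have inj\<Psi>: "inj_on \<Psi> W"
  proof (rule inj_onI)
    fix x y assume xy: "x \<in> W" "y \<in> W" "\<Psi> x = \<Psi> y"
    then have "?\<phi> (P x) = ?\<phi> (P y)" by (metis P\<Psi>)
    then have "P x = P y"
      using f\<phi>[of "P x"] f\<phi>[of "P y"] xy PW by (metis image_subset_iff)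
    then show "x = y" using xy(3) by (simp add: \<Psi>_def)
  qed
  have injD\<Psi>: "inj (frechet_derivative \<Psi> (at x))" if x: "x \<in> W" for x
  proof -
    have Px: "P x \<in> ?T" using x PW by blast
    have D\<phi>: "(?\<phi> has_derivative frechet_derivative ?\<phi> (at (P x))) (at (P x))"
      using inv(2) Px by (rule smooth_on_has_derivative)
    let ?D = "\<lambda>v. v - i (P v) + i (frechet_derivative ?\<phi> (at (P x)) (P v))"
    note DP = bounded_linear_imp_has_derivative[OF bP, of "at x"]
    have "(\<Psi> has_derivative ?D) (at x)"
      unfolding \<Psi>_def
      by (intro has_derivative_add has_derivative_diff has_derivative_ident bounded_linear.has_derivative[OF bi]
          has_derivative_compose[OF DP D\<phi>] DP)
    then have D: "frechet_derivative \<Psi> (at x) = ?D" and lin: "linear ?D"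
      by (auto intro: frechet_derivative_at[symmetric] has_derivative_linear)
    have "v = 0" if v: "?D v = 0" for v
    proof -
      have "P (?D v) = frechet_derivative ?\<phi> (at (P x)) (P v)"
        by (simp add: linear_add[OF iP(2)] linear_diff[OF iP(2)] iP(3))
      then have z: "frechet_derivative ?\<phi> (at (P x)) (P v) = 0"
        unfolding v by (simp add: linear_0[OF iP(2)])
      then have "P v = 0" by (rule inj_D\<phi>[OF Px])
      then show "v = 0" using v z by (simp add: linear_0[OF iP(1)])
    qed
    then show ?thesis unfolding D using linear_injective_0[OF lin] by blast
  qed
  let ?c = "({p \<in> dom_chart c0. snd c0 p \<in> W}, \<Psi> \<circ> snd c0)"
  have cA: "?c \<in> A"
    by (rule transport_chart[OF A c0A W _ smooth\<Psi> inj\<Psi> injD\<Psi>]) (auto simp: W_def)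
  have ri: "r (i w) = 0" for w using iP(4) by blast
  have r: "linear r" using c0(1) bounded_linear.linear unfolding linearizes_def by blast
  have r\<Psi>: "r (\<Psi> x) = r x" for x
    by (simp add: \<Psi>_def linear_add[OF r] linear_diff[OF r] ri)
  have lin: "linearizes ?c d r"
    using c0(1) cA r\<Psi> unfolding linearizes_def by auto
  have inU: "p' \<in> ?U" if "p' \<in> F" "p' \<in> dom_chart ?c" for p'
  proof -
    have p'0: "p' \<in> dom_chart k0" and "snd k0 p' \<in> ?T"
      using that by (auto simp: k0(2) W_def)
    then obtain p2 where "p2 \<in> ?U" "snd k0 p' = snd k0 p2" by blast
    then show ?thesis using p'0 chart_of_inj[OF K0] by (auto dest: inj_onD)
  qed
  have "adapted ?c d r i P b k"
    unfolding adapted_def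
  proof (intro conjI lin iP allI ballI)
    show "F \<inter> dom_chart ?c \<subseteq> dom_chart k" using inU by blast
    fix p' assume p': "p' \<in> F \<inter> dom_chart ?c"
    then have "p' \<in> ?U" using inU by blast
    then have "?\<phi> (P (snd c0 p')) = snd k p'" using \<phi>k[of p'] by (simp add: k0(2))
    moreover have "snd c0 p' = b + i (P (snd c0 p'))"
      using adapted_coord[OF k0(3), of p'] p' by (simp add: k0(2))
    ultimately show "snd ?c p' = b + i (snd k p')"
      by (simp add: \<Psi>_def diff_eq_eq)
  qed
  moreover have "p \<in> dom_chart ?c"
    using p pk c0(2) by (auto simp: W_def k0(2))
  ultimately show ?thesis using that by blast
qed

end

subsection \<open>The Levi-Civita connection in a chart\<close>

locale chart_metric =
  fixes U :: "'a::euclidean_space set" and h :: "'a \<Rightarrow> 'a \<Rightarrow> 'a \<Rightarrow> real"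
  assumes open_U: "open U"
    and bilinear_h: "\<And>x. x \<in> U \<Longrightarrow> bilinear (h x)"
    and sym_h: "\<And>x u v. x \<in> U \<Longrightarrow> h x u v = h x v u"
    and pos_h: "\<And>x u. x \<in> U \<Longrightarrow> u \<noteq> 0 \<Longrightarrow> h x u u > 0"
    and smooth_h: "\<And>u v. smooth_on U (\<lambda>x. h x u v)"
begin

lemma levi_civita_ex1_U: "x \<in> U \<Longrightarrow> \<exists>!\<Gamma>. levi_civita_coeffs h x \<Gamma>"
  by (rule levi_civita_ex1[OF open_U])
     (simp_all add: bilinear_h pos_h sym_h smooth_on_differentiable[OF smooth_h])

lemma levi_civita_christoffel: "x \<in> U \<Longrightarrow> levi_civita_coeffs h x (christoffel h x)"
  unfolding christoffel_def by (rule theI'[OF levi_civita_ex1_U])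

lemma christoffel_eqI: "x \<in> U \<Longrightarrow> levi_civita_coeffs h x \<Gamma> \<Longrightarrow> christoffel h x = \<Gamma>"
  using levi_civita_ex1_U levi_civita_christoffel by blast

lemma bilinear_christoffel: "x \<in> U \<Longrightarrow> bilinear (christoffel h x)"
  and sym_christoffel: "x \<in> U \<Longrightarrow> christoffel h x u v = christoffel h x v u"
  and compat_christoffel: "x \<in> U \<Longrightarrow> frechet_derivative (\<lambda>y. h y u v) (at x) w =
    h x (christoffel h x w u) v + h x u (christoffel h x w v)"
  using levi_civita_christoffel unfolding levi_civita_coeffs_def by blast+

lemma linear_h: "x \<in> U \<Longrightarrow> linear (\<lambda>u. h x u v)"
  using bilinear_h unfolding bilinear_def by blast

text \<open>The Koszul formula for constant fields, whose brackets vanish. Its right-hand side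
  contains only derivatives of the metric, hence is smooth.\<close>

lemma koszul:
  assumes x: "x \<in> U"
  shows "2 * h x (christoffel h x u v) w = frechet_derivative (\<lambda>y. h y v w) (at x) u +
    frechet_derivative (\<lambda>y. h y u w) (at x) v - frechet_derivative (\<lambda>y. h y u v) (at x) w"
  unfolding compat_christoffel[OF x]
    sym_christoffel[OF x, of w u] sym_christoffel[OF x, of w v] sym_christoffel[OF x, of v u]
    sym_h[OF x, of v "christoffel h x u w"] sym_h[OF x, of u "christoffel h x v w"]
    sym_h[OF x, of w "christoffel h x u v"]
  by simp

text \<open>\<open>M x\<close> lowers an index with the metric, and positivity makes it injective.
  By the Koszul formula it sends the connection coefficients to a smooth vector, and the pointwise
  inverse of a smooth linear family is smooth.\<close>

lemma smooth_christoffel: "smooth_on U (\<lambda>x. christoffel h x u v)"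
proof -
  define M where "M x z = (\<Sum>b\<in>Basis. h x z b *\<^sub>R b)" for x z
  define k where "k x w = (frechet_derivative (\<lambda>y. h y v w) (at x) u +
    frechet_derivative (\<lambda>y. h y u w) (at x) v - frechet_derivative (\<lambda>y. h y u v) (at x) w) / 2" for x w
  have linM: "linear (M x)" if "x \<in> U" for x
    unfolding M_def
    by (intro linear_compose_sum ballI linearI)
       (simp_all add: linear_add[OF linear_h] linear_scale[OF linear_h] that scaleR_add_left)
  have injM: "inj (M x)" if x: "x \<in> U" for x
  proof -
    have "z = 0" if z: "M x z = 0" for z
    proof -
      have "h x z b = 0" if "b \<in> Basis" for b
        using arg_cong[OF z, of "\<lambda>y. y \<bullet> b"] that by (simp add: M_def inner_sum_left_Basis)
      moreover have "linear (h x z)" using bilinear_h[OF x] unfolding bilinear_def by blast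
      ultimately have "h x z z = 0" using linear_Basis_sum[of "h x z" z] by simp
      then show ?thesis using pos_h[OF x, of z] by force
    qed
    then show ?thesis using linear_injective_0[OF linM[OF x]] by blast
  qed
  interpret linear_family U M "\<lambda>x. inv (M x)"
  proof (rule linear_family.intro)
    show "M x (inv (M x) v) = v" if "x \<in> U" for x v
      using linear_injective_imp_surjective[OF linM injM] that by (simp add: surj_f_inv_f)
  qed (use open_U linM injM in auto)
  have M: "smooth_on U (\<lambda>x. M x z)" for z
    unfolding M_def
    by (intro smooth_on_sum open_U bounded_bilinear.smooth_on[OF bounded_bilinear_scaleR] smooth_h smooth_on_const)
  have k: "smooth_on U (\<lambda>x. k x w)" for w
    unfolding k_def
    by (intro smooth_on_linear_compose[OF open_U bounded_linear_divide] smooth_on_diff smooth_on_add open_U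
        smooth_on_frechet_derivative smooth_h)
  have "smooth_on U (\<lambda>x. \<Sum>b\<in>Basis. k x b *\<^sub>R b)"
    by (intro smooth_on_sum open_U bounded_bilinear.smooth_on[OF bounded_bilinear_scaleR] k smooth_on_const)
  then have "smooth_on U (\<lambda>x. inv (M x) (\<Sum>b\<in>Basis. k x b *\<^sub>R b))"
    using smooth_on_apply[of U "\<lambda>x. inv (M x)", OF open_U linear_N smooth_on_N[OF M]] by blast
  then show ?thesis
  proof (rule smooth_on_cong[OF open_U, rotated])
    fix x assume x: "x \<in> U"
    have "h x (christoffel h x u v) b = k x b" for b
      using koszul[OF x, of u v b] by (simp add: k_def)
    then have "M x (christoffel h x u v) = (\<Sum>b\<in>Basis. k x b *\<^sub>R b)"
      by (simp add: M_def)
    then show "inv (M x) (\<Sum>b\<in>Basis. k x b *\<^sub>R b) = christoffel h x u v"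
      using N_M[OF x] by metis
  qed
qed

lemma has_derivative_christoffel:
  "x \<in> U \<Longrightarrow> ((\<lambda>x. christoffel h x u v) has_derivative
     frechet_derivative (\<lambda>x. christoffel h x u v) (at x)) (at x)"
  by (rule smooth_on_has_derivative[OF smooth_christoffel])

lemma curvature_const:
  assumes x: "x \<in> U"
  shows "curvature h (\<lambda>_. w) (\<lambda>_. u) (\<lambda>_. v) x =
    frechet_derivative (\<lambda>x. christoffel h x u v) (at x) w + christoffel h x w (christoffel h x u v)
    - (frechet_derivative (\<lambda>x. christoffel h x w v) (at x) u + christoffel h x u (christoffel h x w v))"
proof -
  have "nabla h (\<lambda>_. u) (\<lambda>_. v) = (\<lambda>x. christoffel h x u v)" for u v
    by (simp add: fun_eq_iff nabla_def)
  moreover have "nabla h (lie_bracket (\<lambda>_. w) (\<lambda>_. u)) (\<lambda>_. v) x = 0"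
    by (simp add: nabla_def lie_bracket_def bilinear_lzero[OF bilinear_christoffel[OF x]])
  ultimately show ?thesis
    by (simp add: curvature_def nabla_def)
qed

lemma linear_christoffel: "x \<in> U \<Longrightarrow> linear (\<lambda>u. christoffel h x u v)"
  "x \<in> U \<Longrightarrow> linear (\<lambda>v. christoffel h x u v)"
  using bilinear_christoffel unfolding bilinear_def by blast+

text \<open>\<open>curvature\<close> takes fields as arguments, so linearity in \<open>w\<close>,
  needed to handle the trace, has to be read off the coordinate expression.\<close>

lemma linear_curvature_const:
  assumes x: "x \<in> U"
  shows "linear (\<lambda>w. curvature h (\<lambda>_. w) (\<lambda>_. u) (\<lambda>_. v) x)"
  unfolding curvature_const[OF x]
proof (intro linear_compose_sub linear_compose_add)
  show "linear (\<lambda>w. frechet_derivative (\<lambda>x. christoffel h x w v) (at x) u)"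
    by (intro linear_frechet_derivative[OF open_U x] linear_christoffel(1)
        smooth_on_differentiable[OF smooth_christoffel x])
  show "linear (\<lambda>w. christoffel h x u (christoffel h x w v))"
    using linear_compose[OF linear_christoffel(1)[OF x] linear_christoffel(2)[OF x]] by (simp add: o_def)
qed (use linear_christoffel[OF x] has_derivative_linear[OF has_derivative_christoffel[OF x]] in auto)

end

lemma chart_metricI:
  assumes "riemannian_metric A g" "c \<in> A" "open (img_chart c)"
  shows "chart_metric (img_chart c) (g c)"
proof (rule chart_metric.intro)
  have pt: "bilinear (g c x) \<and> (\<forall>u v. g c x u v = g c x v u) \<and> (\<forall>u. u \<noteq> 0 \<longrightarrow> g c x u u > 0)"
    if "x \<in> img_chart c" for x
    using assms that unfolding riemannian_metric_def by blast
  show "bilinear (g c x)" if "x \<in> img_chart c" for x using pt[OF that] by blast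
  show "g c x u v = g c x v u" if "x \<in> img_chart c" for x u v using pt[OF that] by blast
  show "g c x u u > 0" if "x \<in> img_chart c" "u \<noteq> 0" for x u using pt[OF that(1)] that(2) by blast
  show "smooth_on (img_chart c) (\<lambda>x. g c x u v)" for u v
    using assms unfolding riemannian_metric_def by blast
qed (rule assms(3))

subsection \<open>Restriction to an affine slice with parallel tangent spaces\<close>

text \<open>Cyclicity of the trace: \<open>T\<close> is \<open>i\<close> after \<open>P T\<close>,
  so its trace is that of \<open>P T\<close> after \<open>i\<close>. No orthogonality between
  \<open>i\<close> and \<open>P\<close> is involved.\<close>

lemma trace_through_subspace:
  fixes T :: "'a::euclidean_space \<Rightarrow> 'a" and i :: "'c::euclidean_space \<Rightarrow> 'a"
  assumes T: "linear T" and i: "linear i" and P: "linear P" and "\<And>w. i (P (T w)) = T w"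
  shows "(\<Sum>b\<in>Basis. T b \<bullet> b) = (\<Sum>e\<in>Basis. P (T (i e)) \<bullet> e)"
proof -
  have PT: "linear (\<lambda>w. P (T w) \<bullet> e)" for e
    by (rule linearI) (simp_all add: linear_add[OF T] linear_add[OF P] linear_scale[OF T]
        linear_scale[OF P] inner_add_left)
  have "(\<Sum>b\<in>Basis. T b \<bullet> b) = (\<Sum>b\<in>Basis. \<Sum>e\<in>Basis. (P (T b) \<bullet> e) * (i e \<bullet> b))"
  proof (rule sum.cong)
    fix b :: 'a
    have "T b \<bullet> b = i (P (T b)) \<bullet> b" by (simp add: assms(4))
    also have "\<dots> = (\<Sum>e\<in>Basis. (P (T b) \<bullet> e) * (i e \<bullet> b))"
      by (subst linear_Basis_sum[OF i]) (simp add: inner_sum_left)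
    finally show "T b \<bullet> b = (\<Sum>e\<in>Basis. (P (T b) \<bullet> e) * (i e \<bullet> b))" .
  qed simp
  also have "\<dots> = (\<Sum>e\<in>Basis. \<Sum>b\<in>Basis. (i e \<bullet> b) * (P (T b) \<bullet> e))"
    by (subst sum.swap) (simp add: mult.commute)
  also have "\<dots> = (\<Sum>e\<in>Basis. P (T (i e)) \<bullet> e)"
  proof (rule sum.cong)
    fix e :: 'c
    have "P (T (i e)) \<bullet> e = (\<Sum>b\<in>Basis. (i e \<bullet> b) *\<^sub>R (P (T b) \<bullet> e))"
      by (rule linear_Basis_sum[OF PT])
    then show "(\<Sum>b\<in>Basis. (i e \<bullet> b) * (P (T b) \<bullet> e)) = P (T (i e)) \<bullet> e"
      by simp
  qed simp
  finally show ?thesis .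
qed

text \<open>\<open>parallel\<close> is required on all of \<open>U\<close> and for all directions
  \<open>u\<close>, since the trace runs over transverse directions too and differentiates the
  connection coefficients along them. \<open>Z\<close> is the part of \<open>U'\<close> over which
  the ambient coordinates are available.\<close>

locale parallel_slice = chart_metric U h + slice: chart_metric U' h'
  for U :: "'a::euclidean_space set" and h and U' :: "'c::euclidean_space set" and h' +
  fixes i :: "'c \<Rightarrow> 'a" and P :: "'a \<Rightarrow> 'c" and b :: 'a and Z :: "'c set"
  assumes linear_i: "linear i" and linear_P: "linear P" and P_i: "\<And>w. P (i w) = w"
    and open_Z: "open Z" and Z_U': "Z \<subseteq> U'" and Z_U: "\<And>y. y \<in> Z \<Longrightarrow> b + i y \<in> U"
    and induced: "\<And>y u v. y \<in> Z \<Longrightarrow> h' y u v = h (b + i y) (i u) (i v)"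
    and parallel: "\<And>x u w. x \<in> U \<Longrightarrow> christoffel h x u (i w) \<in> range i"
begin

lemma bounded_linear_i: "bounded_linear i" and bounded_linear_P: "bounded_linear P"
  using linear_i linear_P by (simp_all add: linear_conv_bounded_linear)

lemma has_derivative_slice:
  assumes y: "y \<in> Z" and f: "(f has_derivative f') (at (b + i y))"
    and eq: "\<And>y. y \<in> Z \<Longrightarrow> f (b + i y) = g y"
  shows "(g has_derivative (\<lambda>v. f' (i v))) (at y)"
proof -
  have "((\<lambda>y. b + i y) has_derivative (\<lambda>v. 0 + i v)) (at y)"
    by (intro has_derivative_add has_derivative_const bounded_linear_imp_has_derivative bounded_linear_i)
  from has_derivative_compose[OF this, of f f'] f
  have "((\<lambda>y. f (b + i y)) has_derivative (\<lambda>v. f' (i v))) (at y)" by simp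
  then show ?thesis
    by (rule has_derivative_transform_within_open[OF _ open_Z y]) (rule eq)
qed

lemma frechet_derivative_induced:
  assumes y: "y \<in> Z"
  shows "frechet_derivative (\<lambda>y. h' y u v) (at y) w =
    frechet_derivative (\<lambda>x. h x (i u) (i v)) (at (b + i y)) (i w)"
proof -
  have "((\<lambda>y. h' y u v) has_derivative
      (\<lambda>w. frechet_derivative (\<lambda>x. h x (i u) (i v)) (at (b + i y)) (i w))) (at y)"
    by (rule has_derivative_slice[OF y smooth_on_has_derivative[OF smooth_h Z_U[OF y]]])
       (simp add: induced)
  from frechet_derivative_at[OF this] show ?thesis by metis
qed

lemma i_P: "z \<in> range i \<Longrightarrow> i (P z) = z"
  using P_i by auto

text \<open>The candidate is torsion-free at once. It is compatible with the induced metric because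
  \<open>i\<close> and \<open>P\<close> cancel on vertical values: the fibre has no second
  fundamental form. Uniqueness of the Levi-Civita coefficients does the rest.\<close>

lemma christoffel_slice:
  assumes y: "y \<in> Z"
  shows "christoffel h' y u v = P (christoffel h (b + i y) (i u) (i v))"
proof -
  let ?x = "b + i y"
  have x: "?x \<in> U" and y': "y \<in> U'" using y Z_U Z_U' by auto
  let ?G = "\<lambda>u v. P (christoffel h ?x (i u) (i v))"
  have iG: "i (?G u v) = christoffel h ?x (i u) (i v)" for u v
    by (rule i_P[OF parallel[OF x]])
  note lin = linear_christoffel[OF x]
  have "levi_civita_coeffs h' y ?G"
    unfolding levi_civita_coeffs_def
  proof (intro conjI allI)
    show "bilinear ?G"
      unfolding bilinear_def
      by (intro conjI allI linearI)
         (simp_all add: linear_add[OF linear_i] linear_scale[OF linear_i] linear_add[OF linear_P]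
           linear_scale[OF linear_P] linear_add[OF lin(1)] linear_add[OF lin(2)]
           linear_scale[OF lin(1)] linear_scale[OF lin(2)])
    show "?G u v = ?G v u" for u v
      by (simp only: sym_christoffel[OF x, of "i u"])
    show "frechet_derivative (\<lambda>y. h' y u v) (at y) w = h' y (?G w u) v + h' y u (?G w v)" for u v w
      by (simp only: frechet_derivative_induced[OF y] induced[OF y] iG compat_christoffel[OF x])
  qed
  from slice.christoffel_eqI[OF y' this] show ?thesis by simp
qed

text \<open>A function with values in \<open>range i\<close> is unchanged by \<open>i\<close> after
  \<open>P\<close>, hence so is its derivative.\<close>

lemma frechet_derivative_christoffel_in_range:
  assumes x: "x \<in> U"
  shows "frechet_derivative (\<lambda>x. christoffel h x u (i w)) (at x) v \<in> range i"
proof -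
  let ?D = "frechet_derivative (\<lambda>x. christoffel h x u (i w)) (at x)"
  have "((\<lambda>x. i (P (christoffel h x u (i w)))) has_derivative (\<lambda>v. i (P (?D v)))) (at x)"
    by (intro bounded_linear.has_derivative[OF bounded_linear_i]
        bounded_linear.has_derivative[OF bounded_linear_P] has_derivative_christoffel x)
  then have "((\<lambda>x. christoffel h x u (i w)) has_derivative (\<lambda>v. i (P (?D v)))) (at x)"
    by (rule has_derivative_transform_within_open[OF _ open_U x]) (rule i_P[OF parallel])
  from frechet_derivative_at[OF this] show ?thesis by (metis rangeI)
qed

lemma curvature_in_range:
  assumes x: "x \<in> U"
  shows "curvature h (\<lambda>_. w) (\<lambda>_. u) (\<lambda>_. i v) x \<in> range i"
proof -
  have S: "subspace (range i)" by (intro linear_subspace_image linear_i subspace_UNIV)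
  have "christoffel h x u z \<in> range i" if "z \<in> range i" for u z
    using parallel[OF x] that by auto
  note this[OF parallel[OF x]]
  then show ?thesis
    unfolding curvature_const[OF x]
    by (intro subspace_diff[OF S] subspace_add[OF S] frechet_derivative_christoffel_in_range[OF x])
qed

lemma curvature_slice:
  assumes y: "y \<in> Z"
  shows "curvature h' (\<lambda>_. w) (\<lambda>_. u) (\<lambda>_. v) y =
    P (curvature h (\<lambda>_. i w) (\<lambda>_. i u) (\<lambda>_. i v) (b + i y))"
proof -
  let ?x = "b + i y"
  have x: "?x \<in> U" and y': "y \<in> U'" using y Z_U Z_U' by auto
  have D: "frechet_derivative (\<lambda>y. christoffel h' y u v) (at y) w =
      P (frechet_derivative (\<lambda>x. christoffel h x (i u) (i v)) (at ?x) (i w))" for u v w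
  proof -
    have "((\<lambda>x. P (christoffel h x (i u) (i v))) has_derivative
        (\<lambda>w. P (frechet_derivative (\<lambda>x. christoffel h x (i u) (i v)) (at ?x) w))) (at ?x)"
      by (intro bounded_linear.has_derivative[OF bounded_linear_P] has_derivative_christoffel x)
    from has_derivative_slice[OF y this, of "\<lambda>y. christoffel h' y u v"]
    have "((\<lambda>y. christoffel h' y u v) has_derivative
        (\<lambda>w. P (frechet_derivative (\<lambda>x. christoffel h x (i u) (i v)) (at ?x) (i w)))) (at y)"
      by (simp add: christoffel_slice)
    from frechet_derivative_at[OF this] show ?thesis by metis
  qed
  have G: "christoffel h' y w (christoffel h' y u v) =
      P (christoffel h ?x (i w) (christoffel h ?x (i u) (i v)))" for u v w
    by (simp only: christoffel_slice[OF y] i_P[OF parallel[OF x]])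
  show ?thesis
    unfolding curvature_const[OF x] slice.curvature_const[OF y'] D G
    by (simp only: linear_diff[OF linear_P] linear_add[OF linear_P])
qed

lemma ricci_slice:
  assumes y: "y \<in> Z"
  shows "ricci h' y u v = ricci h (b + i y) (i u) (i v)"
proof -
  have x: "b + i y \<in> U" using y by (rule Z_U)
  show ?thesis
    unfolding ricci_def curvature_slice[OF y]
    by (rule trace_through_subspace[OF linear_curvature_const[OF x] linear_i linear_P, symmetric])
       (rule i_P[OF curvature_in_range[OF x]])
qed

text \<open>The two fields are related by the affine inclusion. Differentiating this relation along
  the slice shows that their brackets with related constant fields are related as well.\<close>

lemma lie_deriv_metric_slice:
  assumes y: "y \<in> Z" and V: "V differentiable (at (b + i y))" and V': "V' differentiable (at y)"
    and eq: "\<And>y. y \<in> Z \<Longrightarrow> V (b + i y) = i (V' y)"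
  shows "lie_deriv_metric V' h' y u v = lie_deriv_metric V h (b + i y) (i u) (i v)"
proof -
  have "((\<lambda>y. i (V' y)) has_derivative (\<lambda>v. frechet_derivative V (at (b + i y)) (i v))) (at y)"
    using V by (intro has_derivative_slice[OF y, of V]) (simp_all add: frechet_derivative_works eq)
  moreover have "((\<lambda>y. i (V' y)) has_derivative (\<lambda>v. i (frechet_derivative V' (at y) v))) (at y)"
    using V' by (intro bounded_linear.has_derivative[OF bounded_linear_i]) (simp add: frechet_derivative_works)
  ultimately have "(\<lambda>v. i (frechet_derivative V' (at y) v)) = (\<lambda>v. frechet_derivative V (at (b + i y)) (i v))"
    by (rule has_derivative_unique[OF _ , rotated])
  then have "i (frechet_derivative V' (at y) w) = frechet_derivative V (at (b + i y)) (i w)" for w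
    by metis
  then have "i (lie_bracket V' (\<lambda>_. w) y) = lie_bracket V (\<lambda>_. i w) (b + i y)" for w
    by (simp add: lie_bracket_def linear_neg[OF linear_i])
  then show ?thesis
    unfolding lie_deriv_metric_def
    by (simp only: frechet_derivative_induced[OF y] induced[OF y] eq[OF y])
qed

end

subsection \<open>Vertical vectors and the connection coefficients\<close>

context submersion
begin

lemma linearizes_differential:
  assumes "linearizes c d r" "p \<in> dom_chart c"
  shows "differential \<pi> c d p = r"
proof (rule differentialI)
  show "chart_of X c" "openin X (dom_chart c)"
    using assms(1) chart_A chart_of_openin unfolding linearizes_def by blast+
  show "(r has_derivative r) (at (snd c p))"
    using assms(1) bounded_linear_imp_has_derivative unfolding linearizes_def by blast
  show "r (snd c p') = snd d (\<pi> p')" if "p' \<in> dom_chart c" for p'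
    using assms(1) that unfolding linearizes_def by simp
qed (use assms(2) in auto)

text \<open>Verticality refers to every chart of the base; a single one decides, because the
  differential read in another chart factors through the transition map.\<close>

lemma vertical_at_linearizes:
  assumes lin: "linearizes c d r" and p: "p \<in> dom_chart c"
  shows "vertical_at B \<pi> c p v \<longleftrightarrow> r v = 0"
proof
  have cd: "c \<in> A" "d \<in> B" and \<pi>: "\<And>p. p \<in> dom_chart c \<Longrightarrow> \<pi> p \<in> dom_chart d"
    using lin unfolding linearizes_def by auto
  note r = linearizes_differential[OF lin p]
  show "r v = 0" if "vertical_at B \<pi> c p v"
    using that cd(2) \<pi>[OF p] unfolding vertical_at_def r[symmetric] by blast
  show "vertical_at B \<pi> c p v" if v: "r v = 0"
    unfolding vertical_at_def
  proof (intro ballI impI)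
    fix d' assume d': "d' \<in> B" "\<pi> p \<in> dom_chart d'"
    have "differential (id \<circ> \<pi>) c d' p v = differential id d d' (\<pi> p) (differential \<pi> c d p v)"
      by (rule differential_compose[OF chart_A[OF cd(1)] chart_B[OF cd(2)]
            chart_of_openin[OF chart_A[OF cd(1)]] p subset_refl])
         (use \<pi> d' cd smooth_wrt_pi smooth_manifold_trans[OF B] in auto)
    then show "differential \<pi> c d' p v = 0"
      using linear_0[OF linear_differential[OF smooth_manifold_trans[OF B cd(2) d'(1)] \<pi>[OF p]]] d'(2)
      by (simp add: r v)
  qed
qed

lemma vertical_at_transition:
  assumes c: "c \<in> A" "c' \<in> A" and p: "p \<in> dom_chart c" "p \<in> dom_chart c'"
    and v: "vertical_at B \<pi> c p v"
  shows "vertical_at B \<pi> c' p (differential id c c' p v)"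
  unfolding vertical_at_def
proof (intro ballI impI)
  fix d assume d: "d \<in> B" "\<pi> p \<in> dom_chart d"
  have "openin X (dom_chart c \<inter> dom_chart c')"
    by (intro openin_Int chart_of_openin chart_A c)
  then have "differential (\<pi> \<circ> id) c d p v = differential \<pi> c' d (id p) (differential id c c' p v)"
    by (rule differential_compose[OF chart_A[OF c(1)] chart_A[OF c(2)]])
       (use p d c smooth_wrt_pi smooth_manifold_trans[OF A] in auto)
  then show "differential \<pi> c' d p (differential id c c' p v) = 0"
    using v d unfolding vertical_at_def by simp
qed

section \<open>Globally defined fields obtained by cutting off constant fields of a chart\<close>

lemma vertical_at_scaleR:
  assumes "c \<in> A" "p \<in> dom_chart c" "vertical_at B \<pi> c p v"
  shows "vertical_at B \<pi> c p (t *\<^sub>R v)"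
  using assms linear_scale[OF linear_differential[OF smooth_wrt_pi]] unfolding vertical_at_def by simp

text \<open>The inverse chart carries the compact set to a compact subset of a Hausdorff space.
  Closedness in all of \<open>X\<close>, and not only in the chart domain, makes extension by zero
  smooth.\<close>

lemma closedin_chart_preimage:
  assumes c: "c \<in> A" and C: "compact C" "C \<subseteq> img_chart c"
  shows "closedin X {p \<in> dom_chart c. snd c p \<in> C}"
proof -
  note ch = chart_A[OF c] and inj = chart_of_inj[OF chart_A[OF c]]
  have "continuous_map (top_of_set (img_chart c)) X (inv_chart c)"
    unfolding continuous_map_def
  proof (intro conjI allI impI funcsetI)
    show "inv_chart c y \<in> topspace X" if "y \<in> topspace (top_of_set (img_chart c))" for y
    proof -
      have "inv_chart c y \<in> dom_chart c" using that by (intro inv_into_into) simp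
      then show ?thesis using openin_subset[OF chart_of_openin[OF ch]] by blast
    qed
    fix V assume "openin X V"
    then have "open (snd c ` (V \<inter> dom_chart c))"
      by (intro chart_of_open_image[OF ch] openin_Int chart_of_openin ch) auto
    moreover have "snd c ` (V \<inter> dom_chart c) = {y \<in> topspace (top_of_set (img_chart c)). inv_chart c y \<in> V}"
      using inj by auto
    ultimately show "openin (top_of_set (img_chart c)) {y \<in> topspace (top_of_set (img_chart c)). inv_chart c y \<in> V}"
      using chart_of_open_img[OF ch] by (auto simp: openin_open_eq)
  qed
  then have "compactin X (inv_chart c ` C)"
    by (rule image_compactin[rotated]) (simp add: compactin_subtopology C)
  moreover have "inv_chart c ` C = {p \<in> dom_chart c. snd c p \<in> C}"
  proof (intro equalityI subsetI)
    fix p assume "p \<in> inv_chart c ` C"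
    then obtain y where y: "y \<in> C" "y \<in> img_chart c" "p = inv_chart c y" using C(2) by blast
    then show "p \<in> {p \<in> dom_chart c. snd c p \<in> C}"
      using inv_into_into[OF y(2)] f_inv_into_f[OF y(2)] by simp
  next
    fix p assume "p \<in> {p \<in> dom_chart c. snd c p \<in> C}"
    then have p: "p \<in> dom_chart c" "snd c p \<in> C" by simp_all
    then show "p \<in> inv_chart c ` C"
      using inv_into_f_f[OF inj p(1)] by (intro image_eqI[of _ _ "snd c p"]) simp_all
  qed
  ultimately show ?thesis
    using compactin_imp_closedin[OF smooth_manifold_Hausdorff[OF A]] by simp
qed

text \<open>A field consists of its components in all charts, so the extension by zero is written in
  each chart \<open>c'\<close>: the constant field \<open>w\<close> of \<open>c\<close> is scaled by
  \<open>\<beta>\<close> and carried over by the transition differential, with value 0 outside the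
  domain of \<open>c\<close>.\<close>

definition cutoff_field :: "('m, 'a) chart \<Rightarrow> ('a \<Rightarrow> real) \<Rightarrow> 'a \<Rightarrow> ('m, 'a) vfield" where
  "cutoff_field c \<beta> w c' y = (if inv_chart c' y \<in> dom_chart c
     then \<beta> (snd c (inv_chart c' y)) *\<^sub>R differential id c c' (inv_chart c' y) w else 0)"

lemma cutoff_field_apply:
  "c' \<in> A \<Longrightarrow> p \<in> dom_chart c' \<Longrightarrow> cutoff_field c \<beta> w c' (snd c' p) =
    (if p \<in> dom_chart c then \<beta> (snd c p) *\<^sub>R differential id c c' p w else 0)"
  using chart_of_inj[OF chart_A] by (simp add: cutoff_field_def)

lemma vector_field_cutoff_field:
  assumes c: "c \<in> A" and \<beta>: "smooth_on UNIV \<beta>" and C: "compact C" "C \<subseteq> img_chart c"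
    and zero: "\<And>x. x \<notin> C \<Longrightarrow> \<beta> x = 0"
  shows "vector_field A (cutoff_field c \<beta> w)"
  unfolding vector_field_def
proof (intro conjI ballI)
  fix c' assume c': "c' \<in> A"
  note ch = chart_A[OF c] and ch' = chart_A[OF c']
  show "smooth_on (img_chart c') (cutoff_field c \<beta> w c')"
  proof (rule smooth_on_local)
    fix y assume "y \<in> img_chart c'"
    then obtain p where p: "p \<in> dom_chart c'" "y = snd c' p" by blast
    show "\<exists>U. open U \<and> y \<in> U \<and> smooth_on U (cutoff_field c \<beta> w c')"
    proof (cases "p \<in> dom_chart c")
      case True
      let ?D = "dom_chart c \<inter> dom_chart c'"
      let ?U = "snd c' ` ?D" and ?U' = "snd c ` ?D" and ?\<tau> = "local_rep id c' c"
      have D: "openin X ?D" by (intro openin_Int chart_of_openin ch ch')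
      have U: "open ?U" using D by (rule chart_of_open_image[OF ch']) blast
      have U': "open ?U'" using D by (rule chart_of_open_image[OF ch]) blast
      have \<tau>: "smooth_on ?U ?\<tau>" and \<tau>': "smooth_on ?U' (local_rep id c c')"
        using smooth_manifold_trans[OF A c' c] smooth_manifold_trans[OF A c c']
        unfolding smooth_wrt_def by (auto elim!: smooth_on_subset)
      have im: "?\<tau> ` ?U \<subseteq> ?U'" using chart_of_inj[OF ch'] by auto
      have "smooth_on ?U (\<lambda>y. \<beta> (?\<tau> y))"
        by (rule smooth_on_compose[OF U open_UNIV \<tau> \<beta>]) simp
      moreover have "smooth_on ?U (\<lambda>y. frechet_derivative (local_rep id c c') (at (?\<tau> y)) w)"
        by (rule smooth_on_compose[OF U U' \<tau> smooth_on_frechet_derivative[OF \<tau>'] im])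
      ultimately have "smooth_on ?U (\<lambda>y. \<beta> (?\<tau> y) *\<^sub>R frechet_derivative (local_rep id c c') (at (?\<tau> y)) w)"
        by (rule bounded_bilinear.smooth_on[OF bounded_bilinear_scaleR U])
      then have "smooth_on ?U (cutoff_field c \<beta> w c')"
      proof (rule smooth_on_cong[OF U, rotated])
        fix y assume "y \<in> ?U"
        then obtain p' where p': "p' \<in> dom_chart c" "p' \<in> dom_chart c'" "y = snd c' p'" by blast
        then show "\<beta> (?\<tau> y) *\<^sub>R frechet_derivative (local_rep id c c') (at (?\<tau> y)) w =
            cutoff_field c \<beta> w c' y"
          using cutoff_field_apply[OF c' p'(2)] chart_of_inj[OF ch'] by (simp add: differential_def)
      qed
      then show ?thesis using U p True by blast
    next
      case False
      \<comment> \<open>Off the closed set belonging to \<open>C\<close> the field is 0 for one of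
        two reasons: \<open>\<beta>\<close> vanishes, or the point is outside the domain of
        \<open>c\<close>.\<close>
      let ?N = "dom_chart c' - {p \<in> dom_chart c. snd c p \<in> C}"
      have "open (snd c' ` ?N)"
        by (rule chart_of_open_image[OF ch'])
           (use openin_diff[OF chart_of_openin[OF ch'] closedin_chart_preimage[OF c C]] in auto)
      moreover have "y \<in> snd c' ` ?N" using p False by blast
      moreover have "smooth_on (snd c' ` ?N) (cutoff_field c \<beta> w c')"
      proof (rule smooth_on_cong[OF \<open>open (snd c' ` ?N)\<close> _ smooth_on_const[of _ 0]])
        fix y assume "y \<in> snd c' ` ?N"
        then obtain p' where p': "p' \<in> ?N" "y = snd c' p'" by blast
        then show "0 = cutoff_field c \<beta> w c' y"
          using cutoff_field_apply[OF c', of p'] zero[of "snd c p'"] by simp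
      qed
      ultimately show ?thesis by blast
    qed
  qed
  fix d p assume d: "d \<in> A" and p: "p \<in> dom_chart c' \<inter> dom_chart d"
  have lin: "linear (differential id c' d p)"
    using p by (intro linear_differential smooth_manifold_trans[OF A c' d]) auto
  have "differential id c d p w = differential id c' d p (differential id c c' p w)"
    if "p \<in> dom_chart c"
  proof -
    have "openin X (dom_chart c \<inter> dom_chart c')" by (intro openin_Int chart_of_openin ch ch')
    then show ?thesis
      by (rule differential_id_compose[OF ch ch' _ _ subset_refl])
         (use p that smooth_manifold_trans[OF A] c c' d in auto)
  qed
  then show "cutoff_field c \<beta> w d (snd d p) = differential id c' d p (cutoff_field c \<beta> w c' (snd c' p))"
    using cutoff_field_apply[OF c', of p] cutoff_field_apply[OF d, of p] p linear_scale[OF lin] linear_0[OF lin]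
    by simp
qed

lemma vertical_field_cutoff_field:
  assumes lin: "linearizes c d r" and w: "r w = 0"
  shows "vertical_field A B \<pi> (cutoff_field c \<beta> w)"
  unfolding vertical_field_def
proof (intro ballI)
  fix c' p assume c': "c' \<in> A" and p: "p \<in> dom_chart c'"
  have c: "c \<in> A" using lin unfolding linearizes_def by blast
  have "vertical_at B \<pi> c' p (\<beta> (snd c p) *\<^sub>R differential id c c' p w)" if "p \<in> dom_chart c"
    using vertical_at_linearizes[OF lin that] w that p
    by (intro vertical_at_scaleR c' vertical_at_transition c) auto
  moreover have "vertical_at B \<pi> c' p 0"
    using linear_0[OF linear_differential[OF smooth_wrt_pi[OF c'] p]] unfolding vertical_at_def by blast
  ultimately show "vertical_at B \<pi> c' p (cutoff_field c \<beta> w c' (snd c' p))"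
    by (simp add: cutoff_field_apply[OF c' p])
qed

text \<open>Constant fields of one chart are not fields on the manifold, so
  \<open>vertical_parallel\<close> cannot be tested on them directly. It is tested on their cutoffs,
  of which only the one built from \<open>v\<close> has to be vertical.\<close>

lemma christoffel_vertical:
  assumes g: "riemannian_metric A g" and par: "vertical_parallel A g B \<pi>"
    and lin: "linearizes c d r" and x: "x \<in> img_chart c" and v: "r v = 0"
  shows "r (christoffel (g c) x u v) = 0"
proof -
  have c: "c \<in> A" and r: "linear r"
    using lin bounded_linear.linear unfolding linearizes_def by auto
  interpret chart_metric "img_chart c" "g c" by (rule chart_metricI[OF g c chart_of_open_img[OF chart_A[OF c]]])
  obtain p where p: "p \<in> dom_chart c" "x = snd c p" using x by blast
  obtain \<rho> where \<rho>: "\<rho> > 0" "cball x \<rho> \<subseteq> img_chart c"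
    using open_U x by (meson open_contains_cball)
  obtain \<beta> :: "'a \<Rightarrow> real" where \<beta>: "smooth_on UNIV \<beta>" "\<beta> x \<noteq> 0" "\<forall>y. y \<notin> cball x \<rho> \<longrightarrow> \<beta> y = 0"
    by (rule bump_function_exists[OF \<rho>(1), of x])
  \<comment> \<open>Cutting off \<open>u\<close> and \<open>v\<close> by \<open>\<beta>\<close> changes \<open>\<Gamma>(u, v)\<close> into \<open>\<beta>\<^sup>2 \<Gamma>(u, v)\<close> plus a multiple of \<open>v\<close>.\<close>
  define E where "E = cutoff_field c \<beta> u"
  define G where "G = cutoff_field c \<beta> v"
  have "vector_field A E" "vector_field A G"
    unfolding E_def G_def by (rule vector_field_cutoff_field[OF c \<beta>(1) compact_cball \<rho>(2) \<beta>(3)[rule_format]]; assumption)+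
  moreover have "vertical_field A B \<pi> G"
    unfolding G_def by (rule vertical_field_cutoff_field[OF lin v])
  ultimately have "vertical_at B \<pi> c p (nabla (g c) (E c) (G c) x)"
    using par c p unfolding vertical_parallel_def vertical_field_def by blast
  then have vert: "r (nabla (g c) (E c) (G c) x) = 0"
    using vertical_at_linearizes[OF lin p(1)] by blast
  have field: "cutoff_field c \<beta> w c y = \<beta> y *\<^sub>R w" if "y \<in> img_chart c" for w y
    using that cutoff_field_apply[OF c, of _ c \<beta> w] differential_id_self[OF chart_A[OF c]] by auto
  have D: "(\<beta> has_derivative frechet_derivative \<beta> (at x)) (at x)"
    using smooth_on_has_derivative[OF \<beta>(1)] by simp
  have "((\<lambda>y. \<beta> y *\<^sub>R v) has_derivative (\<lambda>z. frechet_derivative \<beta> (at x) z *\<^sub>R v)) (at x)"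
    by (rule bounded_linear.has_derivative[OF bounded_linear_scaleR_left D])
  then have "(G c has_derivative (\<lambda>z. frechet_derivative \<beta> (at x) z *\<^sub>R v)) (at x)"
    by (rule has_derivative_transform_within_open[OF _ open_U x]) (simp add: G_def field)
  then have "frechet_derivative (G c) (at x) z = frechet_derivative \<beta> (at x) z *\<^sub>R v" for z
    using frechet_derivative_at by metis
  then have "nabla (g c) (E c) (G c) x =
      frechet_derivative \<beta> (at x) (E c x) *\<^sub>R v + (\<beta> x * \<beta> x) *\<^sub>R christoffel (g c) x u v"
    using bilinear_christoffel[OF x]
    by (simp add: nabla_def E_def G_def field[OF x] bilinear_lmul bilinear_rmul)
  with vert have "(\<beta> x * \<beta> x) *\<^sub>R r (christoffel (g c) x u v) = 0"
    by (simp add: linear_add[OF r] linear_scale[OF r] v)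
  then show ?thesis using \<beta>(2) by simp
qed

end

subsection \<open>The smooth structure of the fibre\<close>

context submersion_fibre
begin

lemma in_dom_A: "p \<in> F \<Longrightarrow> \<exists>c\<in>A. p \<in> dom_chart c"
  using smooth_manifold_Union[OF A] by (auto simp: F_def)

lemma K_dom_F: "k \<in> K \<Longrightarrow> p \<in> dom_chart k \<Longrightarrow> p \<in> F"
  using dom_K[OF K_chart] by blast

lemma openin_dom_Int:
  assumes "chart_of (subtopology X F) k" "c \<in> A"
  shows "openin (subtopology X F) (dom_chart k \<inter> dom_chart c)"
proof -
  have "openin (subtopology X F) (dom_chart k \<inter> (F \<inter> dom_chart c))"
    by (intro openin_Int chart_of_openin[OF assms(1)] openin_F chart_A assms(2))
  then show ?thesis
    by (rule back_subst) (use dom_K[OF assms(1)] in blast)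
qed

lemma differential_K_A:
  assumes k: "k \<in> K" and c: "c \<in> A" "c' \<in> A" and p: "p \<in> dom_chart k" "p \<in> dom_chart c" "p \<in> dom_chart c'"
  shows "differential id k c' p v = differential id c c' p (differential id k c p v)"
  by (rule differential_id_compose[OF K_chart[OF k] chart_A[OF c(1)] openin_dom_Int[OF K_chart[OF k] c(1)]
        _ subset_refl K_smooth[OF k c(1)] smooth_manifold_trans[OF A c] p(3)])
     (use p in blast)

text \<open>In an ambient chart adapted to \<open>k2\<close>, the coordinates of \<open>k2\<close>
  are \<open>P\<close> of the ambient coordinates up to a constant. The ambient coordinates depend
  smoothly on those of \<open>k1\<close> by membership in the atlas.\<close>

lemma K_transition:
  assumes k1: "k1 \<in> K" and k2: "k2 \<in> K"
  shows "smooth_wrt id k1 k2"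
proof (rule smooth_wrt_localI[OF K_chart[OF k1]])
  fix p assume p: "p \<in> dom_chart k1" "id p \<in> dom_chart k2"
  obtain c d r i P b where ad: "adapted c d r i P b k2" and pc: "p \<in> dom_chart c"
    using adapted_exists[OF k2, of p thesis] p(2) unfolding id_apply by blast
  have c: "c \<in> A" by (rule adapted_in_A[OF ad])
  have iP: "linear P" "\<And>w. P (i w) = w" using ad unfolding adapted_def by auto
  have P: "bounded_linear P" using iP(1) by (simp add: linear_conv_bounded_linear)
  let ?U = "dom_chart k1 \<inter> dom_chart c"
  have U: "openin (subtopology X F) ?U" by (rule openin_dom_Int[OF K_chart[OF k1] c])
  have op: "open (snd k1 ` ?U)" using U by (rule chart_of_open_image[OF K_chart[OF k1]]) blast
  have "smooth_on (snd k1 ` ?U) (local_rep id k1 c)"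
    using K_smooth[OF k1 c] unfolding smooth_wrt_def by (auto elim!: smooth_on_subset)
  then have "smooth_on (snd k1 ` ?U) (\<lambda>y. P (local_rep id k1 c y) - P b)"
    by (intro smooth_on_diff smooth_on_const smooth_on_linear_compose[OF op P] op)
  then have "smooth_on (snd k1 ` ?U) (local_rep id k1 k2)"
  proof (rule smooth_on_cong[OF op, rotated])
    fix y assume "y \<in> snd k1 ` ?U"
    then obtain p' where p': "p' \<in> dom_chart k1" "p' \<in> dom_chart c" "y = snd k1 p'" by blast
    then show "P (local_rep id k1 c y) - P b = local_rep id k1 k2 y"
      using adapted_coord[OF ad K_dom_F[OF k1 p'(1)] p'(2)] chart_of_inj[OF K_chart[OF k1]]
      by (simp add: linear_add[OF iP(1)] iP(2))
  qed
  then show "\<exists>U. openin (subtopology X F) U \<and> p \<in> U \<and> U \<subseteq> dom_chart k1 \<and>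
      smooth_on (snd k1 ` U) (local_rep id k1 k2)"
    using U p pc by blast
qed

lemma differential_K_K:
  assumes k: "k1 \<in> K" "k2 \<in> K" and c: "c \<in> A"
    and p: "p \<in> dom_chart k1" "p \<in> dom_chart k2" "p \<in> dom_chart c"
  shows "differential id k1 c p v = differential id k2 c p (differential id k1 k2 p v)"
proof -
  have "openin (subtopology X F) (dom_chart k1 \<inter> dom_chart k2)"
    by (intro openin_Int chart_of_openin K_chart k)
  then show ?thesis
    by (rule differential_id_compose[OF K_chart[OF k(1)] K_chart[OF k(2)] _ _ subset_refl
          K_transition[OF k] K_smooth[OF k(2) c] p(3)])
       (use p in blast)
qed

text \<open>Compatibility towards some \<open>k0\<close> in the atlas gives smoothness into ambient
  charts. Compatibility in both directions makes the transition differential invertible, so the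
  immersion property passes from \<open>k0\<close> to \<open>k\<close>.\<close>

lemma K_maximal:
  assumes k: "chart_of (subtopology X F) k"
    and sm: "\<And>k'. k' \<in> K \<Longrightarrow> smooth_wrt id k k'" "\<And>k'. k' \<in> K \<Longrightarrow> smooth_wrt id k' k"
  shows "k \<in> K"
  unfolding K_def submanifold_atlas_def
proof (intro CollectI conjI ballI k)
  fix c assume c: "c \<in> A"
  show smc: "smooth_wrt id k c"
  proof (rule smooth_wrt_localI[OF k])
    fix p assume p: "p \<in> dom_chart k" "id p \<in> dom_chart c"
    obtain k0 where k0: "k0 \<in> K" "p \<in> dom_chart k0"
      using F_covered dom_K[OF k] p(1) by blast
    let ?T = "dom_chart k0 \<inter> dom_chart c"
    let ?U = "dom_chart k \<inter> ?T"
    have T: "openin (subtopology X F) ?T" by (rule openin_dom_Int[OF K_chart[OF k0(1)] c])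
    have U: "openin (subtopology X F) ?U" by (intro openin_Int T chart_of_openin k)
    have "smooth_on (snd k ` ?U) (local_rep id k k0)" "smooth_on (snd k0 ` ?T) (local_rep id k0 c)"
      using sm(1)[OF k0(1)] K_smooth[OF k0(1) c] unfolding smooth_wrt_def by (auto elim!: smooth_on_subset)
    then have "smooth_on (snd k ` ?U) (local_rep (id \<circ> id) k c)"
      by (intro smooth_on_local_rep_compose[OF k K_chart[OF k0(1)] U _ _ T]) auto
    then show "\<exists>U. openin (subtopology X F) U \<and> p \<in> U \<and> U \<subseteq> dom_chart k \<and>
        smooth_on (snd k ` U) (local_rep id k c)"
      using U p k0(2) by (intro exI[of _ ?U]) auto
  qed
  fix p assume p: "p \<in> dom_chart k \<inter> dom_chart c"
  obtain k0 where k0: "k0 \<in> K" "p \<in> dom_chart k0"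
    using F_covered dom_K[OF k] p by blast
  have "openin (subtopology X F) (dom_chart k \<inter> dom_chart k0)"
    by (intro openin_Int chart_of_openin K_chart k k0)
  then have "differential id k c p v = differential id k0 c p (differential id k k0 p v)" for v
    by (rule differential_id_compose[OF k K_chart[OF k0(1)] _ _ subset_refl
          sm(1)[OF k0(1)] K_smooth[OF k0(1) c]])
       (use p k0 in auto)
  moreover have "inj (differential id k0 c p)"
    using K_inj[OF k0(1) c k0(2)] p by blast
  moreover have "inj (differential id k k0 p)"
    using differential_id_inverse[OF k K_chart[OF k0(1)] sm(1)[OF k0(1)] sm(2)[OF k0(1)]] p k0(2)
    by (metis IntD1 injI)
  ultimately show "inj (differential id k c p)"
    by (metis injD injI)
qed

lemma smooth_manifold_K: "smooth_manifold (subtopology X F) K"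
  unfolding smooth_manifold_def
proof (intro conjI)
  show "\<exists>Bs::'c set. finite Bs \<and> span Bs = UNIV"
    using finite_Basis span_Basis by blast
  show "Hausdorff_space (subtopology X F)"
    using smooth_manifold_Hausdorff[OF A] by (rule Hausdorff_space_subtopology)
  have "second_countable X" using A unfolding smooth_manifold_def by blast
  then show "second_countable (subtopology X F)" by (rule second_countable_subtopology)
  show "(\<Union>k\<in>K. dom_chart k) = topspace (subtopology X F)"
    using F_covered by (auto simp: F_def)
qed (use K_chart K_transition K_maximal in blast)+

lemma img_K_local:
  assumes k: "k \<in> K" and x: "x \<in> img_chart k"
  obtains c d r i P b where "adapted c d r i P b k" "open (snd k ` (F \<inter> dom_chart c))"
    "x \<in> snd k ` (F \<inter> dom_chart c)" "snd k ` (F \<inter> dom_chart c) \<subseteq> img_chart k"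
    "(\<lambda>y. b + i y) ` snd k ` (F \<inter> dom_chart c) \<subseteq> img_chart c"
proof -
  obtain p where p: "p \<in> dom_chart k" "x = snd k p" using x by blast
  obtain c d r i P b where ad: "adapted c d r i P b k" and pc: "p \<in> dom_chart c"
    using adapted_exists[OF k p(1)] by metis
  have sub: "F \<inter> dom_chart c \<subseteq> dom_chart k" using ad unfolding adapted_def by blast
  have op: "open (snd k ` (F \<inter> dom_chart c))"
    by (rule chart_of_open_image[OF K_chart[OF k] openin_F[OF chart_A[OF adapted_in_A[OF ad]]] sub])
  have "(\<lambda>y. b + i y) ` snd k ` (F \<inter> dom_chart c) \<subseteq> img_chart c"
    using adapted_coord[OF ad] by (auto simp: image_iff) metis
  then show ?thesis
    using that[OF ad op] K_dom_F[OF k p(1)] pc p(2) sub by blast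
qed

lemma smooth_on_affine_pullback:
  assumes ad: "adapted c d r i P b k" and f: "smooth_on (img_chart c) f" and S: "open S"
    and sub: "(\<lambda>y. b + i y) ` S \<subseteq> img_chart c"
  shows "smooth_on S (\<lambda>y. f (b + i y))"
proof -
  have "bounded_linear i" using ad by (simp add: adapted_def linear_conv_bounded_linear)
  then have "smooth_on S (\<lambda>y. b + i y)"
    by (intro smooth_on_add smooth_on_const smooth_on_linear S)
  then show ?thesis
    using smooth_on_compose[OF S chart_of_open_img[OF chart_A[OF adapted_in_A[OF ad]]] _ f sub] by blast
qed

end

subsection \<open>The soliton equation on the fibre\<close>

locale soliton_fibre = submersion_fibre X A Y B \<pi> q F K
  for X :: "'m topology" and A :: "('m, 'a::euclidean_space) chart set"
    and Y :: "'n topology" and B :: "('n, 'b::real_normed_vector) chart set" and \<pi> :: "'m \<Rightarrow> 'n"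
    and q F and K :: "('m, 'c::euclidean_space) chart set" +
  fixes g :: "('m, 'a) metric" and \<eta> :: "('m, 'a) oneform" and V :: "('m, 'a) vfield" and l m :: real
  assumes soliton: "eta_ricci_soliton X A g \<eta> V l m"
    and vertical_V: "vertical_field A B \<pi> V"
    and parallel: "vertical_parallel A g B \<pi>"
begin

lemma metric_g: "riemannian_metric A g"
  and one_form_\<eta>: "one_form A \<eta>"
  and vector_field_V: "vector_field A V"
  using soliton unfolding eta_ricci_soliton_def riemannian_manifold_def by blast+

lemma soliton_equation: "c \<in> A \<Longrightarrow> x \<in> img_chart c \<Longrightarrow>
    lie_deriv_metric (V c) (g c) x u v + 2 * ricci (g c) x u v + 2 * l * g c x u v
      + 2 * m * (\<eta> c x u * \<eta> c x v) = 0"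
  using soliton unfolding eta_ricci_soliton_def by blast

section \<open>Metric, one-form and potential field of the fibre\<close>

definition chart_at :: "'m \<Rightarrow> ('m, 'a) chart" where
  "chart_at p = (SOME c. c \<in> A \<and> p \<in> dom_chart c)"

text \<open>Components depend only on the chart of the fibre, so the ambient chart in which the
  pullback is evaluated is chosen point by point. Independence of this choice is
  \<open>gF_eq\<close>; smoothness is recovered in adapted charts.\<close>

definition gF :: "('m, 'c) metric" where
  "gF k y u v = (let p = inv_chart k y; c = chart_at p in
     g c (snd c p) (differential id k c p u) (differential id k c p v))"

definition \<eta>F :: "('m, 'c) oneform" where
  "\<eta>F k y u = (let p = inv_chart k y; c = chart_at p in \<eta> c (snd c p) (differential id k c p u))"

definition VF :: "('m, 'c) vfield" where
  "VF k y = (let p = inv_chart k y; c = chart_at p in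
     SOME u. differential id k c p u = V c (snd c p))"

lemma chart_at:
  assumes "p \<in> F"
  shows "chart_at p \<in> A" "p \<in> dom_chart (chart_at p)"
  using someI_ex[of "\<lambda>c. c \<in> A \<and> p \<in> dom_chart c"] in_dom_A[OF assms] unfolding chart_at_def by blast+

lemma gF_eq:
  assumes k: "k \<in> K" and c: "c \<in> A" and p: "p \<in> dom_chart k" "p \<in> dom_chart c"
  shows "gF k (snd k p) u v = g c (snd c p) (differential id k c p u) (differential id k c p v)"
proof -
  note c' = chart_at[OF K_dom_F[OF k p(1)]]
  have "g c (snd c p) u v = g (chart_at p) (snd (chart_at p) p)
      (differential id c (chart_at p) p u) (differential id c (chart_at p) p v)" for u v
    using metric_g c c'(1) p(2) c'(2) unfolding riemannian_metric_def by blast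
  then show ?thesis
    using inv_into_f_f[OF chart_of_inj[OF K_chart[OF k]] p(1)]
    by (simp add: gF_def Let_def differential_K_A[OF k c c'(1) p c'(2)])
qed

lemma \<eta>F_eq:
  assumes k: "k \<in> K" and c: "c \<in> A" and p: "p \<in> dom_chart k" "p \<in> dom_chart c"
  shows "\<eta>F k (snd k p) u = \<eta> c (snd c p) (differential id k c p u)"
proof -
  note c' = chart_at[OF K_dom_F[OF k p(1)]]
  have "\<eta> c (snd c p) u = \<eta> (chart_at p) (snd (chart_at p) p) (differential id c (chart_at p) p u)" for u
    using one_form_\<eta> c c'(1) p(2) c'(2) unfolding one_form_def by blast
  then show ?thesis
    using inv_into_f_f[OF chart_of_inj[OF K_chart[OF k]] p(1)]
    by (simp add: \<eta>F_def Let_def differential_K_A[OF k c c'(1) p c'(2)])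
qed

text \<open>A preimage of \<open>V\<close> under the differential of the inclusion exists in an
  adapted chart, where vertical means \<open>r v = 0\<close> and hence being in
  \<open>range i\<close>. Transition differentials carry it to every ambient chart, and injectivity
  identifies it with the vector picked in the definition of \<open>VF\<close>.\<close>

lemma VF_eq:
  assumes k: "k \<in> K" and c: "c \<in> A" and p: "p \<in> dom_chart k" "p \<in> dom_chart c"
  shows "differential id k c p (VF k (snd k p)) = V c (snd c p)"
proof -
  have pF: "p \<in> F" by (rule K_dom_F[OF k p(1)])
  note c' = chart_at[OF pF]
  have trans: "V e (snd e p) = differential id c0 e p (V c0 (snd c0 p))"
    if "c0 \<in> A" "e \<in> A" "p \<in> dom_chart c0" "p \<in> dom_chart e" for c0 e
    using vector_field_V that unfolding vector_field_def by blast
  obtain a d r i P b where ad: "adapted a d r i P b k" and pa: "p \<in> dom_chart a"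
    using adapted_exists[OF k p(1)] by metis
  have a: "a \<in> A" by (rule adapted_in_A[OF ad])
  have lin: "linearizes a d r" and ker: "range i = {v. r v = 0}"
    using ad unfolding adapted_def by auto
  have "r (V a (snd a p)) = 0"
    using vertical_V a pa vertical_at_linearizes[OF lin pa] unfolding vertical_field_def by blast
  then have "V a (snd a p) \<in> range i" using ker by simp
  then obtain u where "V a (snd a p) = i u" by blast
  then have u: "differential id k a p u = V a (snd a p)"
    using adapted_differential[OF K_chart[OF k] ad pF pa] by simp
  have u': "differential id k e p u = V e (snd e p)" if "e \<in> A" "p \<in> dom_chart e" for e
    using differential_K_A[OF k a that(1) p(1) pa that(2)] trans[OF a that(1) pa that(2)] u by simp
  have "differential id k (chart_at p) p (VF k (snd k p)) = V (chart_at p) (snd (chart_at p) p)"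
    using someI[of "\<lambda>u. differential id k (chart_at p) p u = V (chart_at p) (snd (chart_at p) p)", OF u'[OF c']]
      inv_into_f_f[OF chart_of_inj[OF K_chart[OF k]] p(1)]
    by (simp add: VF_def Let_def)
  then have "VF k (snd k p) = u"
    using u'[OF c'] injD[OF K_inj[OF k c'(1) p(1) c'(2)]] by metis
  then show ?thesis using u'[OF c p(2)] by simp
qed

lemma adapted_tensors:
  assumes k: "k \<in> K" and ad: "adapted c d r i P b k" and y: "y \<in> snd k ` (F \<inter> dom_chart c)"
  shows "gF k y u v = g c (b + i y) (i u) (i v)"
    and "\<eta>F k y u = \<eta> c (b + i y) (i u)"
    and "V c (b + i y) = i (VF k y)"
proof -
  obtain p where p: "p \<in> F" "p \<in> dom_chart c" "y = snd k p" using y by blast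
  have pk: "p \<in> dom_chart k" using ad p(1,2) unfolding adapted_def by blast
  note c = adapted_in_A[OF ad]
  note D = adapted_differential[OF K_chart[OF k] ad p(1,2)] adapted_coord[OF ad p(1,2)]
  show "gF k y u v = g c (b + i y) (i u) (i v)"
    using gF_eq[OF k c pk p(2)] unfolding D p(3) .
  show "\<eta>F k y u = \<eta> c (b + i y) (i u)"
    using \<eta>F_eq[OF k c pk p(2)] unfolding D p(3) .
  show "V c (b + i y) = i (VF k y)"
    using VF_eq[OF k c pk p(2), symmetric] unfolding D p(3) .
qed

text \<open>A function of the coordinates of the fibre is smooth if it is locally the restriction of
  a smooth function of the ambient coordinates along an affine map.\<close>

lemma smooth_on_via_adapted:
  assumes k: "k \<in> K"
    and ex: "\<And>c d r i P b. adapted c d r i P b k \<Longrightarrow>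
      \<exists>\<phi>. smooth_on (img_chart c) \<phi> \<and> (\<forall>y \<in> snd k ` (F \<inter> dom_chart c). \<phi> (b + i y) = f y)"
  shows "smooth_on (img_chart k) f"
proof (rule smooth_on_local)
  fix x assume "x \<in> img_chart k"
  then obtain c d r i P b where ad: "adapted c d r i P b k" and op: "open (snd k ` (F \<inter> dom_chart c))"
    and x: "x \<in> snd k ` (F \<inter> dom_chart c)"
    and sub: "(\<lambda>y. b + i y) ` snd k ` (F \<inter> dom_chart c) \<subseteq> img_chart c"
    by (rule img_K_local[OF k])
  obtain \<phi> where \<phi>: "smooth_on (img_chart c) \<phi>" "\<forall>y \<in> snd k ` (F \<inter> dom_chart c). \<phi> (b + i y) = f y"
    using ex[OF ad] by blast
  have "smooth_on (snd k ` (F \<inter> dom_chart c)) f"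
    by (rule smooth_on_cong[OF op _ smooth_on_affine_pullback[OF ad \<phi>(1) op sub]]) (use \<phi>(2) in blast)
  then show "\<exists>U. open U \<and> x \<in> U \<and> smooth_on U f" using op x by blast
qed

lemma riemannian_metric_gF: "riemannian_metric K gF"
  unfolding riemannian_metric_def
proof (intro conjI ballI allI impI)
  fix k x assume k: "k \<in> K" and x: "x \<in> img_chart k"
  obtain c d r i P b where ad: "adapted c d r i P b k" and "open (snd k ` (F \<inter> dom_chart c))"
    and xc: "x \<in> snd k ` (F \<inter> dom_chart c)" and "snd k ` (F \<inter> dom_chart c) \<subseteq> img_chart k"
    and sub: "(\<lambda>y. b + i y) ` snd k ` (F \<inter> dom_chart c) \<subseteq> img_chart c"
    by (rule img_K_local[OF k x])
  interpret chart_metric "img_chart c" "g c"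
    using chart_metricI[OF metric_g adapted_in_A[OF ad]] chart_of_open_img[OF chart_A[OF adapted_in_A[OF ad]]]
    by blast
  have bx: "b + i x \<in> img_chart c" using xc sub by blast
  have i: "linear i" "\<And>w. P (i w) = w" and P: "linear P" using ad unfolding adapted_def by auto
  note gF = adapted_tensors(1)[OF k ad xc]
  note lin = bilinear_h[OF bx]
  show "bilinear (gF k x)"
    unfolding bilinear_def gF
    by (intro conjI allI linearI)
       (simp_all add: linear_add[OF i(1)] linear_scale[OF i(1)] bilinear_ladd[OF lin] bilinear_radd[OF lin]
         bilinear_lmul[OF lin] bilinear_rmul[OF lin])
  show "gF k x u v = gF k x v u" for u v
    unfolding gF by (rule sym_h[OF bx])
  show "gF k x u u > 0" if "u \<noteq> 0" for u
  proof -
    have "i u \<noteq> 0" using that i(2)[of u] linear_0[OF P] by auto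
    then show ?thesis unfolding gF by (rule pos_h[OF bx])
  qed
next
  fix k u v assume k: "k \<in> K"
  show "smooth_on (img_chart k) (\<lambda>x. gF k x u v)"
  proof (rule smooth_on_via_adapted[OF k])
    fix c d r i P b assume ad: "adapted c d r i P b k"
    have "smooth_on (img_chart c) (\<lambda>x. g c x (i u) (i v))"
      using metric_g adapted_in_A[OF ad] unfolding riemannian_metric_def by blast
    then show "\<exists>\<phi>. smooth_on (img_chart c) \<phi> \<and>
        (\<forall>y\<in>snd k ` (F \<inter> dom_chart c). \<phi> (b + i y) = gF k y u v)"
      by (intro exI[of _ "\<lambda>x. g c x (i u) (i v)"]) (simp add: adapted_tensors(1)[OF k ad])
  qed
next
  fix k1 k2 p u v assume k: "k1 \<in> K" "k2 \<in> K" and "p \<in> dom_chart k1 \<inter> dom_chart k2"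
  then have p: "p \<in> dom_chart k1" "p \<in> dom_chart k2" by auto
  obtain c where c: "c \<in> A" "p \<in> dom_chart c" using in_dom_A[OF K_dom_F[OF k(1) p(1)]] by blast
  show "gF k1 (snd k1 p) u v =
      gF k2 (snd k2 p) (differential id k1 k2 p u) (differential id k1 k2 p v)"
    by (simp only: gF_eq[OF k(1) c(1) p(1) c(2)] gF_eq[OF k(2) c(1) p(2) c(2)]
        differential_K_K[OF k c(1) p c(2)])
qed

lemma one_form_\<eta>F: "one_form K \<eta>F"
  unfolding one_form_def
proof (intro conjI ballI allI)
  fix k x assume k: "k \<in> K" and x: "x \<in> img_chart k"
  obtain c d r i P b where ad: "adapted c d r i P b k" and "open (snd k ` (F \<inter> dom_chart c))"
    and xc: "x \<in> snd k ` (F \<inter> dom_chart c)" and "snd k ` (F \<inter> dom_chart c) \<subseteq> img_chart k"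
    and sub: "(\<lambda>y. b + i y) ` snd k ` (F \<inter> dom_chart c) \<subseteq> img_chart c"
    by (rule img_K_local[OF k x])
  have "\<forall>c\<in>A. \<forall>x\<in>img_chart c. linear (\<eta> c x)"
    using one_form_\<eta> unfolding one_form_def by (rule conjunct1)
  moreover have "b + i x \<in> img_chart c" using xc sub by blast
  ultimately have "linear (\<eta> c (b + i x))"
    using adapted_in_A[OF ad] by blast
  moreover have "linear i" using ad unfolding adapted_def by blast
  ultimately have "linear (\<lambda>u. \<eta> c (b + i x) (i u))"
    using linear_compose[of i "\<eta> c (b + i x)"] by (simp add: o_def)
  moreover have "\<eta>F k x = (\<lambda>u. \<eta> c (b + i x) (i u))"
    by (rule ext) (rule adapted_tensors(2)[OF k ad xc])
  ultimately show "linear (\<eta>F k x)" by simp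
next
  fix k u assume k: "k \<in> K"
  show "smooth_on (img_chart k) (\<lambda>x. \<eta>F k x u)"
  proof (rule smooth_on_via_adapted[OF k])
    fix c d r i P b assume ad: "adapted c d r i P b k"
    have "smooth_on (img_chart c) (\<lambda>x. \<eta> c x (i u))"
      using one_form_\<eta> adapted_in_A[OF ad] unfolding one_form_def by blast
    then show "\<exists>\<phi>. smooth_on (img_chart c) \<phi> \<and>
        (\<forall>y\<in>snd k ` (F \<inter> dom_chart c). \<phi> (b + i y) = \<eta>F k y u)"
      by (intro exI[of _ "\<lambda>x. \<eta> c x (i u)"]) (simp add: adapted_tensors(2)[OF k ad])
  qed
next
  fix k1 k2 p u assume k: "k1 \<in> K" "k2 \<in> K" and "p \<in> dom_chart k1 \<inter> dom_chart k2"
  then have p: "p \<in> dom_chart k1" "p \<in> dom_chart k2" by auto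
  obtain c where c: "c \<in> A" "p \<in> dom_chart c" using in_dom_A[OF K_dom_F[OF k(1) p(1)]] by blast
  show "\<eta>F k1 (snd k1 p) u = \<eta>F k2 (snd k2 p) (differential id k1 k2 p u)"
    by (simp only: \<eta>F_eq[OF k(1) c(1) p(1) c(2)] \<eta>F_eq[OF k(2) c(1) p(2) c(2)]
        differential_K_K[OF k c(1) p c(2)])
qed

lemma vector_field_VF: "vector_field K VF"
  unfolding vector_field_def
proof (intro conjI ballI)
  fix k assume k: "k \<in> K"
  show "smooth_on (img_chart k) (VF k)"
  proof (rule smooth_on_via_adapted[OF k])
    fix c d r i P b assume ad: "adapted c d r i P b k"
    have P: "bounded_linear P" "\<And>w. P (i w) = w"
      using ad by (auto simp: adapted_def linear_conv_bounded_linear)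
    note c = adapted_in_A[OF ad]
    have "smooth_on (img_chart c) (V c)" using vector_field_V c unfolding vector_field_def by blast
    \<comment> \<open>\<open>P\<close> undoes \<open>i\<close> and is defined on the whole model
      space, so this is an ambient extension of the components of the restricted field.\<close>
    then have "smooth_on (img_chart c) (\<lambda>x. P (V c x))"
      by (rule smooth_on_linear_compose[OF chart_of_open_img[OF chart_A[OF c]] P(1)])
    then show "\<exists>\<phi>. smooth_on (img_chart c) \<phi> \<and>
        (\<forall>y\<in>snd k ` (F \<inter> dom_chart c). \<phi> (b + i y) = VF k y)"
      by (intro exI[of _ "\<lambda>x. P (V c x)"]) (simp add: adapted_tensors(3)[OF k ad] P(2))
  qed
next
  fix k1 k2 p assume k: "k1 \<in> K" "k2 \<in> K" and "p \<in> dom_chart k1 \<inter> dom_chart k2"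
  then have p: "p \<in> dom_chart k1" "p \<in> dom_chart k2" by auto
  obtain c where c: "c \<in> A" "p \<in> dom_chart c" using in_dom_A[OF K_dom_F[OF k(1) p(1)]] by blast
  have "differential id k2 c p (VF k2 (snd k2 p)) =
      differential id k2 c p (differential id k1 k2 p (VF k1 (snd k1 p)))"
    by (simp only: VF_eq[OF k(2) c(1) p(2) c(2)] VF_eq[OF k(1) c(1) p(1) c(2)]
        differential_K_K[OF k c(1) p c(2), symmetric])
  then show "VF k2 (snd k2 p) = differential id k1 k2 p (VF k1 (snd k1 p))"
    by (rule injD[OF K_inj[OF k(2) c(1) p(2) c(2)]])
qed

lemma soliton_equation_fibre:
  assumes k: "k \<in> K" and x: "x \<in> img_chart k"
  shows "lie_deriv_metric (VF k) (gF k) x u v + 2 * ricci (gF k) x u v + 2 * l * gF k x u v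
      + 2 * m * (\<eta>F k x u * \<eta>F k x v) = 0"
proof -
  obtain c d r i P b where ad: "adapted c d r i P b k" and op: "open (snd k ` (F \<inter> dom_chart c))"
    and xc: "x \<in> snd k ` (F \<inter> dom_chart c)" and subk: "snd k ` (F \<inter> dom_chart c) \<subseteq> img_chart k"
    and sub: "(\<lambda>y. b + i y) ` snd k ` (F \<inter> dom_chart c) \<subseteq> img_chart c"
    by (rule img_K_local[OF k x])
  note c = adapted_in_A[OF ad]
  have lin: "linearizes c d r" and iP: "linear i" "linear P" "\<And>w. P (i w) = w" and ker: "range i = {v. r v = 0}"
    using ad unfolding adapted_def by auto
  have bx: "b + i x \<in> img_chart c" using xc sub by blast
  \<comment> \<open>\<open>gF k\<close> is a metric on all of \<open>img_chart k\<close>, but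
    \<open>c\<close> covers only a part of the fibre; the comparison takes place over the
    coordinates of that part, an open set containing \<open>x\<close>.\<close>
  interpret parallel_slice "img_chart c" "g c" "img_chart k" "gF k" i P b "snd k ` (F \<inter> dom_chart c)"
  proof (intro parallel_slice.intro parallel_slice_axioms.intro)
    show "chart_metric (img_chart c) (g c)"
      by (rule chart_metricI[OF metric_g c chart_of_open_img[OF chart_A[OF c]]])
    show "chart_metric (img_chart k) (gF k)"
      by (rule chart_metricI[OF riemannian_metric_gF k chart_of_open_img[OF K_chart[OF k]]])
    show "christoffel (g c) x u (i w) \<in> range i" if "x \<in> img_chart c" for x u w
      using christoffel_vertical[OF metric_g parallel lin that, of "i w"] ker by blast
    show "b + i y \<in> img_chart c" if "y \<in> snd k ` (F \<inter> dom_chart c)" for y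
      using that sub by blast
    show "gF k y u v = g c (b + i y) (i u) (i v)" if "y \<in> snd k ` (F \<inter> dom_chart c)" for y u v
      by (rule adapted_tensors(1)[OF k ad that])
  qed (use iP op subk in auto)
  have "V c differentiable (at (b + i x))"
    using vector_field_V c bx smooth_on_differentiable unfolding vector_field_def by blast
  moreover have "VF k differentiable (at x)"
    using vector_field_VF k x smooth_on_differentiable unfolding vector_field_def by blast
  ultimately have "lie_deriv_metric (VF k) (gF k) x u v = lie_deriv_metric (V c) (g c) (b + i x) (i u) (i v)"
    by (rule lie_deriv_metric_slice[OF xc]) (rule adapted_tensors(3)[OF k ad])
  then show ?thesis
    using soliton_equation[OF c bx, of "i u" "i v"]
    by (simp only: ricci_slice[OF xc] adapted_tensors(1,2)[OF k ad xc])
qed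

lemma eta_ricci_soliton_fibre: "eta_ricci_soliton (subtopology X F) K gF \<eta>F VF l m"
  unfolding eta_ricci_soliton_def riemannian_manifold_def
  by (intro conjI ballI allI smooth_manifold_K riemannian_metric_gF one_form_\<eta>F vector_field_VF
      soliton_equation_fibre)

lemma restricted_tensors:
  "induced_metric A K g gF" "restricts_one_form A K \<eta> \<eta>F" "restricts_vector_field A K V VF"
  unfolding induced_metric_def restricts_one_form_def restricts_vector_field_def
  by (intro ballI allI; elim IntE; rule gF_eq \<eta>F_eq VF_eq; assumption)+

end

text \<open>A type cannot depend on the dimension of the fibre, so the model space \<open>'c\<close>
  is a type parameter tied to it by an equation. The total space has larger dimension than the base,
  hence the difference is positive, as is the dimension of every \<open>euclidean_space\<close>
  type.\<close>

theorem theorem4p3: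
  fixes X :: "'m topology" and A :: "('m, 'a::euclidean_space) chart set"
    and g :: "('m, 'a) metric" and \<eta> :: "('m, 'a) oneform" and V :: "('m, 'a) vfield"
    and l m :: real
    and Y :: "'n topology" and B :: "('n, 'b::real_normed_vector) chart set"
    and h :: "('n, 'b) metric" and \<pi> :: "'m \<Rightarrow> 'n" and q :: 'n
  assumes "eta_ricci_soliton X A g \<eta> V l m"
    and "riemannian_submersion X A g Y B h \<pi>"
    and "vertical_field A B \<pi> V"
    and "vertical_parallel A g B \<pi>"
    and "q \<in> topspace Y"
    and "DIM('c::euclidean_space) = DIM('a) - dim (UNIV :: 'b set)"
  shows "submanifold_eta_ricci_soliton TYPE('c) X A g \<eta> V {p \<in> topspace X. \<pi> p = q}"
proof -
  let ?F = "{p \<in> topspace X. \<pi> p = q}"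
  let ?K = "submanifold_atlas X A ?F :: ('m, 'c) chart set"
  have sub: "submersion X A Y B \<pi>"
    using assms(2) unfolding riemannian_submersion_def riemannian_manifold_def
    by (intro submersion.intro) blast+
  interpret soliton_fibre X A Y B \<pi> q ?F ?K g \<eta> V l m
    by (intro soliton_fibre.intro submersion_fibre.intro submersion_fibre_axioms.intro
        soliton_fibre_axioms.intro sub assms) simp_all
  show ?thesis
    unfolding submanifold_eta_ricci_soliton_def Let_def
    using restricted_tensors eta_ricci_soliton_fibre by blast
qed

end
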